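(* Let $1\le p<\infty$, $0<r<\infty$, $0<q\le\infty$, $\frac1s:=\left(\frac1r-\frac1p\right)_+$. Let $u,v,w\in\mathfrak M^+$ with $0<\int_t^\infty u<\infty$ for all $t>0$, and let $k$ be an Oinarov kernel with constant $D$. Let $C_{\mathfrak S}\in[0,\infty]$ be the least constant such that $\|\mathfrak Sf\|_{L^r_u}\le C_{\mathfrak S}\|f\|_{L^p_v}$ for all $f\in\mathfrak M^+$, where $$(\mathfrak Sf)(x)=\left(\int_0^x k(x,y)w(y)\left(\int_0^y f(z)\,dz\right)^q dy\right)^{1/q}\ (q<\infty),\qquad (\mathfrak Sf)(x)=\operatorname*{ess\,sup}_{y\in(0,x)} k(x,y)w(y)\int_0^y f(z)\,dz\ (q=\infty).$$ If $q<\infty$, let $\mathbf B_0,\mathbf B_1\in[0,\infty]$ be the least constants such that for all $f\in\mathfrak M^+$ $$\left(\int_0^\infty u(x)\left(\int_{\zeta^{-3}(x)}^x k(x,y)w(y)\,dy\right)^{\frac rq}\left(\int_0^{\zeta^{-3}(x)} f\right)^r dx\right)^{\frac1r}\le \mathbf B_0\|f\|_{L^p_v},$$ $$\left(\int_0^\infty u(x)[k(x,\zeta^{-2}(x))]^{\frac rq}\left(\int_0^{\zeta^{-2}(x)} w(y)\left(\int_0^y f\right)^q dy\right)^{\frac rq} dx\right)^{\frac1r}\le \mathbf B_1\|f\|_{L^p_v};$$ if $q=\infty$, let $\mathbf B_0,\mathbf B_1\in[0,\infty]$ be the least constants such that for all $f\in\mathfrak M^+$ $$\left(\int_0^\infty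 u(x)\left[\operatorname*{ess\,sup}_{y\in(\zeta^{-3}(x),x)}k(x,y)w(y)\right]^r\left(\int_0^{\zeta^{-3}(x)} f\right)^r dx\right)^{\frac1r}\le \mathbf B_0\|f\|_{L^p_v},$$ $$\left(\int_0^\infty u(x)[k(x,\zeta^{-2}(x))]^r\left(\operatorname*{ess\,sup}_{y\in(0,\zeta^{-2}(x))}w(y)\int_0^y f\right)^r dx\right)^{\frac1r}\le \mathbf B_1\|f\|_{L^p_v}.$$ Let $$\mathbf B_2:=\begin{cases}\displaystyle\sup_{t\in(0,\infty)}\left(\int_t^\infty u\right)^{\frac1r}\|\mathfrak H^*_t\|_{L^p_v\to L^q_{w(\cdot)k(t,\cdot)}},& p\le r,\\[2mm] \displaystyle\left(\int_0^\infty u(x)\left(\int_x^\infty u\right)^{\frac sp}\|\mathfrak H^*_{\zeta^{-1}(x),\zeta^2(x)}\|^s_{L^p_v\to L^q_{w(\cdot)k(\zeta^2(x),\cdot)}}\,dx\right)^{\frac1s},& r<p.\end{cases}$$ Then $C_{\mathfrak S}<\infty$ if and only if $\mathbf B_0$, $\mathbf B_1$ and $\mathbf B_2$ are all finite. Moreover, $C_{\mathfrak S}\approx \mathbf B_0+\mathbf B_1+\mathbf B_2$, i.e. each side is bounded by the other times a positive constant depending only on $p,q,r,D$.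
   Context: $\mathfrak M$ is the set of measurable functions on $[0,\infty)$, $\mathfrak M^+\subset\mathfrak M$ the non-negative ones. For $0<p<\infty$, $v\in\mathfrak M^+$: $\|f\|_{L^p_v}:=\left(\int_0^\infty|f|^pv\right)^{1/p}$; for $p=\infty$: $\|f\|_{L^\infty_v}:=\operatorname{ess\,sup}_{x\ge0}v(x)|f(x)|$. $L^q_{w(\cdot)k(t,\cdot)}$ is the weighted space with weight $y\mapsto w(y)k(t,y)$. For a positive operator $H$ on $\mathfrak M^+$ and a weight $\omega$, $\|H\|_{L^p_v\to L^q_\omega}\in[0,\infty]$ is the least $C$ with $\|Hf\|_{L^q_\omega}\le C\|f\|_{L^p_v}$ for all $f\in\mathfrak M^+$. Expressions $0\cdot\infty$, $\frac\infty\infty$, $\frac00$ are taken to be $0$; an essential supremum over an empty set is $0$. $(a)_+=\max(a,0)$ ($s$ is used only when $r<p$). Oinarov kernel with constant $D\ge1$: a Borel function $k(x,y)\ge0$ on $[0,\infty)^2$ with $k(x,y)=0$ if $x<y$ and $\frac1D(k(x,z)+k(z,y))\le k(x,y)\le D(k(x,z)+k(z,y))$ for all $x\ge z\ge y\ge0$. The functions $\zeta,\zeta^{-1}:[0,\infty)\to[0,\infty)$ are defined (with $\sup\varnothing=0$) by $$\zeta(x):=\sup\left\{y>0:\int_y^\infty u\ge\tfrac12\int_x^\infty u\right\},\qquad \zeta^{-1}(x):=\sup\left\{y>0:\int_y^\infty u\ge2\int_x^\infty u\right\},$$ and $\zeta^{m}$, $\zeta^{-m}$ are the $m$-fold compositions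 of $\zeta$ and of $\zeta^{-1}$, respectively. For $0\le c<d<\infty$ and $f\in\mathfrak M^+$: $$(\mathfrak H^*_{c,d}f)(x):=\chi_{(c,d]}(x)\int_{\zeta^{-1}(c)}^x f(z)\,dz,\qquad (\mathfrak H^*_df)(x):=\chi_{(0,d]}(x)\int_0^x f(z)\,dz.$$ *)

theory Defs
  imports "HOL-Analysis.Analysis" "HOL-Probability.Essential_Supremum"
begin

text \<open>
  Functions on the half-line are rendered as total functions on the reals of which only the
  values on \<open>{0..}\<close> matter: measurability, integrals and essential suprema are all taken on
  subsets of \<open>{0..}\<close>. All quantities live in \<^typ>\<open>ennreal\<close>, where \<open>0 * \<infinity> = 0\<close>.
\<close>

text \<open>Powers of extended non-negative reals; only meant for exponents \<open>a > 0\<close>.\<close>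

definition epowr :: "ennreal \<Rightarrow> real \<Rightarrow> ennreal"  (infixr "epowr" 80)
  where "x epowr a = (if x = \<infinity> then \<infinity> else ennreal (enn2real x powr a))"

definition Mplus :: "(real \<Rightarrow> ennreal) set"
  where "Mplus = borel_measurable (lebesgue_on {0..})"

text \<open>The weight multiplies \<open>|f|^p\<close> for finite \<open>p\<close>, but \<open>|f|\<close> itself for \<open>p = \<infinity>\<close>.\<close>

definition wnorm :: "ennreal \<Rightarrow> (real \<Rightarrow> ennreal) \<Rightarrow> (real \<Rightarrow> ennreal) \<Rightarrow> ennreal"
  where "wnorm p v f =
    (if p = \<infinity> then esssup (lebesgue_on {0..}) (\<lambda>x. v x * f x)
     else (\<integral>\<^sup>+x\<in>{0..}. (f x epowr enn2real p) * v x \<partial>lebesgue) epowr (1 / enn2real p))"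

text \<open>
  The infimum over the empty set is \<open>\<infinity>\<close>. Under \<open>0 * \<infinity> = 0\<close> the infimum can fail to be attained
  only when it is \<open>0\<close>, because of functions of infinite norm; it is then still the intended
  constant.
\<close>

definition least_const ::
    "ennreal \<Rightarrow> (real \<Rightarrow> ennreal) \<Rightarrow> ((real \<Rightarrow> ennreal) \<Rightarrow> ennreal) \<Rightarrow> ennreal"
  where "least_const p v N = Inf {C. \<forall>f\<in>Mplus. N f \<le> C * wnorm p v f}"

definition op_norm ::
    "((real \<Rightarrow> ennreal) \<Rightarrow> (real \<Rightarrow> ennreal)) \<Rightarrow> ennreal \<Rightarrow> (real \<Rightarrow> ennreal)
      \<Rightarrow> ennreal \<Rightarrow> (real \<Rightarrow> ennreal) \<Rightarrow> ennreal"
  where "op_norm H p v q \<omega> = least_const p v (\<lambda>f. wnorm q \<omega> (H f))"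

definition oinarov_kernel :: "real \<Rightarrow> (real \<Rightarrow> real \<Rightarrow> real) \<Rightarrow> bool"
  where "oinarov_kernel D k \<longleftrightarrow>
    (\<lambda>(x, y). k x y) \<in> borel_measurable (restrict_space borel ({0..} \<times> {0..})) \<and>
    (\<forall>x\<ge>0. \<forall>y\<ge>0. 0 \<le> k x y) \<and>
    (\<forall>x y. 0 \<le> x \<and> x < y \<longrightarrow> k x y = 0) \<and>
    (\<forall>x y z. x \<ge> z \<and> z \<ge> y \<and> y \<ge> 0 \<longrightarrow>
       1 / D * (k x z + k z y) \<le> k x y \<and> k x y \<le> D * (k x z + k z y))"

definition tail :: "(real \<Rightarrow> ennreal) \<Rightarrow> real \<Rightarrow> ennreal"
  where "tail u x = (\<integral>\<^sup>+y\<in>{x..}. u y \<partial>lebesgue)"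

definition prim :: "(real \<Rightarrow> ennreal) \<Rightarrow> real \<Rightarrow> ennreal"
  where "prim f x = (\<integral>\<^sup>+z\<in>{0..x}. f z \<partial>lebesgue)"

text \<open>
  On the reals, \<open>Sup {}\<close> is not the intended value \<open>0\<close>.
\<close>

definition Sup0 :: "real set \<Rightarrow> real"
  where "Sup0 A = (if A = {} then 0 else Sup A)"

definition zeta :: "(real \<Rightarrow> ennreal) \<Rightarrow> real \<Rightarrow> real"
  where "zeta u x = Sup0 {y. 0 < y \<and> tail u y \<ge> (1 / 2) * tail u x}"

text \<open>In general not the inverse function of \<open>zeta u\<close>; the name follows the notation \<open>\<zeta>\<^sup>-\<^sup>1\<close>.\<close>

definition zeta_inv :: "(real \<Rightarrow> ennreal) \<Rightarrow> real \<Rightarrow> real"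
  where "zeta_inv u x = Sup0 {y. 0 < y \<and> tail u y \<ge> 2 * tail u x}"

definition H_block ::
    "(real \<Rightarrow> ennreal) \<Rightarrow> real \<Rightarrow> real \<Rightarrow> (real \<Rightarrow> ennreal) \<Rightarrow> (real \<Rightarrow> ennreal)"
  where "H_block u c d f = (\<lambda>x. indicator {c<..d} x * (\<integral>\<^sup>+z\<in>{zeta_inv u c..x}. f z \<partial>lebesgue))"

definition H_cut :: "real \<Rightarrow> (real \<Rightarrow> ennreal) \<Rightarrow> (real \<Rightarrow> ennreal)"
  where "H_cut d f = (\<lambda>x. indicator {0<..d} x * prim f x)"

definition S_op ::
    "ennreal \<Rightarrow> (real \<Rightarrow> real \<Rightarrow> real) \<Rightarrow> (real \<Rightarrow> ennreal) \<Rightarrow> (real \<Rightarrow> ennreal) \<Rightarrow> (real \<Rightarrow> ennreal)"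
  where "S_op q k w f = (\<lambda>x.
    if q = \<infinity> then esssup (lebesgue_on {0<..<x}) (\<lambda>y. ennreal (k x y) * w y * prim f y)
    else (\<integral>\<^sup>+y\<in>{0..x}. ennreal (k x y) * w y * (prim f y epowr enn2real q) \<partial>lebesgue)
           epowr (1 / enn2real q))"

definition C_S ::
    "real \<Rightarrow> real \<Rightarrow> ennreal \<Rightarrow> (real \<Rightarrow> ennreal) \<Rightarrow> (real \<Rightarrow> ennreal) \<Rightarrow> (real \<Rightarrow> ennreal)
      \<Rightarrow> (real \<Rightarrow> real \<Rightarrow> real) \<Rightarrow> ennreal"
  where "C_S p r q u v w k = op_norm (S_op q k w) (ennreal p) v (ennreal r) u"

definition B0 ::
    "real \<Rightarrow> real \<Rightarrow> ennreal \<Rightarrow> (real \<Rightarrow> ennreal) \<Rightarrow> (real \<Rightarrow> ennreal) \<Rightarrow> (real \<Rightarrow> ennreal)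
      \<Rightarrow> (real \<Rightarrow> real \<Rightarrow> real) \<Rightarrow> ennreal"
  where "B0 p r q u v w k = least_const (ennreal p) v (\<lambda>f.
    if q = \<infinity> then
      (\<integral>\<^sup>+x\<in>{0..}.
         u x
         * (esssup (lebesgue_on {(zeta_inv u ^^ 3) x<..<x}) (\<lambda>y. ennreal (k x y) * w y) epowr r)
         * (prim f ((zeta_inv u ^^ 3) x) epowr r) \<partial>lebesgue) epowr (1 / r)
    else
      (\<integral>\<^sup>+x\<in>{0..}.
         u x
         * ((\<integral>\<^sup>+y\<in>{(zeta_inv u ^^ 3) x..x}. ennreal (k x y) * w y \<partial>lebesgue)
              epowr (r / enn2real q))
         * (prim f ((zeta_inv u ^^ 3) x) epowr r) \<partial>lebesgue) epowr (1 / r))"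

definition B1 ::
    "real \<Rightarrow> real \<Rightarrow> ennreal \<Rightarrow> (real \<Rightarrow> ennreal) \<Rightarrow> (real \<Rightarrow> ennreal) \<Rightarrow> (real \<Rightarrow> ennreal)
      \<Rightarrow> (real \<Rightarrow> real \<Rightarrow> real) \<Rightarrow> ennreal"
  where "B1 p r q u v w k = least_const (ennreal p) v (\<lambda>f.
    if q = \<infinity> then
      (\<integral>\<^sup>+x\<in>{0..}.
         u x
         * (ennreal (k x ((zeta_inv u ^^ 2) x)) epowr r)
         * (esssup (lebesgue_on {0<..<(zeta_inv u ^^ 2) x}) (\<lambda>y. w y * prim f y) epowr r)
         \<partial>lebesgue) epowr (1 / r)
    else
      (\<integral>\<^sup>+x\<in>{0..}.
         u x
         * (ennreal (k x ((zeta_inv u ^^ 2) x)) epowr (r / enn2real q))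
         * ((\<integral>\<^sup>+y\<in>{0..(zeta_inv u ^^ 2) x}. w y * (prim f y epowr enn2real q) \<partial>lebesgue)
              epowr (r / enn2real q)) \<partial>lebesgue) epowr (1 / r))"

definition B2 ::
    "real \<Rightarrow> real \<Rightarrow> ennreal \<Rightarrow> (real \<Rightarrow> ennreal) \<Rightarrow> (real \<Rightarrow> ennreal) \<Rightarrow> (real \<Rightarrow> ennreal)
      \<Rightarrow> (real \<Rightarrow> real \<Rightarrow> real) \<Rightarrow> ennreal"
  where "B2 p r q u v w k =
    (if p \<le> r then
       (SUP t\<in>{0<..}. (tail u t epowr (1 / r))
          * op_norm (H_cut t) (ennreal p) v q (\<lambda>y. w y * ennreal (k t y)))
     else
       (let s = 1 / max (1 / r - 1 / p) 0 in
         (\<integral>\<^sup>+x\<in>{0..}.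
            u x
            * (tail u x epowr (s / p))
            * (op_norm (H_block u (zeta_inv u x) ((zeta u ^^ 2) x)) (ennreal p) v q
                 (\<lambda>y. w y * ennreal (k ((zeta u ^^ 2) x) y)) epowr s) \<partial>lebesgue) epowr (1 / s)))"

end

theory Submission
  imports Defs
begin

text \<open>
  Write \<open>h\<close> for the power of \<open>S f\<close> with the outer root removed and \<open>z i\<close> for \<open>(zeta_inv u ^^ i) x\<close>. The kernel
  inequality at the point \<open>z n\<close> gives \<open>h x \<le> D * (E x (z n) + h (z n))\<close>, where \<open>E x (z n)\<close> is the part of
  \<open>h x\<close> over \<open>(z n, x)\<close> plus \<open>k x (z n)\<close> times the weighted integral over \<open>(0, z n)\<close>; it is
  bounded by a sum of elementary terms \<open>E (z (2 * j)) (z (2 * j + 2))\<close>. Since \<open>zeta_inv u\<close> pushes the measure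
  \<open>u dx\<close> to at most half of it, the term \<open>h (z n)\<close> contributes only \<open>2\<^sup>-\<^sup>n\<close> times the integral for \<open>h\<close> and is
  absorbed for large \<open>n\<close>. The elementary term splits into the integrands of \<open>B0\<close> and \<open>B1\<close> and a local
  part, which is summed over the dyadic levels of \<open>tail u\<close> and estimated by \<open>B2\<close>. Conversely, \<open>B0\<close> and \<open>B1\<close>
  are bounded pointwise, and for \<open>r < p\<close> the bound on \<open>B2\<close> follows by testing with a supremum of
  near-extremal functions of the blocks and \<open>l\<^sup>p\<close> duality.
\<close>

section \<open>Powers of extended non-negative reals and least constants\<close>

text \<open>Finite and infinite \<open>q\<close> are treated together: the inner integral or
  essential supremum is replaced by a positive functional with a few axioms, and only its
  subadditivity, homogeneity and monotonicity enter the estimates. Two features of the weight shape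
  the argument. Since \<open>tail u\<close> may have flat pieces, levels are located by extremal
  points, never by an inverse function. If \<open>tail u 0\<close> is finite,
  \<open>zeta_inv u\<close> sends a set of positive measure to 0, so the halving of the measure is
  used for integrands that vanish at 0. The levels of \<open>tail u\<close> have ratio
  \<open>sqrt 2\<close> for the following reason. A block that dominates the local part at every
  point of a level must be based at a point whose tail lies between twice the largest and four times
  the smallest value of that level. For ratio 2 this window would be empty. Least constants are
  infima that need not be admissible, so estimates are proved for strictly larger constants, which
  then decrease to the infimum. For \<open>p \<le> r\<close> the local sums are controlled by the
  embedding of \<open>l^p\<close> into \<open>l^r\<close>, for \<open>r < p\<close> by Hoelder
  duality; this is the reason for the two forms of \<open>B2\<close>.\<close>

lemma epowr_top [simp]: "\<infinity> epowr a = \<infinity>" "top epowr a = top"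
  by (simp_all add: epowr_def)

lemma epowr_ennreal: "0 \<le> x \<Longrightarrow> ennreal x epowr a = ennreal (x powr a)"
  by (simp add: epowr_def)

lemma epowr_0 [simp]: "0 epowr a = 0"
  by (simp add: epowr_def)

lemma epowr_1 [simp]: "x epowr 1 = x"
  by (cases x) (auto simp: epowr_def)

lemma epowr_one [simp]: "1 epowr a = 1"
  by (simp add: epowr_def)

lemma epowr_mono: "x \<le> y \<Longrightarrow> 0 < a \<Longrightarrow> x epowr a \<le> y epowr a"
  by (cases x; cases y) (auto simp: epowr_def top_unique intro!: ennreal_leI powr_mono2)

lemma epowr_mult:
  assumes "0 < a" shows "(x * y) epowr a = (x epowr a) * (y epowr a)"
proof (cases "x = \<infinity> \<or> y = \<infinity>")
  case True
  have "(\<infinity> * z) epowr a = \<infinity> * (z epowr a)" for z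
    using assms by (cases "z = 0"; cases z) (auto simp: epowr_def ennreal_top_mult top_unique)
  with True show ?thesis by (metis epowr_top(1) mult.commute)
next
  case False
  then obtain r s where "x = ennreal r" "0 \<le> r" "y = ennreal s" "0 \<le> s"
    by (cases x; cases y) auto
  then show ?thesis by (simp add: epowr_ennreal powr_mult flip: ennreal_mult)
qed

lemma epowr_epowr: "0 < a \<Longrightarrow> 0 < b \<Longrightarrow> (x epowr a) epowr b = x epowr (a * b)"
  by (cases x) (auto simp: epowr_def powr_powr)

lemma epowr_inverse [simp]: "0 < a \<Longrightarrow> (x epowr a) epowr (1 / a) = x"
    "0 < a \<Longrightarrow> (x epowr (1 / a)) epowr a = x"
  by (simp_all add: epowr_epowr)

lemma epowr_le_iff: "0 < a \<Longrightarrow> x epowr a \<le> y epowr a \<longleftrightarrow> x \<le> y"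
  by (metis epowr_inverse(1) epowr_mono zero_less_divide_1_iff)

lemma epowr_le_iff': "0 < a \<Longrightarrow> x epowr (1 / a) \<le> y \<longleftrightarrow> x \<le> y epowr a"
  by (metis epowr_inverse(2) epowr_le_iff)

lemma epowr_eq_top_iff [simp]: "x epowr a = top \<longleftrightarrow> x = top"
  by (cases x) (auto simp: epowr_def)

lemma epowr_less_top [simp]: "x < top \<Longrightarrow> x epowr a < top"
  by (cases x) (auto simp: epowr_def)

lemma epowr_eq_0_iff [simp]: "0 < a \<Longrightarrow> x epowr a = 0 \<longleftrightarrow> x = 0"
  by (cases x) (auto simp: epowr_def)

lemma epowr_add: "x < top \<Longrightarrow> (x epowr a) * (x epowr b) = x epowr (a + b)"
  by (cases x) (auto simp: epowr_ennreal powr_add simp flip: ennreal_mult)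

lemma epowr_add_pos:
  assumes "0 < a" "0 < b" shows "(x epowr a) * (x epowr b) = x epowr (a + b)"
  by (cases "x = top") (auto simp: epowr_add less_top[symmetric])

lemma epowr_mono_exponent:
  assumes "x \<le> 1" "0 < a" "a \<le> b" shows "x epowr b \<le> x epowr a"
proof -
  obtain r where r: "x = ennreal r" "0 \<le> r" "r \<le> 1"
    using assms(1) by (cases x) (auto simp: top_unique)
  then show ?thesis
    using assms by (cases "r = 0") (auto simp: epowr_ennreal intro!: ennreal_leI powr_mono')
qed

lemma measurable_epowr [measurable]:
  assumes [measurable]: "f \<in> borel_measurable M"
  shows "(\<lambda>x. f x epowr a) \<in> borel_measurable M"
  unfolding epowr_def by measurable

lemma epowr_max: "0 < a \<Longrightarrow> max x y epowr a = max (x epowr a) (y epowr a)"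
  by (auto simp: max_def epowr_le_iff)

text \<open>Bounding every summand by the largest one gives a constant valid for all
  \<open>a > 0\<close>, so concave and convex powers need no separate treatment.\<close>

lemma epowr_sum_le:
  assumes "finite A" "A \<noteq> {}" "0 < a"
  shows "(\<Sum>i\<in>A. x i) epowr a \<le> ennreal (real (card A) powr a) * (\<Sum>i\<in>A. x i epowr a)"
proof -
  obtain m where m: "m \<in> A" "\<And>i. i \<in> A \<Longrightarrow> x i \<le> x m"
    using finite_has_maximal[of "x ` A"] assms
    by (metis (no_types, lifting) Max_ge Max_in finite_imageI imageE image_eqI image_is_empty)
  have "(\<Sum>i\<in>A. x i) \<le> of_nat (card A) * x m"
    using sum_bounded_above[of A x "x m"] m by auto
  then have "(\<Sum>i\<in>A. x i) epowr a \<le> (of_nat (card A) * x m) epowr a"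
    using assms by (intro epowr_mono)
  also have "\<dots> = ennreal (real (card A) powr a) * (x m epowr a)"
    using assms by (simp add: epowr_mult epowr_ennreal flip: ennreal_of_nat_eq_real_of_nat)
      (simp add: ennreal_of_nat_eq_real_of_nat epowr_ennreal)
  also have "\<dots> \<le> ennreal (real (card A) powr a) * (\<Sum>i\<in>A. x i epowr a)"
    using assms m by (intro mult_left_mono) (auto intro: member_le_sum)
  finally show ?thesis .
qed

lemma epowr_add_le:
  assumes "0 < a" shows "(x + y) epowr a \<le> ennreal (2 powr a) * (x epowr a + y epowr a)"
  using epowr_sum_le[of "{False, True}" a "\<lambda>b. if b then y else x"] assms by simp

lemma epowr_SUP_le:
  assumes "0 < a" shows "(SUP i\<in>I. x i) epowr a \<le> (SUP i\<in>I. x i epowr a)"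
proof -
  have "(SUP i\<in>I. x i) \<le> (SUP i\<in>I. x i epowr a) epowr (1 / a)"
    by (rule SUP_least) (metis SUP_upper assms epowr_inverse(1) epowr_mono zero_less_divide_1_iff)
  from epowr_mono[OF this assms] show ?thesis using assms by simp
qed

text \<open>A substitute for Young's inequality: both factors are at most a power of \<open>max (x epowr a) (y epowr b)\<close>.\<close>

lemma mult_le_epowr_add:
  assumes "0 < a" "0 < b" "1 / a + 1 / b = 1"
  shows "x * y \<le> (x epowr a) + (y epowr b)"
proof -
  define m where "m = max (x epowr a) (y epowr b)"
  have "x \<le> m epowr (1 / a)" "y \<le> m epowr (1 / b)"
    using assms unfolding m_def by (auto simp: epowr_max)
  then have "x * y \<le> (m epowr (1 / a)) * (m epowr (1 / b))"
    by (rule mult_mono) auto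
  also have "\<dots> = m"
    using assms by (simp add: epowr_add_pos)
  also have "\<dots> \<le> (x epowr a) + (y epowr b)"
    unfolding m_def by auto
  finally show ?thesis .
qed

section \<open>Homogeneous functionals, least constants and reduction to the unit ball\<close>

definition homogeneous :: "((real \<Rightarrow> ennreal) \<Rightarrow> ennreal) \<Rightarrow> bool"
  where "homogeneous N \<longleftrightarrow> (\<forall>f\<in>Mplus. \<forall>a>0. N (\<lambda>x. ennreal a * f x) = ennreal a * N f)"

lemma Mplus_cmult: "f \<in> Mplus \<Longrightarrow> (\<lambda>x. ennreal a * f x) \<in> Mplus"
  unfolding Mplus_def by measurable

lemma wnorm_finite_exponent:
  assumes "0 < p"
  shows "wnorm (ennreal p) v f = (\<integral>\<^sup>+x\<in>{0..}. (f x epowr p) * v x \<partial>lebesgue) epowr (1 / p)"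
  using assms by (simp add: wnorm_def)

lemma nn_integral_Mplus_eq:
  "(\<integral>\<^sup>+x\<in>{0..}. g x \<partial>lebesgue) = (\<integral>\<^sup>+x. g x \<partial>lebesgue_on {0::real..})"
  by (subst nn_integral_restrict_space) auto

lemma wnorm_homogeneous:
  assumes "0 < p" "v \<in> Mplus"
  shows "homogeneous (wnorm (ennreal p) v)"
  unfolding homogeneous_def
proof (intro ballI allI impI)
  fix f :: "real \<Rightarrow> ennreal" and a :: real
  assume f: "f \<in> Mplus" and a: "a > 0"
  have [measurable]: "f \<in> borel_measurable (lebesgue_on {0..})" "v \<in> borel_measurable (lebesgue_on {0..})"
    using f assms by (auto simp: Mplus_def)
  have "(\<integral>\<^sup>+x\<in>{0..}. ((ennreal a * f x) epowr p) * v x \<partial>lebesgue)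
      = ennreal (a powr p) * (\<integral>\<^sup>+x\<in>{0..}. (f x epowr p) * v x \<partial>lebesgue)"
    using assms a unfolding nn_integral_Mplus_eq
    by (subst nn_integral_cmult[symmetric]) (auto simp: epowr_mult epowr_ennreal mult.assoc)
  then show "wnorm (ennreal p) v (\<lambda>x. ennreal a * f x) = ennreal a * wnorm (ennreal p) v f"
    using assms a by (simp add: wnorm_finite_exponent epowr_mult epowr_ennreal powr_powr)
qed

lemma least_const_mono:
  assumes "0 < K" "\<And>f. f \<in> Mplus \<Longrightarrow> N1 f \<le> ennreal K * N2 f"
  shows "least_const p v N1 \<le> ennreal K * least_const p v N2"
proof -
  have "least_const p v N1 / ennreal K \<le> C" if C: "\<forall>f\<in>Mplus. N2 f \<le> C * wnorm p v f" for C
  proof -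
    have "N1 f \<le> ennreal K * C * wnorm p v f" if "f \<in> Mplus" for f
    proof -
      have "N1 f \<le> ennreal K * N2 f" using assms that by auto
      also have "\<dots> \<le> ennreal K * (C * wnorm p v f)"
        using C that by (intro mult_left_mono) auto
      finally show ?thesis by (simp add: mult.assoc)
    qed
    then have "least_const p v N1 \<le> ennreal K * C"
      unfolding least_const_def by (intro Inf_lower) auto
    then show ?thesis
      using assms(1) by (auto simp: divide_le_posI_ennreal mult.commute)
  qed
  then have "least_const p v N1 / ennreal K \<le> least_const p v N2"
    unfolding least_const_def[of p v N2] by (intro Inf_greatest) auto
  then have "ennreal K * (least_const p v N1 / ennreal K) \<le> ennreal K * least_const p v N2"
    by (intro mult_left_mono) auto
  then show ?thesis
    using assms(1) by (simp add: ennreal_times_divide mult_divide_eq_ennreal mult.commute[of "ennreal K" "least_const p v N1"])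
qed

text \<open>Admissible constants form an up-set whose infimum may fail to belong to it; hence the
  strict inequality, and hence the auxiliary constants \<open>C\<close> and \<open>B\<close> above
  the least ones in all later arguments.\<close>

lemma least_const_le_imp:
  assumes "least_const p v N < C" "f \<in> Mplus"
  shows "N f \<le> C * wnorm p v f"
proof -
  obtain C' where "C' < C" "\<forall>f\<in>Mplus. N f \<le> C' * wnorm p v f"
    using assms(1) unfolding least_const_def Inf_less_iff by auto
  then show ?thesis
    using assms(2) by (meson dual_order.trans less_imp_le mult_right_mono zero_le)
qed

lemma least_const_unit_ball:
  assumes "homogeneous N" "0 < p" "v \<in> Mplus" "0 < C" "C < top"
    and le: "\<And>f. f \<in> Mplus \<Longrightarrow> wnorm (ennreal p) v f \<le> 1 \<Longrightarrow> N f \<le> C"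
  shows "least_const (ennreal p) v N \<le> C"
  unfolding least_const_def
proof (intro Inf_lower CollectI ballI)
  fix f assume f: "f \<in> Mplus"
  note hom = wnorm_homogeneous[OF assms(2,3)]
  consider "wnorm (ennreal p) v f = top" | "wnorm (ennreal p) v f = 0"
    | W where "wnorm (ennreal p) v f = ennreal W" "0 < W"
    by (cases "wnorm (ennreal p) v f") (fastforce simp: ennreal_eq_0_iff not_less)+
  then show "N f \<le> C * wnorm (ennreal p) v f"
  proof cases
    case 1
    \<comment> \<open>Positivity of \<open>C\<close> makes the right-hand side infinite; with
      \<open>C = 0\<close> it would be 0.\<close>
    then show ?thesis using assms(4) by (simp add: ennreal_mult_top)
  next
    case 2
    \<comment> \<open>A function of norm zero stays in the unit ball under any scaling, so
      homogeneity and \<open>C < top\<close> force \<open>N f = 0\<close>, as the vanishing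
      right-hand side demands.\<close>
    have bound: "ennreal (real n + 1) * N f \<le> C" for n :: nat
    proof -
      have "N (\<lambda>x. ennreal (real n + 1) * f x) \<le> C"
        using hom f 2 by (intro le) (auto simp: homogeneous_def Mplus_cmult simp del: ennreal_plus)
      then show ?thesis using assms(1) f by (auto simp: homogeneous_def simp del: ennreal_plus)
    qed
    obtain c where c: "C = ennreal c" "0 \<le> c"
      using assms(5) by (cases C) auto
    have "N f \<noteq> top"
      using bound[of 0] assms(5) by (auto simp: top_unique)
    then obtain y where y: "N f = ennreal y" "0 \<le> y"
      by (cases "N f") auto
    have "(real n + 1) * y \<le> c" for n
      using bound[of n] y c by (simp flip: ennreal_mult del: ennreal_plus)
    then have "y \<le> 0"
      using reals_Archimedean3[of y] by (meson add_increasing2 dual_order.trans linorder_not_less mult_right_mono not_less zero_le_one order_refl y(2) less_imp_le)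
    then show ?thesis using y by simp
  next
    case (3 W)
    have "N (\<lambda>x. ennreal (1 / W) * f x) \<le> C"
      using hom f 3 by (intro le) (auto simp: homogeneous_def Mplus_cmult simp flip: ennreal_mult)
    then have "ennreal (1 / W) * N f \<le> C"
      using assms(1) f 3 by (auto simp: homogeneous_def)
    then have "ennreal W * (ennreal (1 / W) * N f) \<le> ennreal W * C"
      by (intro mult_left_mono) auto
    then show ?thesis
      using 3 by (simp add: mult.commute flip: mult.assoc ennreal_mult)
  qed
qed

section \<open>The half-line weight and its dyadic shifts\<close>

lemma Mplus_indicator:
  "f \<in> Mplus \<longleftrightarrow> (\<lambda>x. f x * indicator {0..} x) \<in> borel_measurable lebesgue"
  unfolding Mplus_def by (rule borel_measurable_restrict_space_iff_ennreal) auto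

text \<open>The measure \<open>u dx\<close>, carried by the Borel sets: composition with
  \<open>zeta_inv u\<close> preserves Borel measurability but not Lebesgue measurability in general,
  and Borel measures can be compared on half-lines.\<close>

definition half_line_measure :: "(real \<Rightarrow> ennreal) \<Rightarrow> real measure"
  where "half_line_measure u = distr (density lebesgue (\<lambda>x. u x * indicator {0..} x)) borel (\<lambda>x. x)"

lemma sets_half_line_measure [simp, measurable_cong]: "sets (half_line_measure u) = sets borel"
  and space_half_line_measure [simp]: "space (half_line_measure u) = UNIV"
  by (simp_all add: half_line_measure_def)

lemma lebesgue_measurable_of_borel [measurable (raw)]:
  "f \<in> borel_measurable borel \<Longrightarrow> f \<in> borel_measurable lebesgue"
  by (simp add: borel_measurable_if_D measurable_completion)

lemma nn_integral_half_line_measure: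
  assumes "u \<in> Mplus" and [measurable]: "g \<in> borel_measurable borel"
  shows "(\<integral>\<^sup>+x. g x \<partial>half_line_measure u) = (\<integral>\<^sup>+x\<in>{0..}. u x * g x \<partial>lebesgue)"
proof -
  have [measurable]: "(\<lambda>x. u x * indicator {0..} x) \<in> borel_measurable lebesgue"
    using assms(1) by (simp add: Mplus_indicator)
  have [measurable]: "g \<in> borel_measurable lebesgue"
    by (rule lebesgue_measurable_of_borel) measurable
  have *: "(\<lambda>x. x) \<in> density lebesgue (\<lambda>x. u x * indicator {0..} x) \<rightarrow>\<^sub>M (borel :: real measure)"
    using measurable_completion[OF measurable_ident_sets[OF sets_lborel[symmetric]]]
    by (simp add: id_def)
  show ?thesis unfolding half_line_measure_def
    using * by (subst nn_integral_distr) (auto simp: nn_integral_density ac_simps)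
qed

lemma emeasure_half_line_measure:
  assumes "u \<in> Mplus" "A \<in> sets borel"
  shows "emeasure (half_line_measure u) A = (\<integral>\<^sup>+x\<in>{0..} \<inter> A. u x \<partial>lebesgue)"
proof -
  have "emeasure (half_line_measure u) A = (\<integral>\<^sup>+x. indicator A x \<partial>half_line_measure u)"
    using assms by simp
  also have "\<dots> = (\<integral>\<^sup>+x\<in>{0..} \<inter> A. u x \<partial>lebesgue)"
    using assms by (subst nn_integral_half_line_measure)
      (auto simp: indicator_inter_arith ac_simps)
  finally show ?thesis .
qed

lemma emeasure_half_line_atLeast:
  assumes "u \<in> Mplus" "0 \<le> x"
  shows "emeasure (half_line_measure u) {x..} = tail u x"
    "emeasure (half_line_measure u) {x<..} = tail u x"
proof -
  have *: "{0..} \<inter> {x..} = {x..}" "{0..} \<inter> {x<..} = {x<..}" using assms by auto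
  show "emeasure (half_line_measure u) {x..} = tail u x"
    using assms by (simp add: emeasure_half_line_measure * tail_def)
  have "AE y in lebesgue. y \<noteq> x"
    using AE_lborel_singleton AE_completion_iff by blast
  then have "(\<integral>\<^sup>+y\<in>{x<..}. u y \<partial>lebesgue) = tail u x"
    unfolding tail_def by (intro nn_integral_cong_AE) (auto elim!: eventually_mono simp: indicator_def)
  then show "emeasure (half_line_measure u) {x<..} = tail u x"
    using assms by (simp add: emeasure_half_line_measure *)
qed

lemma AE_half_line_measure_pos:
  assumes "u \<in> Mplus" shows "AE x in half_line_measure u. 0 < x"
proof -
  have "emeasure (half_line_measure u) {..0} = (\<integral>\<^sup>+x. u x * indicator {0} x \<partial>lebesgue)"
    using assms by (subst emeasure_half_line_measure) (auto intro!: nn_integral_cong simp: indicator_def)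
  also have "\<dots> = (\<integral>\<^sup>+(x::real). 0 \<partial>lebesgue)"
  proof (intro nn_integral_cong_AE)
    have "AE x in lebesgue. x \<noteq> (0::real)"
      using AE_lborel_singleton AE_completion_iff by blast
    then show "AE x in lebesgue. u x * indicator {0} x = 0" by eventually_elim simp
  qed
  finally have "{..0} \<in> null_sets (half_line_measure u)" by auto
  then show ?thesis by (rule AE_I') (auto simp: not_less)
qed

text \<open>Truncation at \<open>n\<close> reduces this to monotone real-valued functions.\<close>

lemma borel_measurable_mono_ennreal:
  fixes f :: "real \<Rightarrow> ennreal"
  assumes "mono f" shows "f \<in> borel_measurable borel"
proof -
  have "(\<lambda>x. enn2real (inf (f x) (of_nat n))) \<in> borel_measurable borel" for n :: nat
  proof (intro borel_measurable_mono monoI enn2real_mono inf_mono order_refl)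
    fix x y :: real assume "x \<le> y" then show "f x \<le> f y" using assms by (rule monoD[rotated])
    show "inf (f y) (of_nat n) < top" by (rule le_less_trans[OF inf_le2]) (rule of_nat_less_top)
  qed
  then have "(\<lambda>x. SUP n::nat. ennreal (enn2real (inf (f x) (of_nat n)))) \<in> borel_measurable borel"
    by measurable
  moreover have "ennreal (enn2real (inf (f x) (of_nat n))) = inf (f x) (of_nat n)" for x and n :: nat
    by (rule ennreal_enn2real) (rule le_less_trans[OF inf_le2], rule of_nat_less_top)
  ultimately show ?thesis
    by (simp add: inf_SUP[symmetric] ennreal_SUP_of_nat_eq_top)
qed

lemma tail_antimono: "x \<le> y \<Longrightarrow> tail u y \<le> tail u x"
  unfolding tail_def by (intro nn_integral_mono) (auto simp: indicator_def)

locale half_line_weight =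
  fixes u :: "real \<Rightarrow> ennreal"
  assumes u_meas: "u \<in> Mplus"
    and tail_pos: "0 < t \<Longrightarrow> 0 < tail u t"
    and tail_fin: "0 < t \<Longrightarrow> tail u t < top"
begin

abbreviation "\<mu> \<equiv> half_line_measure u"

text \<open>Continuity from below along half-lines increasing to \<open>{t<..}\<close>. It therefore
  holds at \<open>t = 0\<close> too, even when \<open>tail u 0\<close> is infinite.\<close>

lemma tail_right_continuous:
  assumes "0 \<le> t" shows "tail u t = (SUP n. tail u (t + 1 / Suc n))"
proof -
  have "(\<Union>n. {t + 1 / real (Suc n)..}) = {t<..}"
  proof (intro equalityI subsetI)
    fix x assume "x \<in> {t<..}"
    then obtain n :: nat where "1 / Suc n < x - t" using nat_approx_posE[of "x - t"] by auto
    then show "x \<in> (\<Union>n. {t + 1 / real (Suc n)..})" by (intro UN_I[of n]) auto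
  next
    fix x assume "x \<in> (\<Union>n. {t + 1 / real (Suc n)..})"
    then obtain n :: nat where "t + 1 / real (Suc n) \<le> x" by auto
    moreover have "0 < 1 / real (Suc n)" by simp
    ultimately show "x \<in> {t<..}" unfolding greaterThan_iff by linarith
  qed
  moreover have "(SUP n. emeasure \<mu> {t + 1 / real (Suc n)..}) = emeasure \<mu> (\<Union>n. {t + 1 / real (Suc n)..})"
    by (intro SUP_emeasure_incseq) (auto intro!: incseq_SucI simp: field_simps)
  ultimately show ?thesis
    using assms u_meas by (simp add: emeasure_half_line_atLeast)
qed

lemma tail_left_continuous:
  assumes "0 < t" "\<And>s. 0 < s \<Longrightarrow> s < t \<Longrightarrow> c \<le> tail u s" shows "c \<le> tail u t"
proof -
  \<comment> \<open>The shift by 2 keeps \<open>s 0 = t / 2\<close> positive, where the tail is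
    finite, as continuity from above requires.\<close>
  define s where "s n = t - t / (n + 2)" for n :: nat
  have s: "0 < s n" "s n < t" for n using assms(1) by (auto simp: s_def field_simps add_pos_nonneg)
  have "(\<Inter>n. {s n..}) = {t..}"
  proof (intro equalityI subsetI)
    fix x assume "x \<in> (\<Inter>n. {s n..})"
    then have "s n \<le> x" for n by auto
    moreover have "s \<longlonglongrightarrow> t - 0"
      unfolding s_def by (intro tendsto_diff tendsto_const real_tendsto_divide_at_top[OF tendsto_const])
        (auto intro!: filterlim_tendsto_add_at_top filterlim_real_sequentially simp: add.commute[of _ 2])
    ultimately show "x \<in> {t..}" by (auto intro: LIMSEQ_le_const2)
  next
    fix x assume "x \<in> {t..}"
    then show "x \<in> (\<Inter>n. {s n..})" using less_imp_le[OF s(2)] by (auto intro: order_trans)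
  qed
  moreover have "(INF n. emeasure \<mu> {s n..}) = emeasure \<mu> (\<Inter>n. {s n..})"
  proof (rule INF_emeasure_decseq')
    show "{s i..} \<in> sets \<mu>" for i by simp
    show "\<exists>i. emeasure \<mu> {s i..} \<noteq> \<infinity>"
      using s[of 0] tail_fin[of "s 0"] u_meas by (auto simp: emeasure_half_line_atLeast intro!: exI[of _ 0])
    show "decseq (\<lambda>n. {s n..})"
    proof (intro decseq_SucI subsetI)
      fix n x assume "x \<in> {s (Suc n)..}"
      moreover have "t / (real (Suc n) + 2) \<le> t / (real n + 2)"
        using assms(1) by (intro divide_left_mono) auto
      ultimately show "x \<in> {s n..}" by (simp add: s_def algebra_simps)
    qed
  qed
  ultimately have "emeasure \<mu> {t..} = (INF n. emeasure \<mu> {s n..})" by simp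
  then have "tail u t = (INF n. tail u (s n))"
    using s assms(1) u_meas by (simp add: emeasure_half_line_atLeast less_imp_le)
  then show ?thesis using s assms by (auto intro!: INF_greatest)
qed

lemma tail_vanishes:
  assumes "0 < c" shows "\<exists>t>0. tail u t < c"
proof (rule ccontr)
  assume "\<not> ?thesis"
  then have ge: "c \<le> tail u (real n + 1)" for n :: nat
    by (auto simp: not_less dest!: spec[of _ "real n + 1"])
  have "(\<Inter>n::nat. {real n + 1..}) = {}"
  proof (intro equals0I)
    fix x :: real assume "x \<in> (\<Inter>n::nat. {real n + 1..})"
    then have "real n + 1 \<le> x" for n :: nat by auto
    moreover obtain n :: nat where "x < real n" using reals_Archimedean2 by blast
    ultimately show False by (meson add_increasing2 leD order_trans zero_le_one order_refl)
  qed
  moreover have "(INF n. emeasure \<mu> {real n + 1..}) = emeasure \<mu> (\<Inter>n::nat. {real n + 1..})"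
    using tail_fin[of 1] u_meas
    by (intro INF_emeasure_decseq') (auto simp: emeasure_half_line_atLeast decseq_def intro!: exI[of _ 0])
  ultimately have "(INF n. tail u (real n + 1)) = 0"
    using u_meas by (simp add: emeasure_half_line_atLeast)
  moreover have "c \<le> (INF n. tail u (real n + 1))" by (rule INF_greatest) (rule ge)
  ultimately show False using assms by auto
qed

lemma tail_le_tail_0: "0 \<le> x \<Longrightarrow> tail u x \<le> tail u 0"
  by (rule tail_antimono)

text \<open>Intermediate value argument: the superlevel set is nonempty by right continuity at 0 and
  bounded because the tail vanishes at infinity; the two one-sided continuities give the value
  \<open>c\<close> at its supremum. Taking the largest point of the level makes the superlevel set
  exactly \<open>{0<..m}\<close> despite flat pieces.\<close>

lemma exists_level:
  assumes "0 < c" "c < tail u 0"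
  obtains m where "0 < m" "tail u m = c" "\<And>y. 0 < y \<Longrightarrow> c \<le> tail u y \<longleftrightarrow> y \<le> m"
proof -
  define S where "S = {y. 0 < y \<and> c \<le> tail u y}"
  obtain t where t: "0 < t" "tail u t < c" using tail_vanishes assms by auto
  have bdd: "bdd_above S"
  proof (intro bdd_aboveI[of _ t] leI notI)
    fix y assume "y \<in> S" "t < y"
    then show False using t tail_antimono[of t y u] by (auto simp: S_def)
  qed
  obtain n :: nat where "c < tail u (0 + 1 / Suc n)"
    using assms(2) tail_right_continuous[of 0] by (auto simp: less_SUP_iff)
  then have S: "1 / Suc n \<in> S" by (auto simp: S_def)
  define m where "m = Sup S"
  have m: "0 < m"
    using cSup_upper[OF S bdd] by (auto simp: m_def intro: less_le_trans[rotated])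
  have below: "c \<le> tail u s" if "0 < s" "s < m" for s
  proof -
    obtain y where "y \<in> S" "s < y"
      using \<open>s < m\<close> less_cSup_iff[of S s] S bdd unfolding m_def by blast
    then show ?thesis using tail_antimono[of s y u] by (auto simp: S_def)
  qed
  have ge: "c \<le> tail u m" by (rule tail_left_continuous[OF m below])
  have above: "tail u y < c" if "m < y" for y
  proof (rule ccontr)
    assume "\<not> ?thesis"
    then have "y \<in> S" using that m by (auto simp: S_def not_less)
    from cSup_upper[OF this bdd] that show False by (simp add: m_def)
  qed
  have "tail u m \<le> c"
    unfolding tail_right_continuous[OF less_imp_le[OF m]]
    by (intro SUP_least less_imp_le above) auto
  with ge have eq: "tail u m = c" by auto
  show thesis
  proof (rule that[OF m eq])
    fix y :: real assume "0 < y"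
    then show "c \<le> tail u y \<longleftrightarrow> y \<le> m"
      using ge above[of y] tail_antimono[of y m u] eq by (cases "y \<le> m") auto
  qed
qed

text \<open>A point \<open>y\<close> of the defining set lies strictly to the left of
  \<open>x\<close>: otherwise \<open>2 * tail u y \<le> tail u y\<close>, impossible for a tail that
  is positive and finite at \<open>y > 0\<close>. This gives boundedness, so that the supremum is
  genuine whenever the set is nonempty.\<close>

lemma zeta_inv_le: "zeta_inv u x \<le> max x 0"
  and zeta_inv_ge: "0 < y \<Longrightarrow> 2 * tail u x \<le> tail u y \<Longrightarrow> y \<le> zeta_inv u x"
  and zeta_inv_nonneg: "0 \<le> zeta_inv u x"
proof -
  define S where "S = {y. 0 < y \<and> 2 * tail u x \<le> tail u y}"
  have S: "y < x" if "y \<in> S" for y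
  proof (rule ccontr)
    assume "\<not> ?thesis"
    then have "tail u y \<le> tail u x" by (intro tail_antimono) auto
    then have "2 * tail u y \<le> 2 * tail u x" by (intro mult_left_mono) auto
    also have "\<dots> \<le> tail u y" using that by (simp add: S_def)
    finally have "2 * tail u y \<le> tail u y" .
    moreover have "0 < tail u y" "tail u y < top"
      using tail_pos tail_fin that by (auto simp: S_def)
    then obtain r where "tail u y = ennreal r" "0 < r"
      by (cases "tail u y") auto
    moreover have "2 * ennreal r = ennreal (2 * r)" using \<open>0 < r\<close> by (simp add: ennreal_mult)
    ultimately show False by simp
  qed
  have bdd: "bdd_above S" using S by (intro bdd_aboveI[of _ x]) (auto intro: less_imp_le)
  have eq: "zeta_inv u x = (if S = {} then 0 else Sup S)"
    unfolding zeta_inv_def Sup0_def S_def ..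
  show "zeta_inv u x \<le> max x 0"
    using S less_imp_le unfolding eq by (auto intro!: cSup_least max.coboundedI1)
  show ge: "y \<le> zeta_inv u x" if "0 < y" "2 * tail u x \<le> tail u y" for y
    using that cSup_upper[OF _ bdd, of y] by (auto simp: eq S_def)
  show "0 \<le> zeta_inv u x"
    using S cSup_upper[OF _ bdd] by (auto simp: eq) (metis (mono_tags, lifting) S_def less_imp_le mem_Collect_eq order_trans)
qed

lemma zeta_inv_le_self: "0 \<le> x \<Longrightarrow> zeta_inv u x \<le> x"
  using zeta_inv_le[of x] by simp

lemma zeta_inv_less_iff:
  assumes "0 \<le> a" shows "a < zeta_inv u x \<longleftrightarrow> (\<exists>y>a. 2 * tail u x \<le> tail u y)"
proof
  assume "\<exists>y>a. 2 * tail u x \<le> tail u y"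
  then show "a < zeta_inv u x"
    using assms zeta_inv_ge by (meson le_less_trans less_le_trans)
next
  assume *: "a < zeta_inv u x"
  let ?S = "{y. 0 < y \<and> 2 * tail u x \<le> tail u y}"
  have "?S \<noteq> {}" "a < Sup ?S"
    using * assms by (auto simp: zeta_inv_def Sup0_def split: if_splits)
  then obtain y where "y \<in> ?S" "a < y"
    by (meson less_cSupD)
  then show "\<exists>y>a. 2 * tail u x \<le> tail u y" by auto
qed

lemma zeta_inv_mono: "mono (zeta_inv u)"
proof (rule monoI, rule ccontr)
  fix x y :: real assume "x \<le> y" and *: "\<not> zeta_inv u x \<le> zeta_inv u y"
  then obtain z where z: "zeta_inv u y < z" "2 * tail u x \<le> tail u z"
    using zeta_inv_less_iff[OF zeta_inv_nonneg, of y x] by auto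
  then have "2 * tail u y \<le> tail u z"
    using tail_antimono[OF \<open>x \<le> y\<close>] by (meson mult_left_mono order_trans zero_le)
  with z show False
    using zeta_inv_nonneg[of y] zeta_inv_ge[of z y] by simp
qed

text \<open>If the doubled level lies below \<open>tail u 0\<close> it is attained, at a point not
  exceeding \<open>zeta_inv u x\<close>; otherwise \<open>tail u 0\<close> itself is at most
  \<open>2 * tail u x\<close>.\<close>

lemma tail_zeta_inv_le:
  assumes "0 \<le> x" shows "tail u (zeta_inv u x) \<le> 2 * tail u x"
proof (cases "2 * tail u x < tail u 0")
  case False
  then show ?thesis using order_trans[OF tail_le_tail_0[OF zeta_inv_nonneg]] by (auto simp: not_less)
next
  case True
  then have "x \<noteq> 0"
    using mult_right_mono[of 1 2 "tail u 0"] by auto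
  then have "0 < 2 * tail u x" using assms tail_pos[of x] by (auto simp: ennreal_zero_less_mult_iff)
  from exists_level[OF this True] obtain m where m: "0 < m" "tail u m = 2 * tail u x" by metis
  then have "m \<le> zeta_inv u x" by (intro zeta_inv_ge) auto
  from tail_antimono[OF this, of u] m show ?thesis by simp
qed

lemma zeta_inv_eq_0:
  assumes "tail u 0 < 2 * tail u x" shows "zeta_inv u x = 0"
proof (rule antisym[OF _ zeta_inv_nonneg], rule ccontr)
  assume "\<not> zeta_inv u x \<le> 0"
  then obtain y where "0 < y" "2 * tail u x \<le> tail u y"
    using zeta_inv_less_iff[of 0 x] by auto
  with assms tail_le_tail_0[of y] show False by simp
qed

lemma half_tail: "(1 / 2 :: ennreal) * (2 * c) = c" "2 * ((1 / 2 :: ennreal) * c) = c"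
proof -
  have "(1 / 2 :: ennreal) * 2 = 1" by (simp add: ennreal_divide_self mult.commute ennreal_times_divide)
  then show "(1 / 2 :: ennreal) * (2 * c) = c" "2 * ((1 / 2 :: ennreal) * c) = c"
    by (metis mult.assoc mult.commute mult_1)+
qed

lemma half_less: assumes "0 < c" "c < top" shows "0 < (1/2) * c" "(1 / 2) * c < (c::ennreal)"
proof -
  obtain r where r: "c = ennreal r" "0 < r" using assms by (cases c) auto
  have "2 * ennreal (r / 2) = c" using r by (simp add: ennreal_mult'[symmetric] flip: ennreal_numeral)
  then have "(1 / 2) * c = ennreal (r / 2)" using half_tail(1) by metis
  then show "0 < (1/2) * c" "(1 / 2) * c < c" using r by (auto intro!: ennreal_lessI)
qed

text \<open>Half of a positive finite tail is always an attained level, so \<open>zeta\<close>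
  halves the tail exactly. For \<open>zeta_inv\<close> the doubled level may exceed
  \<open>tail u 0\<close>, and only an inequality remains.\<close>

lemma zeta_props:
  assumes "0 < x"
  shows "0 < zeta u x" "tail u (zeta u x) = (1 / 2) * tail u x"
    "\<And>y. 0 < y \<Longrightarrow> (1 / 2) * tail u x \<le> tail u y \<longleftrightarrow> y \<le> zeta u x"
proof -
  have "0 < (1 / 2) * tail u x" "(1 / 2) * tail u x < tail u 0"
    using half_less[OF tail_pos tail_fin, OF assms assms] tail_le_tail_0[of x] assms by auto
  from exists_level[OF this] obtain m where
    m: "0 < m" "tail u m = (1 / 2) * tail u x" "\<And>y. 0 < y \<Longrightarrow> (1 / 2) * tail u x \<le> tail u y \<longleftrightarrow> y \<le> m"
    by metis
  then have "{y. 0 < y \<and> (1 / 2) * tail u x \<le> tail u y} = {0<..m}" by auto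
  then have "zeta u x = m"
    using m(1) by (simp add: zeta_def Sup0_def)
  with m show "0 < zeta u x" "tail u (zeta u x) = (1 / 2) * tail u x"
    "\<And>y. 0 < y \<Longrightarrow> (1 / 2) * tail u x \<le> tail u y \<longleftrightarrow> y \<le> zeta u x" by auto
qed

lemma zeta2_props:
  assumes "0 < x"
  shows "0 < (zeta u ^^ 2) x" "4 * tail u ((zeta u ^^ 2) x) = tail u x"
    "\<And>y. 0 < y \<Longrightarrow> tail u x \<le> 4 * tail u y \<Longrightarrow> y \<le> (zeta u ^^ 2) x"
proof -
  have eq: "(zeta u ^^ 2) x = zeta u (zeta u x)" by (simp add: numeral_2_eq_2)
  note z = zeta_props[OF assms] and z2 = zeta_props[OF zeta_props(1)[OF assms]]
  show "0 < (zeta u ^^ 2) x" using z2 by (simp add: eq)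
  have four: "4 * c = 2 * (2 * c)" for c :: ennreal
    by (simp flip: mult.assoc)
  show "4 * tail u ((zeta u ^^ 2) x) = tail u x" unfolding eq z2 four half_tail z ..
  fix y :: real assume y: "0 < y" "tail u x \<le> 4 * tail u y"
  have "(1 / 2) * ((1 / 2) * tail u x) \<le> (1 / 2) * ((1 / 2) * (2 * (2 * tail u y)))"
    using y unfolding four by (intro mult_left_mono) auto
  also have "\<dots> = tail u y" unfolding half_tail ..
  finally show "y \<le> (zeta u ^^ 2) x" using z2(3)[of y] y by (simp add: eq z)
qed

lemma measurable_tail [measurable]: "tail u \<in> borel_measurable borel"
proof -
  have "(\<lambda>x. tail u (- x)) \<in> borel_measurable borel"
    by (rule borel_measurable_mono_ennreal) (auto simp: mono_def intro: tail_antimono)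
  from measurable_compose[OF borel_measurable_uminus[OF measurable_ident] this]
  show ?thesis by simp
qed

lemma measurable_zeta_inv [measurable]: "zeta_inv u \<in> borel_measurable borel"
  by (rule borel_measurable_mono[OF zeta_inv_mono])

lemma emeasure_mu_le_tail_0: "emeasure \<mu> A \<le> tail u 0"
proof (cases "A \<in> sets borel")
  case True
  then have "emeasure \<mu> A = (\<integral>\<^sup>+x\<in>{0..} \<inter> A. u x \<partial>lebesgue)"
    using u_meas by (rule emeasure_half_line_measure[rotated])
  also have "\<dots> \<le> tail u 0" unfolding tail_def
    by (intro nn_integral_mono) (auto simp: indicator_def)
  finally show ?thesis .
qed (simp add: emeasure_notin_sets)

lemma emeasure_sublevel:
  assumes "0 < c" "c < tail u 0" shows "emeasure \<mu> {x. 0 < x \<and> tail u x < c} = c"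
proof -
  obtain m where m: "0 < m" "tail u m = c" "\<And>y. 0 < y \<Longrightarrow> c \<le> tail u y \<longleftrightarrow> y \<le> m"
    using exists_level[OF assms] by metis
  have "{x. 0 < x \<and> tail u x < c} = {m<..}"
    using m by (auto simp flip: not_le)
  then show ?thesis using m u_meas by (simp add: emeasure_half_line_atLeast)
qed

text \<open>Approximation of \<open>c\<close> from above by levels \<open>d\<close>: below
  \<open>tail u 0\<close> the strict sublevel set has mass exactly \<open>d\<close>, and from
  \<open>tail u 0\<close> on the total mass suffices. This covers \<open>c = 0\<close> and flat
  pieces.\<close>

lemma emeasure_sublevel_le: "emeasure \<mu> {x. 0 < x \<and> tail u x \<le> c} \<le> c"
proof (rule dense_ge)
  fix d assume "c < d"
  show "emeasure \<mu> {x. 0 < x \<and> tail u x \<le> c} \<le> d"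
  proof (cases "d < tail u 0")
    case True
    have "emeasure \<mu> {x. 0 < x \<and> tail u x \<le> c} \<le> emeasure \<mu> {x. 0 < x \<and> tail u x < d}"
      using \<open>c < d\<close> by (intro emeasure_mono) auto
    moreover have "0 < d" using \<open>c < d\<close> by (rule le_less_trans[rotated]) simp
    ultimately show ?thesis using emeasure_sublevel[OF _ True] by simp
  next
    case False
    then show ?thesis using order_trans[OF emeasure_mu_le_tail_0] by (simp add: not_less)
  qed
qed

lemma emeasure_sublevel_ge: "min c (tail u 0) \<le> emeasure \<mu> {x. 0 < x \<and> tail u x \<le> c}"
proof (cases "c < tail u 0")
  case True
  show ?thesis
  proof (cases "c = 0")
    case False
    with emeasure_sublevel[OF _ True] have "c = emeasure \<mu> {x. 0 < x \<and> tail u x < c}"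
      by (simp add: zero_less_iff_neq_zero)
    also have "\<dots> \<le> emeasure \<mu> {x. 0 < x \<and> tail u x \<le> c}" by (intro emeasure_mono) auto
    finally show ?thesis using True by (simp add: min_def less_imp_le)
  qed simp
next
  case False
  then have "{x. 0 < x \<and> tail u x \<le> c} = {0<..}"
    using order_trans[OF tail_le_tail_0] by (auto simp: not_less less_imp_le)
  then show ?thesis using False u_meas by (simp add: emeasure_half_line_atLeast)
qed

text \<open>With \<open>c\<close> half of \<open>tail u a\<close>, the set lies between the strict
  and the non-strict sublevel set of \<open>c\<close>, both of mass \<open>c\<close>. Right
  continuity enters for the first inclusion: a strict inequality at \<open>a\<close> leaves room for
  a point beyond \<open>a\<close>.\<close>

lemma emeasure_zeta_inv_greater:
  assumes "0 < a"
  shows "2 * emeasure \<mu> {x. a < zeta_inv u x} = tail u a"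
proof -
  define c where "c = (1 / 2) * tail u a"
  have c: "0 < c" "c < tail u 0" "tail u a = 2 * c"
    using half_less[OF tail_pos tail_fin, OF assms assms] tail_le_tail_0[of a] assms
    by (auto simp: c_def half_tail)
  have "emeasure \<mu> {x. 0 < x \<and> tail u x < c} \<le> emeasure \<mu> {x. a < zeta_inv u x}"
  proof (intro emeasure_mono subsetI CollectI)
    fix x assume "x \<in> {x. 0 < x \<and> tail u x < c}"
    then have x: "0 < x" "tail u x < c" by auto
    have "2 * tail u x < tail u a"
      unfolding c by (rule ennreal_mult_strict_left_mono) (use x in auto)
    then obtain n :: nat where "2 * tail u x < tail u (a + 1 / Suc n)"
      using tail_right_continuous[of a] assms by (auto simp: less_SUP_iff)
    then show "a < zeta_inv u x"
      using assms by (auto simp: zeta_inv_less_iff intro!: exI[of _ "a + 1 / Suc n"] less_imp_le)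
  qed simp
  then have ge: "c \<le> emeasure \<mu> {x. a < zeta_inv u x}" using emeasure_sublevel[OF c(1,2)] by simp
  have "emeasure \<mu> {x. a < zeta_inv u x} \<le> emeasure \<mu> {x. 0 < x \<and> tail u x \<le> c}"
  proof (intro emeasure_mono subsetI CollectI)
    fix x assume "x \<in> {x. a < zeta_inv u x}"
    then have "a < max x 0" using less_le_trans[OF _ zeta_inv_le] by auto
    moreover obtain y where y: "a < y" "2 * tail u x \<le> tail u y"
      using assms \<open>x \<in> _\<close> by (auto simp: zeta_inv_less_iff)
    then have "2 * tail u x \<le> 2 * c"
      using order_trans[OF y(2) tail_antimono[of a y u]] c(3) by simp
    then have "(1/2) * (2 * tail u x) \<le> (1/2) * (2 * c)" by (rule mult_left_mono) simp
    then have "tail u x \<le> c" unfolding half_tail .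
    then show "0 < x \<and> tail u x \<le> c" using \<open>a < max x 0\<close> assms by (simp add: half_tail)
  qed simp
  with emeasure_sublevel_le[of c] ge have "emeasure \<mu> {x. a < zeta_inv u x} = c" by auto
  then show ?thesis using c by simp
qed

text \<open>The image of twice \<open>\<mu>\<close> under \<open>zeta_inv u\<close> has the same
  mass as \<open>\<mu>\<close> on half-lines, hence coincides with it on \<open>{a<..}\<close>;
  positivity of \<open>a\<close> keeps these masses finite, so that half-lines determine the
  measures. Letting \<open>a\<close> decrease to 0 loses nothing on the left, because the part sent
  to 0 meets \<open>g 0 = 0\<close>.\<close>

lemma nn_integral_zeta_inv:
  assumes [measurable]: "g \<in> borel_measurable borel" and "g 0 = 0"
  shows "2 * (\<integral>\<^sup>+x. g (zeta_inv u x) \<partial>\<mu>) \<le> (\<integral>\<^sup>+x. g x \<partial>\<mu>)"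
proof -
  have *: "2 * (\<integral>\<^sup>+x. g (zeta_inv u x) * indicator {a<..} (zeta_inv u x) \<partial>\<mu>) = (\<integral>\<^sup>+x. g x * indicator {a<..} x \<partial>\<mu>)"
    if a: "0 < a" for a
  proof -
    define M1 where "M1 = density (scale_measure 2 (distr \<mu> borel (zeta_inv u))) (indicator {a<..})"
    define M2 where "M2 = density \<mu> (indicator {a<..})"
    have em1: "emeasure M1 {x<..} = tail u (max a x)" for x
    proof -
      have "emeasure M1 {x<..} = emeasure (scale_measure 2 (distr \<mu> borel (zeta_inv u))) ({a<..} \<inter> {x<..})"
        unfolding M1_def by (subst emeasure_density) (auto simp: nn_integral_indicator indicator_inter_arith[symmetric])
      also have "{a<..} \<inter> {x<..} = {max a x<..}" by auto
      finally show ?thesis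
        using a emeasure_zeta_inv_greater[of "max a x"]
        by (simp add: emeasure_distr vimage_def)
    qed
    have em2: "emeasure M2 {x<..} = tail u (max a x)" for x
    proof -
      have "emeasure M2 {x<..} = emeasure \<mu> ({a<..} \<inter> {x<..})"
        unfolding M2_def by (subst emeasure_density) (auto simp: nn_integral_indicator indicator_inter_arith[symmetric])
      also have "{a<..} \<inter> {x<..} = {max a x<..}" by auto
      finally show ?thesis using a u_meas by (simp add: emeasure_half_line_atLeast)
    qed
    have "M1 = M2"
      using a em1 em2 by (intro measure_eqI_lessThan) (auto simp: M1_def M2_def tail_fin)
    then have "(\<integral>\<^sup>+x. g x \<partial>M1) = (\<integral>\<^sup>+x. g x \<partial>M2)" by simp
    then show ?thesis unfolding M1_def M2_def
      by (simp add: nn_integral_density nn_integral_scale_measure nn_integral_distr mult.commute)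
  qed
  define A where "A n = {1 / real (Suc n)<..}" for n
  have A: "incseq A" unfolding A_def by (intro incseq_SucI) (auto simp: field_simps elim!: le_less_trans[rotated])
  have UN: "\<exists>n. x \<in> A n" if "0 < x" for x
    using that nat_approx_posE[of x] by (auto simp: A_def)
  have "(\<integral>\<^sup>+x. g (zeta_inv u x) \<partial>\<mu>) = (\<integral>\<^sup>+x. (SUP n. g (zeta_inv u x) * indicator (A n) (zeta_inv u x)) \<partial>\<mu>)"
  proof (rule nn_integral_cong)
    fix x
    show "g (zeta_inv u x) = (SUP n. g (zeta_inv u x) * indicator (A n) (zeta_inv u x))"
    proof (cases "0 < zeta_inv u x")
      case True
      then obtain n where "zeta_inv u x \<in> A n" using UN by blast
      then show ?thesis
        by (intro antisym SUP_upper2[where i=n] SUP_least) (auto simp: indicator_def)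
    next
      case False
      then have "zeta_inv u x = 0" using zeta_inv_nonneg[of x] by simp
      then show ?thesis using assms(2) by simp
    qed
  qed
  also have "\<dots> = (SUP n. \<integral>\<^sup>+x. g (zeta_inv u x) * indicator (A n) (zeta_inv u x) \<partial>\<mu>)"
  proof (rule nn_integral_monotone_convergence_SUP)
    show "incseq (\<lambda>n x. g (zeta_inv u x) * indicator (A n) (zeta_inv u x))"
      using A by (auto simp: incseq_def le_fun_def indicator_def)
    show "(\<lambda>x. g (zeta_inv u x) * indicator (A n) (zeta_inv u x)) \<in> borel_measurable \<mu>" for n
      unfolding A_def by measurable
  qed
  finally have "2 * (\<integral>\<^sup>+x. g (zeta_inv u x) \<partial>\<mu>) = (SUP n. 2 * (\<integral>\<^sup>+x. g (zeta_inv u x) * indicator (A n) (zeta_inv u x) \<partial>\<mu>))"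
    by (simp add: SUP_mult_left_ennreal)
  also have "\<dots> = (SUP n. \<integral>\<^sup>+x. g x * indicator (A n) x \<partial>\<mu>)"
    unfolding A_def by (subst *) auto
  also have "\<dots> \<le> (\<integral>\<^sup>+x. g x \<partial>\<mu>)"
    by (intro SUP_least nn_integral_mono) (auto simp: indicator_def)
  finally show ?thesis .
qed

end

section \<open>Absorption for Oinarov kernels\<close>

lemma ennreal_absorb: "2 * I \<le> 2 * X + I \<Longrightarrow> I < top \<Longrightarrow> I \<le> 2 * (X :: ennreal)"
  unfolding mult_2[of I] add.commute[of "2 * X" I] by (auto simp: ennreal_add_left_cancel_le)

context half_line_weight
begin

lemma measurable_zeta_inv_pow [measurable]: "(zeta_inv u ^^ i) \<in> borel_measurable borel"
  by (rule measurable_compose_n) measurable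

lemma zeta_inv_pow_0 [simp]: "(zeta_inv u ^^ i) 0 = 0"
  by (induction i) (auto intro: antisym zeta_inv_nonneg zeta_inv_le_self[of 0, simplified])

lemma zeta_inv_pow_nonneg: "0 \<le> x \<Longrightarrow> 0 \<le> (zeta_inv u ^^ i) x"
  by (induction i) (auto intro: zeta_inv_nonneg)

lemma zeta_inv_pow_antimono:
  assumes "0 \<le> x" "i \<le> j" shows "(zeta_inv u ^^ j) x \<le> (zeta_inv u ^^ i) x"
  using assms(2)
proof (induction j rule: dec_induct)
  case (step n)
  have "(zeta_inv u ^^ Suc n) x \<le> (zeta_inv u ^^ n) x"
    using zeta_inv_le_self[OF zeta_inv_pow_nonneg[OF assms(1)]] by simp
  with step.IH show ?case by (rule order_trans[rotated])
qed simp

lemma tail_zeta_inv_pow_le: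
  assumes "0 \<le> x" shows "tail u ((zeta_inv u ^^ i) x) \<le> 2 ^ i * tail u x"
proof (induction i)
  case (Suc i)
  have "tail u ((zeta_inv u ^^ Suc i) x) \<le> 2 * tail u ((zeta_inv u ^^ i) x)"
    using tail_zeta_inv_le[OF zeta_inv_pow_nonneg[OF assms]] by simp
  also have "\<dots> \<le> 2 * (2 ^ i * tail u x)"
    by (intro mult_left_mono Suc.IH) simp
  finally show ?case by (simp add: mult.assoc)
qed simp

lemma nn_integral_zeta_inv_pow:
  assumes [measurable]: "g \<in> borel_measurable borel" and "g 0 = 0"
  shows "2 ^ i * (\<integral>\<^sup>+x. g ((zeta_inv u ^^ i) x) \<partial>\<mu>) \<le> (\<integral>\<^sup>+x. g x \<partial>\<mu>)"
proof (induction i)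
  case (Suc i)
  have eq: "(zeta_inv u ^^ Suc i) x = (zeta_inv u ^^ i) (zeta_inv u x)" for x
    by (simp only: funpow_Suc_right o_apply)
  have "2 * (\<integral>\<^sup>+x. g ((zeta_inv u ^^ Suc i) x) \<partial>\<mu>) \<le> (\<integral>\<^sup>+x. g ((zeta_inv u ^^ i) x) \<partial>\<mu>)"
    unfolding eq using assms(2) by (intro nn_integral_zeta_inv) auto
  then have "2 ^ i * (2 * (\<integral>\<^sup>+x. g ((zeta_inv u ^^ Suc i) x) \<partial>\<mu>))
      \<le> 2 ^ i * (\<integral>\<^sup>+x. g ((zeta_inv u ^^ i) x) \<partial>\<mu>)"
    by (intro mult_left_mono) auto
  also note Suc.IH
  finally show ?case by (simp only: power_Suc mult.commute mult.left_commute mult.assoc)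
qed simp

lemma AE_mu_pos: "AE x in \<mu>. 0 < x"
  by (rule AE_half_line_measure_pos[OF u_meas])

lemma nn_integral_mu_le:
  assumes [measurable]: "g \<in> borel_measurable borel" and "g 0 = 0"
  shows "(\<integral>\<^sup>+x. g ((zeta_inv u ^^ i) x) \<partial>\<mu>) \<le> (\<integral>\<^sup>+x. g x \<partial>\<mu>)"
proof -
  have "1 * (\<integral>\<^sup>+x. g ((zeta_inv u ^^ i) x) \<partial>\<mu>) \<le> 2 ^ i * (\<integral>\<^sup>+x. g ((zeta_inv u ^^ i) x) \<partial>\<mu>)"
    by (rule mult_right_mono) auto
  from order_trans[OF this nn_integral_zeta_inv_pow[OF assms]] show ?thesis by (simp only: mult_1)
qed

text \<open>
  Absorption: going back \<open>2 * (m + 1)\<close> steps costs the factor \<open>D\<close> only once but gains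
  \<open>4 ^ (m + 1)\<close>, so the last term of the recursion can be absorbed for large \<open>m\<close>. The truncation
  of \<open>h\<close> makes the absorbed integral finite.
\<close>

lemma nn_integral_absorb:
  fixes h e :: "real \<Rightarrow> ennreal"
  assumes [measurable]: "h \<in> borel_measurable borel" "e \<in> borel_measurable borel"
    and "e 0 = 0" and "0 < \<epsilon>" and h0: "\<And>x. 0 \<le> x \<Longrightarrow> x \<le> \<epsilon> \<Longrightarrow> h x = 0"
    and "0 \<le> C" "1 \<le> D" "0 < a" "2 * (2 * D) powr a \<le> 4 ^ Suc m"
    and rec: "\<And>x. 0 \<le> x \<Longrightarrow> h x \<le> ennreal C * (\<Sum>j\<le>m. e ((zeta_inv u ^^ (2 * j)) x))
      + ennreal D * h ((zeta_inv u ^^ (2 * Suc m)) x)"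
  shows "(\<integral>\<^sup>+x. h x epowr a \<partial>\<mu>)
    \<le> ennreal (2 * (2 * C * Suc m) powr a * Suc m) * (\<integral>\<^sup>+x. e x epowr a \<partial>\<mu>)"
proof -
  \<comment> \<open>The bounded function \<open>g n\<close> vanishes on
    \<open>{0..\<epsilon>}\<close>, and \<open>tail u \<epsilon>\<close> is finite; together these
    make the integral to be absorbed finite.\<close>
  define g where "g n x = min (h x) (of_nat n)" for n :: nat and x
  have [measurable]: "g n \<in> borel_measurable borel" for n
    unfolding g_def by measurable
  have gz: "g n 0 = 0" for n using h0[of 0] \<open>0 < \<epsilon>\<close> by (simp add: g_def)
  let ?B = "ennreal ((2 * C * Suc m) powr a)"
  let ?X = "?B * (of_nat (Suc m) * (\<integral>\<^sup>+x. e x epowr a \<partial>\<mu>))"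
  have bound: "(\<integral>\<^sup>+x. g n x epowr a \<partial>\<mu>) \<le> ennreal 2 * (?X)" for n
  proof -
    let ?I = "\<integral>\<^sup>+x. g n x epowr a \<partial>\<mu>" and ?J = "\<integral>\<^sup>+x. g n ((zeta_inv u ^^ (2 * Suc m)) x) epowr a \<partial>\<mu>"
    have fin: "?I < top"
    proof -
      have "?I \<le> (\<integral>\<^sup>+x. (of_nat n epowr a) * indicator {\<epsilon>..} x \<partial>\<mu>)"
        using AE_mu_pos
        by (intro nn_integral_mono_AE, eventually_elim)
           (use \<open>0 < a\<close> in \<open>auto simp: indicator_def g_def h0 intro!: epowr_mono\<close>)
      also have "\<dots> = (of_nat n epowr a) * tail u \<epsilon>"
        using \<open>0 < \<epsilon>\<close> u_meas by (simp add: nn_integral_cmult_indicator emeasure_half_line_atLeast)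
      also have "\<dots> < top"
        using tail_fin[OF \<open>0 < \<epsilon>\<close>] by (intro ennreal_mult_less_top[THEN iffD2] disjI2 conjI epowr_less_top of_nat_less_top)
      finally show ?thesis .
    qed
    have g_rec: "g n x epowr a \<le> ?B * (\<Sum>j\<le>m. e ((zeta_inv u ^^ (2 * j)) x) epowr a)
        + ennreal ((2 * D) powr a) * (g n ((zeta_inv u ^^ (2 * Suc m)) x) epowr a)" if "0 \<le> x" for x
    proof -
      let ?S = "\<Sum>j\<le>m. e ((zeta_inv u ^^ (2 * j)) x)" and ?z = "(zeta_inv u ^^ (2 * Suc m)) x"
      \<comment> \<open>The recursion survives truncation: if the last term is cut at
        \<open>n\<close>, then \<open>D \<ge> 1\<close> already makes the right-hand side at least
        \<open>n\<close>.\<close>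
      have "g n x \<le> ennreal C * ?S + ennreal D * g n ?z"
      proof (cases "h ?z \<le> of_nat n")
        case True
        then have "g n ?z = h ?z" by (simp add: g_def)
        then show ?thesis using rec[OF that] by (auto simp: g_def intro: min.coboundedI1)
      next
        case False
        then have "g n ?z = of_nat n" by (simp add: g_def)
        moreover have "1 * of_nat n \<le> ennreal D * of_nat n"
          using \<open>1 \<le> D\<close> by (intro mult_right_mono) auto
        ultimately show ?thesis by (auto simp: g_def intro!: min.coboundedI2 add_increasing)
      qed
      then have "g n x epowr a \<le> (ennreal C * ?S + ennreal D * g n ?z) epowr a"
        using \<open>0 < a\<close> by (rule epowr_mono)
      also have "\<dots> \<le> ennreal (2 powr a) * ((ennreal C * ?S) epowr a + (ennreal D * g n ?z) epowr a)"
        using \<open>0 < a\<close> by (rule epowr_add_le)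
      also have "(ennreal C * ?S) epowr a \<le> ennreal (C powr a) * (ennreal (real (Suc m) powr a) * (\<Sum>j\<le>m. e ((zeta_inv u ^^ (2 * j)) x) epowr a))"
        using \<open>0 < a\<close> \<open>0 \<le> C\<close> epowr_sum_le[of "{..m}" a "\<lambda>j. e ((zeta_inv u ^^ (2 * j)) x)"]
        by (simp add: epowr_mult epowr_ennreal mult_left_mono)
      also have "(ennreal D * g n ?z) epowr a = ennreal (D powr a) * (g n ?z epowr a)"
        using \<open>0 < a\<close> \<open>1 \<le> D\<close> by (simp add: epowr_mult epowr_ennreal)
      also have "ennreal (2 powr a) * (ennreal (C powr a) * (ennreal (real (Suc m) powr a) * (\<Sum>j\<le>m. e ((zeta_inv u ^^ (2 * j)) x) epowr a))
           + ennreal (D powr a) * (g n ?z epowr a))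
        = ?B * (\<Sum>j\<le>m. e ((zeta_inv u ^^ (2 * j)) x) epowr a) + ennreal ((2 * D) powr a) * (g n ?z epowr a)"
        using \<open>0 \<le> C\<close> \<open>1 \<le> D\<close> by (simp add: powr_mult ennreal_mult distrib_left mult.assoc del: of_nat_Suc)
      finally show ?thesis by (simp add: add_left_mono add_right_mono mult_left_mono)
    qed
    have "?I \<le> (\<integral>\<^sup>+x. ?B * (\<Sum>j\<le>m. e ((zeta_inv u ^^ (2 * j)) x) epowr a)
        + ennreal ((2 * D) powr a) * (g n ((zeta_inv u ^^ (2 * Suc m)) x) epowr a) \<partial>\<mu>)"
      using AE_mu_pos g_rec by (intro nn_integral_mono_AE) (auto elim!: eventually_mono)
    also have "\<dots> = ?B * (\<Sum>j\<le>m. \<integral>\<^sup>+x. e ((zeta_inv u ^^ (2 * j)) x) epowr a \<partial>\<mu>) + ennreal ((2 * D) powr a) * ?J"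
      by (simp add: nn_integral_add nn_integral_cmult nn_integral_sum del: funpow.simps mult_Suc_right)
    also have "(\<Sum>j\<le>m. \<integral>\<^sup>+x. e ((zeta_inv u ^^ (2 * j)) x) epowr a \<partial>\<mu>) \<le> of_nat (Suc m) * (\<integral>\<^sup>+x. e x epowr a \<partial>\<mu>)"
      using sum_bounded_above[of "{..m}" "\<lambda>j. \<integral>\<^sup>+x. e ((zeta_inv u ^^ (2 * j)) x) epowr a \<partial>\<mu>" "\<integral>\<^sup>+x. e x epowr a \<partial>\<mu>"]
        nn_integral_mu_le[of "\<lambda>x. e x epowr a"] \<open>e 0 = 0\<close> by simp
    finally have I: "?I \<le> ?X + ennreal ((2 * D) powr a) * ?J"
      by (simp add: add_right_mono mult_left_mono)
    \<comment> \<open>Each of the \<open>2 * Suc m\<close> applications of \<open>zeta_inv u\<close>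
      gains a factor 2.\<close>
    have J: "4 ^ Suc m * ?J \<le> ?I"
      using nn_integral_zeta_inv_pow[of "\<lambda>x. g n x epowr a" "2 * Suc m"] gz[of n]
      by (simp add: power_mult del: funpow.simps mult_Suc_right power_Suc)
    have "2 * ?I \<le> 2 * (?X + ennreal ((2 * D) powr a) * ?J)"
      by (intro mult_left_mono I) simp
    also have "\<dots> = 2 * (?X) + ennreal (2 * (2 * D) powr a) * ?J"
      by (simp add: distrib_left mult.assoc ennreal_mult del: of_nat_Suc)
    also have "\<dots> \<le> 2 * (?X) + ennreal (4 ^ Suc m) * ?J"
      using assms(9) by (intro add_left_mono mult_right_mono ennreal_leI) auto
    also have "\<dots> \<le> 2 * (?X) + ?I"
      using J by (intro add_left_mono) (subst ennreal_power[symmetric], simp_all only: ennreal_numeral zero_le_numeral)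
    finally show ?thesis using fin by (simp only: ennreal_numeral) (rule ennreal_absorb)
  qed
  have "(\<integral>\<^sup>+x. h x epowr a \<partial>\<mu>) \<le> (\<integral>\<^sup>+x. (SUP n. g n x epowr a) \<partial>\<mu>)"
  proof (intro nn_integral_mono)
    fix x
    have "(SUP n. g n x) = h x"
      unfolding g_def inf_min[symmetric] by (simp add: inf_SUP[symmetric] ennreal_SUP_of_nat_eq_top)
    then show "h x epowr a \<le> (SUP n. g n x epowr a)"
      using epowr_SUP_le[OF \<open>0 < a\<close>, of "\<lambda>n. g n x" UNIV] by simp
  qed
  also have "\<dots> = (SUP n. \<integral>\<^sup>+x. g n x epowr a \<partial>\<mu>)"
    using \<open>0 < a\<close>
    by (intro nn_integral_monotone_convergence_SUP)
       (auto simp: incseq_def le_fun_def g_def simp del: min_less_iff_conj intro!: epowr_mono min.mono)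
  also have "\<dots> \<le> ennreal 2 * (?X)"
    by (intro SUP_least bound)
  also have "\<dots> = ennreal (2 * (2 * C * Suc m) powr a * Suc m) * (\<integral>\<^sup>+x. e x epowr a \<partial>\<mu>)"
    by (simp add: ennreal_mult mult.assoc ennreal_of_nat_eq_real_of_nat del: of_nat_Suc)
  finally show ?thesis .
qed

end

text \<open>These axioms are shared by weighted integration and the weighted essential supremum. In
  \<open>N_cmult\<close> the factor may be infinite, since primitives of \<open>f\<close> may be.
  \<open>N_cont\<close> is continuity under removal of a neighbourhood of 0; it produces the
  functions vanishing near 0 to which the absorption applies.\<close>

locale mean_functional =
  fixes N :: "(real \<Rightarrow> ennreal) \<Rightarrow> ennreal"
  assumes N_mono_AE: "(AE y in lborel. 0 \<le> y \<longrightarrow> \<phi> y \<le> \<psi> y) \<Longrightarrow> N \<phi> \<le> N \<psi>"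
    and N_add: "\<phi> \<in> borel_measurable borel \<Longrightarrow> \<psi> \<in> borel_measurable borel \<Longrightarrow> N (\<lambda>y. \<phi> y + \<psi> y) \<le> N \<phi> + N \<psi>"
    and N_cmult: "\<phi> \<in> borel_measurable borel \<Longrightarrow> N (\<lambda>y. c * \<phi> y) = c * N \<phi>"
    and N_measurable: "case_prod \<Phi> \<in> borel_measurable (borel \<Otimes>\<^sub>M borel) \<Longrightarrow> (\<lambda>x::real. N (\<Phi> x)) \<in> borel_measurable borel"
    and N_cont: "\<phi> \<in> borel_measurable borel \<Longrightarrow> N \<phi> \<le> (SUP n. N (\<lambda>y. indicator {1 / real (Suc n)<..} y * \<phi> y))"
begin

lemma N_mono: "(\<And>y. 0 \<le> y \<Longrightarrow> \<phi> y \<le> \<psi> y) \<Longrightarrow> N \<phi> \<le> N \<psi>"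
  by (rule N_mono_AE) auto

lemma N_mono_except: "(\<And>y. 0 \<le> y \<Longrightarrow> y \<noteq> c \<Longrightarrow> \<phi> y \<le> \<psi> y) \<Longrightarrow> N \<phi> \<le> N \<psi>"
  using AE_lborel_singleton[of c] by (intro N_mono_AE) (auto elim!: eventually_mono)

lemma N_zero [simp]: "N (\<lambda>y. 0) = 0"
  using N_cmult[of "\<lambda>y. 0" 0] by simp

end

locale oinarov_mean = mean_functional +
  fixes K :: "real \<Rightarrow> real \<Rightarrow> ennreal" and D :: real
  assumes K_meas: "case_prod K \<in> borel_measurable (borel \<Otimes>\<^sub>M borel)"
    and D_ge_1: "1 \<le> D"
    and K_tri: "0 \<le> y \<Longrightarrow> y \<le> z \<Longrightarrow> z \<le> x \<Longrightarrow> K x y \<le> ennreal D * (K x z + K z y)"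
    and K_left: "0 \<le> y \<Longrightarrow> y \<le> z \<Longrightarrow> z \<le> x \<Longrightarrow> K x z \<le> ennreal D * K x y"
    and K_right: "0 \<le> y \<Longrightarrow> y \<le> z \<Longrightarrow> z \<le> x \<Longrightarrow> K z y \<le> ennreal D * K x y"
begin

lemma K_meas_comp [measurable (raw)]:
  assumes [measurable]: "f \<in> borel_measurable M" "g \<in> borel_measurable M"
  shows "(\<lambda>x. K (f x) (g x)) \<in> borel_measurable M"
proof -
  have "(\<lambda>x. case_prod K (f x, g x)) \<in> borel_measurable M"
    by (rule measurable_compose[OF _ K_meas]) measurable
  then show ?thesis by simp
qed

text \<open>With \<open>G y\<close> the power of the primitive of \<open>f\<close>, this is
  \<open>h\<close> of the overview, and \<open>split_mean\<close> below is \<open>E\<close>.\<close>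

definition kernel_mean :: "(real \<Rightarrow> ennreal) \<Rightarrow> real \<Rightarrow> ennreal"
  where "kernel_mean G x = N (\<lambda>y. indicator {0<..<x} y * (K x y * G y))"

definition split_mean :: "(real \<Rightarrow> ennreal) \<Rightarrow> real \<Rightarrow> real \<Rightarrow> ennreal"
  where "split_mean G x a = K x a * N (\<lambda>y. indicator {0<..<a} y * G y)
    + N (\<lambda>y. indicator {a<..<x} y * (K x y * G y))"

text \<open>\<open>K_tri\<close> at the intermediate point \<open>a\<close> separates
  \<open>x\<close> from \<open>y\<close>; the term with \<open>K x a\<close> is enlarged to all of
  \<open>{0<..<a}\<close> so as to match the first summand of \<open>split_mean\<close>.\<close>

lemma kernel_far_part:
  assumes [measurable]: "G \<in> borel_measurable borel" and "0 \<le> b" "b \<le> a" "a \<le> x"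
  shows "N (\<lambda>y. indicator {b<..<a} y * (K x y * G y))
    \<le> ennreal D * (K x a * N (\<lambda>y. indicator {0<..<a} y * G y) + N (\<lambda>y. indicator {b<..<a} y * (K a y * G y)))"
proof -
  have "N (\<lambda>y. indicator {b<..<a} y * (K x y * G y))
      \<le> N (\<lambda>y. ennreal D * (K x a * (indicator {0<..<a} y * G y) + indicator {b<..<a} y * (K a y * G y)))"
  proof (rule N_mono)
    fix y :: real assume "0 \<le> y"
    show "indicator {b<..<a} y * (K x y * G y)
      \<le> ennreal D * (K x a * (indicator {0<..<a} y * G y) + indicator {b<..<a} y * (K a y * G y))"
    proof (cases "y \<in> {b<..<a}")
      case True
      then have "K x y * G y \<le> ennreal D * (K x a + K a y) * G y"
        using assms \<open>0 \<le> y\<close> by (intro mult_right_mono K_tri) auto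
      then show ?thesis using True assms by (simp add: algebra_simps)
    qed simp
  qed
  also have "\<dots> = ennreal D * N (\<lambda>y. K x a * (indicator {0<..<a} y * G y) + indicator {b<..<a} y * (K a y * G y))"
    by (rule N_cmult) measurable
  also have "\<dots> \<le> ennreal D * (N (\<lambda>y. K x a * (indicator {0<..<a} y * G y)) + N (\<lambda>y. indicator {b<..<a} y * (K a y * G y)))"
    by (intro mult_left_mono N_add) measurable
  also have "N (\<lambda>y. K x a * (indicator {0<..<a} y * G y)) = K x a * N (\<lambda>y. indicator {0<..<a} y * G y)"
    by (rule N_cmult) measurable
  finally show ?thesis .
qed

lemma N_split_interval:
  assumes [measurable]: "\<phi> \<in> borel_measurable borel" and "b \<le> a" "a \<le> x"
  shows "N (\<lambda>y. indicator {b<..<x} y * \<phi> y)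
    \<le> N (\<lambda>y. indicator {b<..<a} y * \<phi> y) + N (\<lambda>y. indicator {a<..<x} y * \<phi> y)"
proof -
  have "N (\<lambda>y. indicator {b<..<x} y * \<phi> y) \<le> N (\<lambda>y. indicator {b<..<a} y * \<phi> y + indicator {a<..<x} y * \<phi> y)"
    by (rule N_mono_except[of a]) (auto simp: indicator_def)
  also have "\<dots> \<le> N (\<lambda>y. indicator {b<..<a} y * \<phi> y) + N (\<lambda>y. indicator {a<..<x} y * \<phi> y)"
    by (rule N_add) measurable
  finally show ?thesis .
qed

lemma split_mean_step:
  assumes [measurable]: "G \<in> borel_measurable borel" and "0 \<le> b" "b \<le> a" "a \<le> x"
  shows "split_mean G x b \<le> ennreal (2 * D) * (split_mean G x a + split_mean G a b)"
proof -
  let ?W = "\<lambda>t. N (\<lambda>y. indicator {0<..<t} y * G y)"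
  let ?P = "N (\<lambda>y. indicator {a<..<x} y * (K x y * G y))"
  let ?R = "N (\<lambda>y. indicator {b<..<a} y * (K a y * G y))"
  have "K x b * ?W b \<le> ennreal D * (K x a + K a b) * ?W b"
    using assms by (intro mult_right_mono K_tri) auto
  also have "\<dots> \<le> ennreal D * (K x a * ?W a + K a b * ?W b)"
  proof -
    have "?W b \<le> ?W a" using assms by (intro N_mono) (auto simp: indicator_def)
    then have "K x a * ?W b \<le> K x a * ?W a" by (intro mult_left_mono) auto
    then show ?thesis by (auto simp: distrib_right mult.assoc intro!: mult_left_mono add_mono)
  qed
  finally have 1: "K x b * ?W b \<le> ennreal D * (K x a * ?W a + K a b * ?W b)" .
  have "N (\<lambda>y. indicator {b<..<x} y * (K x y * G y)) \<le> N (\<lambda>y. indicator {b<..<a} y * (K x y * G y)) + ?P"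
    using assms by (intro N_split_interval) auto
  also have "\<dots> \<le> ennreal D * (K x a * ?W a + ?R) + ennreal D * ?P"
  proof (rule add_mono)
    show "?P \<le> ennreal D * ?P"
      using D_ge_1 mult_right_mono[of 1 "ennreal D" ?P] by simp
  qed (rule kernel_far_part[OF assms])
  finally have 2: "N (\<lambda>y. indicator {b<..<x} y * (K x y * G y)) \<le> ennreal D * (K x a * ?W a + ?R) + ennreal D * ?P" .
  have "split_mean G x b \<le> ennreal D * (K x a * ?W a + K a b * ?W b) + (ennreal D * (K x a * ?W a + ?R) + ennreal D * ?P)"
    unfolding split_mean_def using 1 2 by (rule add_mono)
  \<comment> \<open>Padding: with the added terms each of the four quantities occurs exactly twice,
    which explains the factor \<open>2 * D\<close>.\<close>
  also have "\<dots> \<le> ennreal D * (K x a * ?W a + K a b * ?W b) + (ennreal D * (K x a * ?W a + ?R) + ennreal D * ?P)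
      + ennreal D * (?P + ?R + K a b * ?W b)"
    by simp
  also have "\<dots> = ennreal (2 * D) * (split_mean G x a + split_mean G a b)"
    using D_ge_1 unfolding split_mean_def by (simp add: ennreal_mult mult_2 algebra_simps)
  finally show ?thesis .
qed

text \<open>Since \<open>a\<close> is arbitrary, one application with a distant \<open>a\<close>
  leaves a single factor \<open>D\<close>, not a power of it, in front of the term to be
  absorbed.\<close>

lemma kernel_mean_step:
  assumes [measurable]: "G \<in> borel_measurable borel" and "0 \<le> a" "a \<le> x"
  shows "kernel_mean G x \<le> ennreal D * (split_mean G x a + kernel_mean G a)"
proof -
  let ?W = "N (\<lambda>y. indicator {0<..<a} y * G y)"
  let ?P = "N (\<lambda>y. indicator {a<..<x} y * (K x y * G y))"
  have "kernel_mean G x \<le> N (\<lambda>y. indicator {0<..<a} y * (K x y * G y)) + ?P"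
    unfolding kernel_mean_def using assms by (intro N_split_interval) auto
  also have "\<dots> \<le> ennreal D * (K x a * ?W + kernel_mean G a) + ennreal D * ?P"
  proof (rule add_mono)
    show "?P \<le> ennreal D * ?P"
      using D_ge_1 mult_right_mono[of 1 "ennreal D" ?P] by simp
    show "N (\<lambda>y. indicator {0<..<a} y * (K x y * G y)) \<le> ennreal D * (K x a * ?W + kernel_mean G a)"
      unfolding kernel_mean_def using kernel_far_part[OF assms(1), of 0 a x] assms by simp
  qed
  also have "\<dots> = ennreal D * (split_mean G x a + kernel_mean G a)"
    unfolding split_mean_def by (simp add: algebra_simps)
  finally show ?thesis .
qed

text \<open>The powers of \<open>2 * D\<close> accumulate only here, on terms that are not absorbed
  and whose constant may therefore be large.\<close>

lemma split_mean_chain: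
  assumes [measurable]: "G \<in> borel_measurable borel" and "\<And>j. 0 \<le> z j" "\<And>j. z (Suc j) \<le> z j"
  shows "split_mean G (z 0) (z (Suc m)) \<le> ennreal ((2 * D) ^ m) * (\<Sum>j\<le>m. split_mean G (z j) (z (Suc j)))"
proof (induction m)
  case (Suc m)
  let ?T = "\<lambda>j. split_mean G (z j) (z (Suc j))"
  have le: "z i \<le> z 0" for i
    by (rule lift_Suc_antimono_le[of z, OF assms(3)]) simp
  have "split_mean G (z 0) (z (Suc (Suc m))) \<le> ennreal (2 * D) * (split_mean G (z 0) (z (Suc m)) + ?T (Suc m))"
    using assms le by (intro split_mean_step) auto
  also have "\<dots> \<le> ennreal (2 * D) * (ennreal ((2 * D) ^ m) * (\<Sum>j\<le>m. ?T j) + ennreal ((2 * D) ^ m) * ?T (Suc m))"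
  proof (intro mult_left_mono add_mono Suc.IH)
    have "1 \<le> (2 * D) ^ m"
      using D_ge_1 by (intro one_le_power) auto
    then have "1 * ?T (Suc m) \<le> ennreal ((2 * D) ^ m) * ?T (Suc m)"
      by (intro mult_right_mono) (simp_all only: ennreal_ge_1 zero_le)
    then show "?T (Suc m) \<le> ennreal ((2 * D) ^ m) * ?T (Suc m)" by simp
  qed simp
  also have "\<dots> = ennreal ((2 * D) ^ Suc m) * (\<Sum>j\<le>Suc m. ?T j)"
    using D_ge_1 by (simp add: ennreal_mult distrib_left mult.assoc)
  finally show ?case .
qed simp

lemma measurable_kernel_mean:
  assumes [measurable]: "G \<in> borel_measurable borel"
  shows "kernel_mean G \<in> borel_measurable borel"
proof -
  have "case_prod (\<lambda>x y. (if 0 < y \<and> y < x then 1 else 0) * (K x y * G y)) \<in> borel_measurable (borel \<Otimes>\<^sub>M borel)"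
    unfolding case_prod_beta by measurable
  from N_measurable[OF this] show ?thesis
    unfolding kernel_mean_def by (rule measurable_cong[THEN iffD1, rotated]) (auto intro!: arg_cong[of _ _ N] simp: indicator_def)
qed

lemma measurable_split_mean:
  assumes [measurable]: "G \<in> borel_measurable borel" "z \<in> borel_measurable borel"
  shows "(\<lambda>x. split_mean G x (z x)) \<in> borel_measurable borel"
proof -
  have "case_prod (\<lambda>x y. (if 0 < y \<and> y < z x then 1 else 0) * G y) \<in> borel_measurable (borel \<Otimes>\<^sub>M borel)"
    unfolding case_prod_beta by measurable
  from N_measurable[OF this] have [measurable]: "(\<lambda>x. N (\<lambda>y. indicator {0<..<z x} y * G y)) \<in> borel_measurable borel"
    by (rule measurable_cong[THEN iffD1, rotated]) (auto intro!: arg_cong[of _ _ N] simp: indicator_def)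
  have "case_prod (\<lambda>x y. (if z x < y \<and> y < x then 1 else 0) * (K x y * G y)) \<in> borel_measurable (borel \<Otimes>\<^sub>M borel)"
    unfolding case_prod_beta by measurable
  from N_measurable[OF this] have [measurable]: "(\<lambda>x. N (\<lambda>y. indicator {z x<..<x} y * (K x y * G y))) \<in> borel_measurable borel"
    by (rule measurable_cong[THEN iffD1, rotated]) (auto intro!: arg_cong[of _ _ N] simp: indicator_def)
  show ?thesis unfolding split_mean_def by measurable
qed

lemma split_mean_mono:
  assumes "\<And>y. 0 \<le> y \<Longrightarrow> G y \<le> G' y" "0 \<le> a"
  shows "split_mean G x a \<le> split_mean G' x a"
  unfolding split_mean_def using assms
  by (intro add_mono mult_left_mono N_mono) (auto simp: indicator_def intro!: mult_left_mono assms(1))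

end

text \<open>The constant of \<open>nn_integral_absorb\<close> for
  \<open>C = D * (2 * D) ^ m\<close>, the product of the factors of \<open>kernel_mean_step\<close>
  and \<open>split_mean_chain\<close>.\<close>

definition absorb_const :: "real \<Rightarrow> nat \<Rightarrow> real \<Rightarrow> real"
  where "absorb_const D m a = 2 * (2 * (D * (2 * D) ^ m) * Suc m) powr a * Suc m"

locale weighted_oinarov_mean = half_line_weight u + oinarov_mean N K D for u N K D
begin

text \<open>The absorption is applied to \<open>G\<close> cut off near 0, with a constant
  independent of the cut-off; \<open>N_cont\<close> and monotone convergence then restore
  \<open>G\<close>.\<close>

lemma nn_integral_kernel_mean_le:
  assumes [measurable]: "G \<in> borel_measurable borel"
    and a: "0 < a" "2 * (2 * D) powr a \<le> 4 ^ Suc m"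
  shows "(\<integral>\<^sup>+x. kernel_mean G x epowr a \<partial>\<mu>)
    \<le> ennreal (absorb_const D m a) * (\<integral>\<^sup>+x. split_mean G x ((zeta_inv u ^^ 2) x) epowr a \<partial>\<mu>)"
    (is "_ \<le> ?C * (\<integral>\<^sup>+x. ?e G x epowr a \<partial>\<mu>)")
proof -
  define G' where "G' n y = indicator {1 / real (Suc n)<..} y * G y" for n y
  have [measurable]: "G' n \<in> borel_measurable borel" for n unfolding G'_def by measurable
  have bound: "(\<integral>\<^sup>+x. kernel_mean (G' n) x epowr a \<partial>\<mu>) \<le> ?C * (\<integral>\<^sup>+x. ?e G x epowr a \<partial>\<mu>)" for n
  proof -
    have "(\<integral>\<^sup>+x. kernel_mean (G' n) x epowr a \<partial>\<mu>) \<le> ?C * (\<integral>\<^sup>+x. ?e (G' n) x epowr a \<partial>\<mu>)"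
      unfolding absorb_const_def
    proof (rule nn_integral_absorb)
      show "kernel_mean (G' n) \<in> borel_measurable borel" by (rule measurable_kernel_mean) measurable
      show "?e (G' n) \<in> borel_measurable borel" by (rule measurable_split_mean) measurable
      show "0 < 1 / real (Suc n)" by simp
      show "kernel_mean (G' n) x = 0" if "0 \<le> x" "x \<le> 1 / real (Suc n)" for x
      proof -
        have "(\<lambda>y. indicator {0<..<x} y * (K x y * G' n y)) = (\<lambda>y. 0)"
          using that by (auto simp: G'_def indicator_def)
        then show ?thesis by (simp add: kernel_mean_def)
      qed
      show "?e (G' n) 0 = 0" by (simp add: split_mean_def)
      fix x :: real assume "0 \<le> x"
      define z where "z j = (zeta_inv u ^^ (2 * j)) x" for j
      have z: "0 \<le> z j" "z (Suc j) \<le> z j" "z j \<le> x" for j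
        using \<open>0 \<le> x\<close> zeta_inv_pow_antimono[of x 0 "2 * j"]
        unfolding z_def by (auto intro!: zeta_inv_pow_nonneg zeta_inv_pow_antimono simp del: funpow.simps)
      have zS: "z (Suc j) = (zeta_inv u ^^ 2) (z j)" for j
        unfolding z_def by (simp only: funpow_add[symmetric, THEN fun_cong, unfolded o_def]) (simp add: numeral_2_eq_2)
      have "kernel_mean (G' n) x \<le> ennreal D * (split_mean (G' n) x (z (Suc m)) + kernel_mean (G' n) (z (Suc m)))"
        using z by (intro kernel_mean_step) auto
      also have "split_mean (G' n) x (z (Suc m)) \<le> ennreal ((2 * D) ^ m) * (\<Sum>j\<le>m. split_mean (G' n) (z j) (z (Suc j)))"
        using split_mean_chain[of "G' n" z m] z by (simp add: z_def)
      finally show "kernel_mean (G' n) x \<le> ennreal (D * (2 * D) ^ m) * (\<Sum>j\<le>m. ?e (G' n) ((zeta_inv u ^^ (2 * j)) x))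
          + ennreal D * kernel_mean (G' n) ((zeta_inv u ^^ (2 * Suc m)) x)"
        using D_ge_1 unfolding zS unfolding z_def zS[unfolded z_def]
        by (simp add: ennreal_mult distrib_left mult.assoc mult_left_mono add_right_mono del: funpow.simps)
    qed (use D_ge_1 a in auto)
    also have "\<dots> \<le> ?C * (\<integral>\<^sup>+x. ?e G x epowr a \<partial>\<mu>)"
    proof (intro mult_left_mono nn_integral_mono_AE)
      show "AE x in \<mu>. ?e (G' n) x epowr a \<le> ?e G x epowr a"
        using AE_mu_pos
        by eventually_elim (use a in \<open>auto intro!: epowr_mono split_mean_mono zeta_inv_pow_nonneg simp: G'_def indicator_def\<close>)
    qed simp
    finally show ?thesis .
  qed
  have "(\<integral>\<^sup>+x. kernel_mean G x epowr a \<partial>\<mu>) \<le> (\<integral>\<^sup>+x. (SUP n. kernel_mean (G' n) x epowr a) \<partial>\<mu>)"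
  proof (intro nn_integral_mono)
    fix x
    have "kernel_mean G x \<le> (SUP n. kernel_mean (G' n) x)"
      unfolding kernel_mean_def by (rule order_trans[OF N_cont]) (auto simp: G'_def ac_simps)
    then have "kernel_mean G x epowr a \<le> (SUP n. kernel_mean (G' n) x) epowr a" using a by (intro epowr_mono)
    then show "kernel_mean G x epowr a \<le> (SUP n. kernel_mean (G' n) x epowr a)"
      using epowr_SUP_le[OF a(1)] by (rule order_trans)
  qed
  also have "\<dots> = (SUP n. \<integral>\<^sup>+x. kernel_mean (G' n) x epowr a \<partial>\<mu>)"
  proof (rule nn_integral_monotone_convergence_SUP)
    show "(\<lambda>x. kernel_mean (G' n) x epowr a) \<in> borel_measurable \<mu>" for n
      using measurable_kernel_mean[of "G' n"] by measurable
    show "incseq (\<lambda>n x. kernel_mean (G' n) x epowr a)"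
    proof (intro incseq_SucI le_funI epowr_mono a)
      fix n x
      have "G' n y \<le> G' (Suc n) y" for y
      proof -
        have "1 / real (Suc (Suc n)) \<le> 1 / real (Suc n)" by (intro divide_left_mono) auto
        then show ?thesis unfolding G'_def by (intro mult_right_mono) (auto simp: indicator_def)
      qed
      then show "kernel_mean (G' n) x \<le> kernel_mean (G' (Suc n)) x"
        unfolding kernel_mean_def by (intro N_mono mult_left_mono) auto
    qed
  qed
  also have "\<dots> \<le> ?C * (\<integral>\<^sup>+x. ?e G x epowr a \<partial>\<mu>)"
    by (intro SUP_least bound)
  finally show ?thesis .
qed

end

section \<open>Weighted norms as mean functionals\<close>

text \<open>\<open>esssup\<close> has a default value at non-measurable functions, hence the case
  distinction.\<close>

lemma esssup_cong_space:
  assumes "\<And>x. x \<in> space M \<Longrightarrow> f x = g x" shows "esssup M f = esssup M g"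
proof (cases "f \<in> borel_measurable M")
  case True
  then have "g \<in> borel_measurable M" using assms by (simp cong: measurable_cong)
  then show ?thesis using True assms by (simp add: esssup_eq_AE cong: AE_cong)
next
  case False
  then have "g \<notin> borel_measurable M" using assms by (simp cong: measurable_cong)
  then show ?thesis using False by (simp add: esssup_non_measurable)
qed

definition mean_exponent :: "ennreal \<Rightarrow> real"
  where "mean_exponent q = (if q = \<infinity> then 1 else enn2real q)"

lemma mean_exponent_top [simp]: "mean_exponent \<infinity> = 1" "mean_exponent top = 1"
  by (simp_all add: mean_exponent_def)

lemma mean_exponent_pos: "0 < q \<Longrightarrow> 0 < mean_exponent q"
  by (simp add: mean_exponent_def enn2real_positive_iff less_top)

text \<open>
  With \<open>Q = mean_exponent q\<close>, both the \<open>L\<^sup>q\<close> norms and the essential suprema of the theorem are of the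
  form \<open>N (g epowr Q) epowr (1 / Q)\<close> for the functional \<open>N\<close> below.
\<close>

definition weight_mean :: "ennreal \<Rightarrow> (real \<Rightarrow> ennreal) \<Rightarrow> (real \<Rightarrow> ennreal) \<Rightarrow> ennreal"
  where "weight_mean q w \<phi> =
    (if q = \<infinity> then Inf {z. AE y in lborel. 0 \<le> y \<longrightarrow> \<phi> y * w y \<le> z}
     else (\<integral>\<^sup>+y\<in>{0..}. \<phi> y * w y \<partial>lborel))"

text \<open>The infimum is attained: it is approached along \<open>1 / Suc n\<close>, and countably
  many almost-everywhere statements hold simultaneously.\<close>

lemma weight_mean_AE:
  "AE y in lborel. 0 \<le> y \<longrightarrow> \<phi> y * w y \<le> weight_mean \<infinity> w \<phi>"
proof (cases "weight_mean \<infinity> w \<phi>")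
  case (real c)
  have "AE y in lborel. 0 \<le> y \<longrightarrow> \<phi> y * w y \<le> ennreal (c + 1 / real (Suc n))" for n
  proof -
    have "weight_mean \<infinity> w \<phi> < ennreal (c + 1 / real (Suc n))"
      using real by (auto intro!: ennreal_lessI add_nonneg_pos)
    then obtain z where "AE y in lborel. 0 \<le> y \<longrightarrow> \<phi> y * w y \<le> z" "z < ennreal (c + 1 / real (Suc n))"
      by (auto simp: weight_mean_def Inf_less_iff)
    then show ?thesis by (auto elim!: eventually_mono)
  qed
  then have "AE y in lborel. \<forall>n::nat. 0 \<le> y \<longrightarrow> \<phi> y * w y \<le> ennreal (c + 1 / real (Suc n))"
    unfolding AE_all_countable by blast
  then show ?thesis
  proof eventually_elim
    case (elim y)
    show ?case
    proof
      assume y: "0 \<le> y"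
      have le: "\<phi> y * w y \<le> ennreal c + ennreal e" if "0 < e" for e
      proof -
        obtain n where "1 / real (Suc n) < e" using nat_approx_posE[OF \<open>0 < e\<close>] .
        then show ?thesis
          using order_trans[OF elim[rule_format, OF y, of n] ennreal_leI[of _ "c + e"]] real that
          by (simp flip: ennreal_plus)
      qed
      show "\<phi> y * w y \<le> weight_mean \<infinity> w \<phi>"
        unfolding real(2) by (rule ennreal_le_epsilon) (rule le)
    qed
  qed
qed auto

lemma weight_mean_leI:
  "(AE y in lborel. 0 \<le> y \<longrightarrow> \<phi> y * w y \<le> c) \<Longrightarrow> weight_mean \<infinity> w \<phi> \<le> c"
  by (auto simp: weight_mean_def intro: Inf_lower)

lemma weight_mean_le_iff:
  "weight_mean \<infinity> w \<phi> \<le> c \<longleftrightarrow> (AE y in lborel. 0 \<le> y \<longrightarrow> \<phi> y * w y \<le> c)"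
proof
  assume "weight_mean \<infinity> w \<phi> \<le> c"
  with weight_mean_AE[of \<phi> w] show "AE y in lborel. 0 \<le> y \<longrightarrow> \<phi> y * w y \<le> c"
    by (auto elim!: eventually_mono)
qed (rule weight_mean_leI)

lemma mean_functional_esssup:
  assumes [measurable]: "w \<in> borel_measurable borel"
  shows "mean_functional (weight_mean \<infinity> w)" (is "mean_functional ?N")
proof
  fix \<phi> \<psi> :: "real \<Rightarrow> ennreal"
  assume "AE y in lborel. 0 \<le> y \<longrightarrow> \<phi> y \<le> \<psi> y"
  then show "?N \<phi> \<le> ?N \<psi>"
    using weight_mean_AE[of \<psi> w] unfolding weight_mean_le_iff
    by eventually_elim (metis mult_right_mono order_trans zero_le)
next
  fix \<phi> \<psi> :: "real \<Rightarrow> ennreal"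
  show "?N (\<lambda>y. \<phi> y + \<psi> y) \<le> ?N \<phi> + ?N \<psi>"
    using weight_mean_AE[of \<phi> w] weight_mean_AE[of \<psi> w] unfolding weight_mean_le_iff
    by eventually_elim (auto simp: distrib_right intro: add_mono)
next
  fix \<phi> :: "real \<Rightarrow> ennreal" and c :: ennreal
  have le: "?N (\<lambda>y. c * \<phi> y) \<le> c * ?N \<phi>" for c \<phi>
    using weight_mean_AE[of \<phi> w] unfolding weight_mean_le_iff
    by eventually_elim (auto simp: mult.assoc intro: mult_left_mono)
  \<comment> \<open>For positive finite \<open>c\<close> this is the converse inequality applied
    with the factor \<open>1 / c\<close>.\<close>
  have "c * ?N \<phi> \<le> ?N (\<lambda>y. c * \<phi> y)"
  proof (cases c)
    case (real r)
    show ?thesis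
    proof (cases "r = 0")
      case False
      have "?N (\<lambda>y. ennreal (1 / r) * (c * \<phi> y)) \<le> ennreal (1 / r) * ?N (\<lambda>y. c * \<phi> y)"
        by (rule le)
      moreover have inv: "ennreal r * ennreal (1 / r) = 1"
        using real False by (simp flip: ennreal_mult)
      then have "ennreal (1 / r) * (c * \<phi> y) = \<phi> y" for y
        using real by (metis mult.assoc mult.commute mult_1)
      ultimately have "c * ?N \<phi> \<le> c * (ennreal (1 / r) * ?N (\<lambda>y. c * \<phi> y))"
        by (simp add: mult_left_mono)
      also have "\<dots> = ?N (\<lambda>y. c * \<phi> y)"
        using inv real by (simp flip: mult.assoc)
      finally show ?thesis .
    qed (use real in simp)
  next
    case top
    show ?thesis
    proof (cases "?N (\<lambda>y. c * \<phi> y) = top")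
      case False
      \<comment> \<open>With an infinite factor, a finite supremum forces the weighted function to
        vanish almost everywhere.\<close>
      have "?N \<phi> \<le> 0"
        using weight_mean_AE[of "\<lambda>y. c * \<phi> y" w] unfolding weight_mean_le_iff
      proof eventually_elim
        case (elim y)
        then show ?case
          using False top by (cases "\<phi> y * w y = 0") (auto simp: mult.assoc ennreal_top_mult top_unique)
      qed
      then show ?thesis by simp
    qed simp
  qed
  with le show "?N (\<lambda>y. c * \<phi> y) = c * ?N \<phi>" by (rule antisym)
next
  fix \<Phi> :: "real \<Rightarrow> real \<Rightarrow> ennreal"
  assume [measurable]: "case_prod \<Phi> \<in> borel_measurable (borel \<Otimes>\<^sub>M borel)"
  show "(\<lambda>x. ?N (\<Phi> x)) \<in> borel_measurable borel"
  proof (rule borel_measurableI_le)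
    fix c
    \<comment> \<open>Measurability in the parameter is reduced to Tonelli: the supremum is at most
      \<open>c\<close> exactly when the integral of the indicator of the exceptional set
      vanishes.\<close>
    define g :: "real \<Rightarrow> real \<Rightarrow> ennreal" where "g x y = (if 0 \<le> y \<and> c < \<Phi> x y * w y then 1 else 0)" for x y
    have g: "case_prod g \<in> borel_measurable (borel \<Otimes>\<^sub>M lborel)"
      unfolding g_def case_prod_beta by measurable
    have [measurable]: "g x \<in> borel_measurable lborel" for x
      using measurable_compose[OF measurable_Pair1' g, of x] by simp
    have "?N (\<Phi> x) \<le> c \<longleftrightarrow> (\<integral>\<^sup>+y. g x y \<partial>lborel) = 0" for x
      unfolding weight_mean_le_iff
      by (subst nn_integral_0_iff_AE) (auto simp: g_def not_less elim!: eventually_mono split: if_splits)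
    moreover have "(\<lambda>x. \<integral>\<^sup>+y. g x y \<partial>lborel) \<in> borel_measurable borel"
      using g by (rule lborel.borel_measurable_nn_integral)
    ultimately show "{x \<in> space borel. ?N (\<Phi> x) \<le> c} \<in> sets borel"
      by simp
  qed
next
  fix \<phi> :: "real \<Rightarrow> ennreal"
  let ?\<phi> = "\<lambda>n y. indicator {1 / real (Suc n)<..} y * \<phi> y"
  have "AE y in lborel. \<forall>n. 0 \<le> y \<longrightarrow> ?\<phi> n y * w y \<le> ?N (?\<phi> n)"
    unfolding AE_all_countable by (intro allI weight_mean_AE)
  then show "?N \<phi> \<le> (SUP n. ?N (?\<phi> n))"
    using AE_lborel_singleton[of "0::real"] unfolding weight_mean_le_iff
  proof eventually_elim
    case (elim y)
    show ?case
    proof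
      assume "0 \<le> y"
      then obtain n where "1 / real (Suc n) < y" using elim(2) nat_approx_posE[of y] by auto
      then have "\<phi> y * w y \<le> ?N (?\<phi> n)" using elim(1) \<open>0 \<le> y\<close> by (auto dest!: spec[of _ n])
      then show "\<phi> y * w y \<le> (SUP n. ?N (?\<phi> n))" by (rule SUP_upper2[rotated]) simp
    qed
  qed
qed

lemma mean_functional_integral:
  assumes [measurable]: "w \<in> borel_measurable borel" and q: "q \<noteq> \<infinity>"
  shows "mean_functional (weight_mean q w)"
proof
  fix \<phi> \<psi> :: "real \<Rightarrow> ennreal"
  assume "AE y in lborel. 0 \<le> y \<longrightarrow> \<phi> y \<le> \<psi> y"
  then have "(\<integral>\<^sup>+y\<in>{0..}. \<phi> y * w y \<partial>lborel) \<le> (\<integral>\<^sup>+y\<in>{0..}. \<psi> y * w y \<partial>lborel)"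
    by (intro nn_integral_mono_AE) (auto elim!: eventually_mono simp: indicator_def intro: mult_right_mono)
  then show "weight_mean q w \<phi> \<le> weight_mean q w \<psi>" using q by (simp add: weight_mean_def)
next
  fix \<phi> \<psi> :: "real \<Rightarrow> ennreal"
  assume [measurable]: "\<phi> \<in> borel_measurable borel" "\<psi> \<in> borel_measurable borel"
  show "weight_mean q w (\<lambda>y. \<phi> y + \<psi> y) \<le> weight_mean q w \<phi> + weight_mean q w \<psi>"
    using q by (simp add: weight_mean_def distrib_right nn_integral_add)
next
  fix \<phi> :: "real \<Rightarrow> ennreal" and c :: ennreal
  assume [measurable]: "\<phi> \<in> borel_measurable borel"
  show "weight_mean q w (\<lambda>y. c * \<phi> y) = c * weight_mean q w \<phi>"
    using q by (simp add: weight_mean_def mult.assoc nn_integral_cmult)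
next
  fix \<Phi> :: "real \<Rightarrow> real \<Rightarrow> ennreal"
  assume [measurable]: "case_prod \<Phi> \<in> borel_measurable (borel \<Otimes>\<^sub>M borel)"
  have "case_prod (\<lambda>x y. \<Phi> x y * w y * indicator {0..} y) \<in> borel_measurable (borel \<Otimes>\<^sub>M lborel)"
    unfolding case_prod_beta by measurable
  from lborel.borel_measurable_nn_integral[OF this]
  show "(\<lambda>x. weight_mean q w (\<Phi> x)) \<in> borel_measurable borel"
    using q by (simp add: weight_mean_def)
next
  fix \<phi> :: "real \<Rightarrow> ennreal"
  assume [measurable]: "\<phi> \<in> borel_measurable borel"
  let ?\<phi> = "\<lambda>n y. indicator {1 / real (Suc n)<..} y * \<phi> y"
  have "(\<integral>\<^sup>+y\<in>{0..}. \<phi> y * w y \<partial>lborel) \<le> (\<integral>\<^sup>+y. (SUP n. ?\<phi> n y * w y * indicator {0..} y) \<partial>lborel)"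
    using AE_lborel_singleton[of "0::real"]
  proof (intro nn_integral_mono_AE, eventually_elim)
    case (elim y)
    show ?case
    proof (cases "0 \<le> y")
      case True
      then obtain n where "1 / real (Suc n) < y" using elim nat_approx_posE[of y] by auto
      then show ?thesis by (intro SUP_upper2[of n]) auto
    qed simp
  qed
  also have "\<dots> = (SUP n. \<integral>\<^sup>+y. ?\<phi> n y * w y * indicator {0..} y \<partial>lborel)"
  proof (rule nn_integral_monotone_convergence_SUP)
    show "incseq (\<lambda>n y. ?\<phi> n y * w y * indicator {0..} y)"
    proof (intro incseq_SucI le_funI mult_right_mono)
      fix n and y :: real
      have "1 / real (Suc (Suc n)) \<le> 1 / real (Suc n)" by (intro divide_left_mono) auto
      then show "indicator {1 / real (Suc n)<..} y \<le> (indicator {1 / real (Suc (Suc n))<..} y :: ennreal)"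
        by (auto simp: indicator_def)
    qed auto
  qed measurable
  finally show "weight_mean q w \<phi> \<le> (SUP n. weight_mean q w (?\<phi> n))"
    using q by (simp add: weight_mean_def)
qed

lemma mean_functional_weight_mean:
  "w \<in> borel_measurable borel \<Longrightarrow> mean_functional (weight_mean q w)"
  using mean_functional_esssup mean_functional_integral by (cases "q = \<infinity>") auto

text \<open>\<open>w\<close> is only Lebesgue measurable, while measurability of
  \<open>N (\<Phi> x)\<close> in \<open>x\<close> rests on joint Borel measurability. A Borel
  representative changes neither integrals nor essential suprema.\<close>

lemma Mplus_borel_version:
  assumes "w \<in> Mplus"
  obtains w' where "w' \<in> borel_measurable borel" "AE y in lborel. 0 \<le> y \<longrightarrow> w y = w' y"
proof -
  have "(\<lambda>y. w y * indicator {0..} y) \<in> borel_measurable (completion lborel)"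
    using assms by (simp add: Mplus_indicator)
  from completion_ex_borel_measurable[OF this]
  obtain w' where "w' \<in> borel_measurable lborel" "AE y in lborel. w y * indicator {0..} y = w' y" by blast
  then show thesis by (intro that[of w']) (auto elim!: eventually_mono)
qed

lemma set_nn_integral_eq_weight_mean:
  assumes "AE y in lborel. 0 \<le> y \<longrightarrow> w y = w' y" "q \<noteq> \<infinity>" "A \<subseteq> {0..}"
  shows "(\<integral>\<^sup>+y\<in>A. w y * \<phi> y \<partial>lebesgue) = weight_mean q w' (\<lambda>y. indicator A y * \<phi> y)"
proof -
  have "(\<integral>\<^sup>+y\<in>A. w y * \<phi> y \<partial>lebesgue) = (\<integral>\<^sup>+y. indicator A y * \<phi> y * w' y * indicator {0..} y \<partial>lebesgue)"
    using AE_completion[OF assms(1)] assms(3)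
    by (intro nn_integral_cong_AE) (auto elim!: eventually_mono simp: indicator_def ac_simps)
  then show ?thesis using assms(2) by (simp add: weight_mean_def nn_integral_completion)
qed

lemma esssup_eq_weight_mean:
  assumes "w \<in> Mplus" "AE y in lborel. 0 \<le> y \<longrightarrow> w y = w' y" "A \<subseteq> {0..}" "A \<in> sets borel"
    and "\<phi> \<in> borel_measurable borel"
  shows "esssup (lebesgue_on A) (\<lambda>y. w y * \<phi> y) = weight_mean \<infinity> w' (\<lambda>y. indicator A y * \<phi> y)"
proof -
  have [measurable]: "A \<in> sets lebesgue" using assms(4) by simp
  have "(\<lambda>y. w y * indicator {0..} y) \<in> borel_measurable lebesgue"
    using assms(1) by (simp add: Mplus_indicator)
  moreover have "\<phi> \<in> borel_measurable lebesgue"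
    by (rule lebesgue_measurable_of_borel[OF assms(5)])
  ultimately have "(\<lambda>y. w y * indicator {0..} y * \<phi> y) \<in> borel_measurable (lebesgue_on A)"
    by (intro measurable_restrict_space1) (rule borel_measurable_times_ennreal)
  then have meas: "(\<lambda>y. w y * \<phi> y) \<in> borel_measurable (lebesgue_on A)"
    by (rule measurable_cong[THEN iffD1, rotated]) (use assms(3) in \<open>auto simp: indicator_def\<close>)
  have "(AE y in lebesgue_on A. w y * \<phi> y \<le> z) \<longleftrightarrow> (AE y in lborel. 0 \<le> y \<longrightarrow> indicator A y * \<phi> y * w' y \<le> z)" for z
  proof -
    have "(AE y in lebesgue_on A. w y * \<phi> y \<le> z) \<longleftrightarrow> (AE y in lborel. y \<in> A \<longrightarrow> w y * \<phi> y \<le> z)"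
      by (subst AE_restrict_space_iff) (auto simp: AE_completion_iff)
    also have "\<dots> \<longleftrightarrow> (AE y in lborel. 0 \<le> y \<longrightarrow> indicator A y * \<phi> y * w' y \<le> z)"
    proof (rule eventually_subst)
      show "AE y in lborel. (y \<in> A \<longrightarrow> w y * \<phi> y \<le> z) = (0 \<le> y \<longrightarrow> indicator A y * \<phi> y * w' y \<le> z)"
        using assms(2) by eventually_elim (use assms(3) in \<open>auto simp: indicator_def mult.commute\<close>)
    qed
    finally show ?thesis .
  qed
  then show ?thesis using meas by (simp add: esssup_eq_AE weight_mean_def)
qed

text \<open>The hypotheses on \<open>k\<close> concern the closed quadrant only; extension by 0
  makes the kernel jointly Borel on the whole plane.\<close>

definition kernel_ext :: "(real \<Rightarrow> real \<Rightarrow> real) \<Rightarrow> real \<Rightarrow> real \<Rightarrow> ennreal"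
  where "kernel_ext k x y = (if 0 \<le> x \<and> 0 \<le> y then ennreal (k x y) else 0)"

lemma oinarov_mean_weight_mean:
  assumes k: "oinarov_kernel D k" and "1 \<le> D" "w \<in> borel_measurable borel"
  shows "oinarov_mean (weight_mean q w) (kernel_ext k) D"
proof -
  interpret mean_functional "weight_mean q w"
    by (rule mean_functional_weight_mean[OF assms(3)])
  have nn: "0 \<le> k x y" if "0 \<le> x" "0 \<le> y" for x y
    using k that by (auto simp: oinarov_kernel_def)
  have bd: "k x z + k z y \<le> D * k x y" "k x y \<le> D * (k x z + k z y)" if "0 \<le> y" "y \<le> z" "z \<le> x" for x y z
    using k that \<open>1 \<le> D\<close> by (auto simp: oinarov_kernel_def field_simps)
  show ?thesis
  proof
    have "(\<lambda>xy. ennreal (case_prod k xy)) \<in> borel_measurable (restrict_space (borel \<Otimes>\<^sub>M borel) ({0..} \<times> {0..}))"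
      using k by (auto simp: oinarov_kernel_def borel_prod)
    then have "(\<lambda>xy. ennreal (case_prod k xy) * indicator ({0..} \<times> {0..}) xy) \<in> borel_measurable (borel \<Otimes>\<^sub>M borel)"
      by (subst (asm) borel_measurable_restrict_space_iff_ennreal) (auto simp: borel_prod)
    moreover have "(\<lambda>xy. ennreal (case_prod k xy) * indicator ({0..} \<times> {0..}) xy) = case_prod (kernel_ext k)"
      by (auto simp: kernel_ext_def fun_eq_iff indicator_def)
    ultimately show "case_prod (kernel_ext k) \<in> borel_measurable (borel \<Otimes>\<^sub>M borel)" by simp
    fix x y z :: real assume xyz: "0 \<le> y" "y \<le> z" "z \<le> x"
    note b = bd[OF xyz] nn[of x z] nn[of z y] nn[of x y]
    show "kernel_ext k x y \<le> ennreal D * (kernel_ext k x z + kernel_ext k z y)"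
      using xyz b \<open>1 \<le> D\<close> by (simp add: kernel_ext_def flip: ennreal_plus ennreal_mult) 
    show "kernel_ext k x z \<le> ennreal D * kernel_ext k x y"
      using xyz b \<open>1 \<le> D\<close> by (simp add: kernel_ext_def flip: ennreal_mult)
    show "kernel_ext k z y \<le> ennreal D * kernel_ext k x y"
      using xyz b \<open>1 \<le> D\<close> by (simp add: kernel_ext_def flip: ennreal_mult)
  qed fact
qed

lemma prim_mono: "mono (prim f)"
  unfolding prim_def by (intro monoI nn_integral_mono) (auto simp: indicator_def)

lemma measurable_prim [measurable]: "prim f \<in> borel_measurable borel"
  by (rule borel_measurable_mono_ennreal[OF prim_mono])

definition prim_from :: "real \<Rightarrow> (real \<Rightarrow> ennreal) \<Rightarrow> real \<Rightarrow> ennreal"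
  where "prim_from c f y = (\<integral>\<^sup>+z\<in>{c..y}. f z \<partial>lebesgue)"

lemma prim_from_0 [simp]: "prim_from 0 f = prim f"
  by (simp add: prim_from_def prim_def fun_eq_iff)

lemma prim_from_mono: "mono (prim_from c f)"
  unfolding prim_from_def by (intro monoI nn_integral_mono) (auto simp: indicator_def)

lemma measurable_prim_from [measurable]: "prim_from c f \<in> borel_measurable borel"
  by (rule borel_measurable_mono_ennreal[OF prim_from_mono])


section \<open>The constants of the theorem expressed through one mean functional\<close>

locale problem = half_line_weight u for u +
  fixes p r :: real and q :: ennreal and v w :: "real \<Rightarrow> ennreal" and k :: "real \<Rightarrow> real \<Rightarrow> real" and D :: real
    and w' :: "real \<Rightarrow> ennreal"
  assumes p_ge_1: "1 \<le> p" and r_pos: "0 < r" and q_pos: "0 < q" and D1: "1 \<le> D"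
    and v_meas: "v \<in> Mplus" and w_meas: "w \<in> Mplus" and kernel: "oinarov_kernel D k"
    and w'_meas: "w' \<in> borel_measurable borel" and w'_eq: "AE y in lborel. 0 \<le> y \<longrightarrow> w y = w' y"
begin

abbreviation "Q \<equiv> mean_exponent q"
abbreviation "N \<equiv> weight_mean q w'"
abbreviation "K \<equiv> kernel_ext k"
abbreviation "pnorm f \<equiv> wnorm (ennreal p) v f"

lemma Q_pos: "0 < Q" by (rule mean_exponent_pos[OF q_pos])

sublocale weighted_oinarov_mean u N K D
  by (intro weighted_oinarov_mean.intro half_line_weight_axioms oinarov_mean_weight_mean kernel D1 w'_meas)

lemma p_pos: "0 < p" using p_ge_1 by simp

lemma N_integral:
  "q \<noteq> \<infinity> \<Longrightarrow> A \<subseteq> {0..} \<Longrightarrow> (\<integral>\<^sup>+y\<in>A. w y * \<phi> y \<partial>lebesgue) = N (\<lambda>y. indicator A y * \<phi> y)"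
  by (rule set_nn_integral_eq_weight_mean[OF w'_eq])

lemma N_esssup:
  "q = \<infinity> \<Longrightarrow> A \<subseteq> {0..} \<Longrightarrow> A \<in> sets borel \<Longrightarrow> \<phi> \<in> borel_measurable borel \<Longrightarrow>
    esssup (lebesgue_on A) (\<lambda>y. w y * \<phi> y) = N (\<lambda>y. indicator A y * \<phi> y)"
  using esssup_eq_weight_mean[OF w_meas w'_eq] by simp

text \<open>Two exceptional points are enough to exchange open and closed intervals.\<close>

lemma N_cong_except:
  assumes "\<And>y. 0 \<le> y \<Longrightarrow> y \<noteq> a \<Longrightarrow> y \<noteq> b \<Longrightarrow> \<phi> y = \<psi> y" shows "N \<phi> = N \<psi>"
proof -
  have "AE y in lborel. 0 \<le> y \<longrightarrow> \<phi> y = \<psi> y"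
    using AE_lborel_singleton[of a] AE_lborel_singleton[of b] by eventually_elim (auto intro: assms)
  then show ?thesis by (intro antisym N_mono_AE) (auto elim!: eventually_mono)
qed

abbreviation "Fq f \<equiv> (\<lambda>y. prim f y epowr Q)"

lemma Q_infinity: "q = \<infinity> \<Longrightarrow> Q = 1" and Q_finite: "q \<noteq> \<infinity> \<Longrightarrow> Q = enn2real q"
  by (simp_all add: mean_exponent_def)

lemma kernel_ext_meas2 [measurable]: "kernel_ext k x \<in> borel_measurable borel"
  by measurable

lemma S_op_eq:
  assumes "0 \<le> x" shows "S_op q k w f x = kernel_mean (Fq f) x epowr (1 / Q)"
proof (cases "q = \<infinity>")
  case True
  have "S_op q k w f x = esssup (lebesgue_on {0<..<x}) (\<lambda>y. w y * (K x y * Fq f y))"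
    using assms True unfolding S_op_def
    by (auto intro!: esssup_cong_space simp: kernel_ext_def Q_infinity ac_simps)
  also have "\<dots> = N (\<lambda>y. indicator {0<..<x} y * (K x y * Fq f y))"
    using True by (intro N_esssup) auto
  finally show ?thesis using Q_infinity[OF True] by (simp add: kernel_mean_def)
next
  case False
  have "S_op q k w f x = (\<integral>\<^sup>+y\<in>{0..x}. w y * (K x y * Fq f y) \<partial>lebesgue) epowr (1 / Q)"
    using assms False unfolding S_op_def
    by (auto intro!: arg_cong2[of _ _ _ _ "(epowr)"] nn_integral_cong simp: kernel_ext_def Q_finite indicator_def ac_simps)
  also have "\<dots> = N (\<lambda>y. indicator {0..x} y * (K x y * Fq f y)) epowr (1 / Q)"
    using False by (subst N_integral) auto
  also have "\<dots> = kernel_mean (Fq f) x epowr (1 / Q)"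
    unfolding kernel_mean_def
    by (intro arg_cong2[of _ _ _ _ "(epowr)"] N_cong_except[of 0 x]) (auto simp: indicator_def)
  finally show ?thesis .
qed

lemma wnorm_kernel_eq:
  assumes "0 \<le> t" and [measurable]: "g \<in> borel_measurable borel"
  shows "wnorm q (\<lambda>y. w y * ennreal (k t y)) g = N (\<lambda>y. K t y * (g y epowr Q)) epowr (1 / Q)"
proof (cases "q = \<infinity>")
  case True
  have "wnorm q (\<lambda>y. w y * ennreal (k t y)) g = esssup (lebesgue_on {0..}) (\<lambda>y. w y * (K t y * g y))"
    using assms True unfolding wnorm_def
    by (auto intro!: esssup_cong_space simp: kernel_ext_def ac_simps)
  also have "\<dots> = N (\<lambda>y. indicator {0..} y * (K t y * g y))"
    using True by (intro N_esssup) auto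
  also have "\<dots> = N (\<lambda>y. K t y * g y)"
    by (rule N_cong_except[of 0 0]) auto
  finally show ?thesis using Q_infinity[OF True] by simp
next
  case False
  have "wnorm q (\<lambda>y. w y * ennreal (k t y)) g = (\<integral>\<^sup>+y\<in>{0..}. w y * (K t y * (g y epowr Q)) \<partial>lebesgue) epowr (1 / Q)"
    using assms False unfolding wnorm_def
    by (auto intro!: arg_cong2[of _ _ _ _ "(epowr)"] nn_integral_cong simp: kernel_ext_def Q_finite indicator_def ac_simps)
  also have "\<dots> = N (\<lambda>y. indicator {0..} y * (K t y * (g y epowr Q))) epowr (1 / Q)"
    using False by (subst N_integral) auto
  also have "\<dots> = N (\<lambda>y. K t y * (g y epowr Q)) epowr (1 / Q)"
    by (intro arg_cong2[of _ _ _ _ "(epowr)"] N_cong_except[of 0 0]) auto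
  finally show ?thesis .
qed

lemma H_cut_norm:
  assumes "0 \<le> t"
  shows "wnorm q (\<lambda>y. w y * ennreal (k t y)) (H_cut t f) = kernel_mean (Fq f) t epowr (1 / Q)"
proof -
  have [measurable]: "H_cut t f \<in> borel_measurable borel" unfolding H_cut_def by measurable
  show ?thesis
    unfolding wnorm_kernel_eq[OF assms \<open>H_cut t f \<in> _\<close>] kernel_mean_def
    by (intro arg_cong2[of _ _ _ _ "(epowr)"] N_cong_except[of 0 t]) (auto simp: H_cut_def indicator_def)
qed

definition block_mean :: "real \<Rightarrow> real \<Rightarrow> (real \<Rightarrow> ennreal) \<Rightarrow> ennreal"
  where "block_mean c d f = N (\<lambda>y. indicator {c<..<d} y * (K d y * (prim_from (zeta_inv u c) f y epowr Q)))"

lemma H_block_norm: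
  assumes "0 \<le> d"
  shows "wnorm q (\<lambda>y. w y * ennreal (k d y)) (H_block u c d f) = block_mean c d f epowr (1 / Q)"
proof -
  have eq: "H_block u c d f = (\<lambda>y. indicator {c<..d} y * prim_from (zeta_inv u c) f y)"
    by (simp add: H_block_def prim_from_def)
  have [measurable]: "H_block u c d f \<in> borel_measurable borel" unfolding eq by measurable
  show ?thesis
    unfolding wnorm_kernel_eq[OF assms \<open>H_block u c d f \<in> _\<close>] block_mean_def
    by (intro arg_cong2[of _ _ _ _ "(epowr)"] N_cong_except[of 0 d]) (auto simp: eq indicator_def)
qed

lemma rnorm_eq:
  assumes "g \<in> borel_measurable borel" "\<And>x. 0 \<le> x \<Longrightarrow> g' x = g x"
  shows "wnorm (ennreal r) u g' = (\<integral>\<^sup>+x. g x epowr r \<partial>\<mu>) epowr (1 / r)"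
  using assms r_pos u_meas
  by (subst nn_integral_half_line_measure)
     (auto simp: wnorm_finite_exponent indicator_def ac_simps intro!: arg_cong2[of _ _ _ _ "(epowr)"] nn_integral_cong)

lemma measurable_Fq [measurable]: "Fq f \<in> borel_measurable borel"
  by measurable

abbreviation "CS \<equiv> C_S p r q u v w k"
abbreviation "BB0 \<equiv> B0 p r q u v w k"
abbreviation "BB1 \<equiv> B1 p r q u v w k"
abbreviation "BB2 \<equiv> B2 p r q u v w k"
abbreviation "rint g \<equiv> \<integral>\<^sup>+x. g x epowr (r / Q) \<partial>\<mu>"

lemma C_S_eq:
  "CS = least_const (ennreal p) v (\<lambda>f. rint (kernel_mean (Fq f)) epowr (1 / r))"
proof -
  have [measurable]: "kernel_mean (Fq f) \<in> borel_measurable borel" for f by (rule measurable_kernel_mean) measurable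
  have "wnorm (ennreal r) u (S_op q k w f) = (\<integral>\<^sup>+x. (kernel_mean (Fq f) x epowr (1 / Q)) epowr r \<partial>\<mu>) epowr (1 / r)" for f
    by (rule rnorm_eq) (auto simp: S_op_eq)
  then show ?thesis using Q_pos r_pos by (simp add: C_S_def op_norm_def epowr_epowr)
qed

text \<open>Normalised so that the power \<open>r / Q\<close>, taken in \<open>rint\<close>, gives
  the integrand of the theorem; in this form it is comparable pointwise with
  \<open>kernel_mean (Fq f)\<close>.\<close>

definition B0_integrand :: "(real \<Rightarrow> ennreal) \<Rightarrow> real \<Rightarrow> ennreal"
  where "B0_integrand f x = N (\<lambda>y. indicator {(zeta_inv u ^^ 3) x<..<x} y * K x y) * Fq f ((zeta_inv u ^^ 3) x)"

definition B1_integrand :: "(real \<Rightarrow> ennreal) \<Rightarrow> real \<Rightarrow> ennreal"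
  where "B1_integrand f x = K x ((zeta_inv u ^^ 2) x) * N (\<lambda>y. indicator {0<..<(zeta_inv u ^^ 2) x} y * Fq f y)"

lemma measurable_N_interval:
  fixes \<Phi> :: "real \<Rightarrow> real \<Rightarrow> ennreal" and a b :: "real \<Rightarrow> real"
  assumes [measurable]: "case_prod \<Phi> \<in> borel_measurable (borel \<Otimes>\<^sub>M borel)"
    "a \<in> borel_measurable borel" "b \<in> borel_measurable borel"
  shows "(\<lambda>x. N (\<lambda>y. indicator {a x<..<b x} y * \<Phi> x y)) \<in> borel_measurable borel"
proof -
  have "case_prod (\<lambda>x y. (if a x < y \<and> y < b x then 1 else 0) * \<Phi> x y) \<in> borel_measurable (borel \<Otimes>\<^sub>M borel)"
    unfolding case_prod_beta by measurable
  from N_measurable[OF this] show ?thesis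
    by (rule measurable_cong[THEN iffD1, rotated]) (auto intro!: arg_cong[of _ _ N] simp: indicator_def)
qed

lemma measurable_B0_integrand: "B0_integrand f \<in> borel_measurable borel"
proof -
  have "(\<lambda>x. N (\<lambda>y. indicator {(zeta_inv u ^^ 3) x<..<x} y * K x y)) \<in> borel_measurable borel"
    by (rule measurable_N_interval[OF K_meas]) measurable
  then show ?thesis unfolding B0_integrand_def by measurable
qed

lemma measurable_B1_integrand: "B1_integrand f \<in> borel_measurable borel"
proof -
  have "(\<lambda>x. N (\<lambda>y. indicator {0<..<(zeta_inv u ^^ 2) x} y * Fq f y)) \<in> borel_measurable borel"
    by (rule measurable_N_interval) measurable
  then show ?thesis unfolding B1_integrand_def by measurable
qed

lemma B0_eq:
  "BB0 = least_const (ennreal p) v (\<lambda>f. rint (B0_integrand f) epowr (1 / r))"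
proof -
  note [measurable] = measurable_B0_integrand
  have rQ: "0 < r / Q" using r_pos Q_pos by simp
  have FQ: "(Fq f y) epowr (r / Q) = prim f y epowr r" for f y
    using Q_pos r_pos by (simp add: epowr_epowr)
  have inf: "N (\<lambda>y. indicator {(zeta_inv u ^^ 3) x<..<x} y * K x y)
      = esssup (lebesgue_on {(zeta_inv u ^^ 3) x<..<x}) (\<lambda>y. ennreal (k x y) * w y)" if "q = \<infinity>" "0 \<le> x" for x
  proof -
    have "N (\<lambda>y. indicator {(zeta_inv u ^^ 3) x<..<x} y * K x y)
      = esssup (lebesgue_on {(zeta_inv u ^^ 3) x<..<x}) (\<lambda>y. w y * K x y)"
      using that zeta_inv_pow_nonneg[of x 3] by (subst N_esssup) auto
    also have "\<dots> = esssup (lebesgue_on {(zeta_inv u ^^ 3) x<..<x}) (\<lambda>y. ennreal (k x y) * w y)"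
      using that zeta_inv_pow_nonneg[of x 3]
      by (intro esssup_cong_space) (auto simp: kernel_ext_def ac_simps)
    finally show ?thesis .
  qed
  have fin: "N (\<lambda>y. indicator {(zeta_inv u ^^ 3) x<..<x} y * K x y)
      = (\<integral>\<^sup>+y\<in>{(zeta_inv u ^^ 3) x..x}. ennreal (k x y) * w y \<partial>lebesgue)" if "q \<noteq> \<infinity>" "0 \<le> x" for x
  proof -
    have "N (\<lambda>y. indicator {(zeta_inv u ^^ 3) x<..<x} y * K x y) = N (\<lambda>y. indicator {(zeta_inv u ^^ 3) x..x} y * K x y)"
      by (rule N_cong_except[of "(zeta_inv u ^^ 3) x" x]) (auto simp: indicator_def)
    also have "\<dots> = (\<integral>\<^sup>+y\<in>{(zeta_inv u ^^ 3) x..x}. w y * K x y \<partial>lebesgue)"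
      using that zeta_inv_pow_nonneg[of x 3] by (subst N_integral) auto
    also have "\<dots> = (\<integral>\<^sup>+y\<in>{(zeta_inv u ^^ 3) x..x}. ennreal (k x y) * w y \<partial>lebesgue)"
      using that zeta_inv_pow_nonneg[of x 3]
      by (intro nn_integral_cong) (auto simp: kernel_ext_def indicator_def ac_simps)
    finally show ?thesis .
  qed
  have N_eq: "N (\<lambda>y. indicator {(zeta_inv u ^^ 3) x<..<x} y * K x y)
      = (if q = \<infinity> then esssup (lebesgue_on {(zeta_inv u ^^ 3) x<..<x}) (\<lambda>y. ennreal (k x y) * w y)
         else (\<integral>\<^sup>+y\<in>{(zeta_inv u ^^ 3) x..x}. ennreal (k x y) * w y \<partial>lebesgue))" if "0 \<le> x" for x
  proof (cases "q = \<infinity>")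
    case True
    show ?thesis unfolding if_P[OF True] by (rule inf[OF True that])
  next
    case False
    show ?thesis unfolding if_not_P[OF False] by (rule fin[OF False that])
  qed
  show ?thesis unfolding B0_def
  proof (intro arg_cong[of _ _ "least_const (ennreal p) v"] ext, goal_cases)
    case (1 f)
    show ?case
    proof -
      have "rint (B0_integrand f) = (\<integral>\<^sup>+x\<in>{0..}. u x
           * (N (\<lambda>y. indicator {(zeta_inv u ^^ 3) x<..<x} y * K x y) epowr (r / Q))
           * (prim f ((zeta_inv u ^^ 3) x) epowr r) \<partial>lebesgue)"
        using rQ unfolding nn_integral_half_line_measure[OF u_meas measurable_epowr[OF measurable_B0_integrand]]
          by (simp add: B0_integrand_def epowr_mult FQ mult.assoc)
      also have "\<dots> = (\<integral>\<^sup>+x\<in>{0..}. u x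
           * ((if q = \<infinity> then esssup (lebesgue_on {(zeta_inv u ^^ 3) x<..<x}) (\<lambda>y. ennreal (k x y) * w y)
               else (\<integral>\<^sup>+y\<in>{(zeta_inv u ^^ 3) x..x}. ennreal (k x y) * w y \<partial>lebesgue)) epowr (r / Q))
           * (prim f ((zeta_inv u ^^ 3) x) epowr r) \<partial>lebesgue)"
        apply (intro nn_integral_cong)
        subgoal for x by (cases "0 \<le> x") (simp only: N_eq, simp)
        done
      finally have eq: "rint (B0_integrand f) = \<dots>" .
      show ?thesis
      proof (cases "q = \<infinity>")
        case True
        show ?thesis unfolding eq unfolding if_P[OF True] Q_infinity[OF True] by simp
      next
        case False
        show ?thesis unfolding eq unfolding if_not_P[OF False] Q_finite[OF False] ..
      qed
    qed
  qed
qed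

lemma B1_eq:
  "BB1 = least_const (ennreal p) v (\<lambda>f. rint (B1_integrand f) epowr (1 / r))"
proof -
  note [measurable] = measurable_B1_integrand
  have rQ: "0 < r / Q" using r_pos Q_pos by simp
  have inf: "N (\<lambda>y. indicator {0<..<a} y * Fq f y) = esssup (lebesgue_on {0<..<a}) (\<lambda>y. w y * prim f y)" if "q = \<infinity>" for a f
    using that Q_infinity[OF that] by (subst N_esssup[symmetric]) auto
  have fin: "N (\<lambda>y. indicator {0<..<a} y * Fq f y) = (\<integral>\<^sup>+y\<in>{0..a}. w y * (prim f y epowr enn2real q) \<partial>lebesgue)"
    if "q \<noteq> \<infinity>" for a f
  proof -
    have "N (\<lambda>y. indicator {0<..<a} y * Fq f y) = N (\<lambda>y. indicator {0..a} y * Fq f y)"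
      by (rule N_cong_except[of 0 a]) (auto simp: indicator_def)
    then show ?thesis using that by (subst N_integral) (auto simp: Q_finite)
  qed
  show ?thesis unfolding B1_def
  proof (intro arg_cong[of _ _ "least_const (ennreal p) v"] ext, goal_cases)
    case (1 f)
    show ?case
    proof -
      have "rint (B1_integrand f) = (\<integral>\<^sup>+x\<in>{0..}. u x
           * (K x ((zeta_inv u ^^ 2) x) epowr (r / Q))
           * (N (\<lambda>y. indicator {0<..<(zeta_inv u ^^ 2) x} y * Fq f y) epowr (r / Q)) \<partial>lebesgue)"
        using rQ unfolding nn_integral_half_line_measure[OF u_meas measurable_epowr[OF measurable_B1_integrand]]
          by (simp add: B1_integrand_def epowr_mult mult.assoc)
      also have "\<dots> = (\<integral>\<^sup>+x\<in>{0..}. u x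
           * (ennreal (k x ((zeta_inv u ^^ 2) x)) epowr (r / Q))
           * (N (\<lambda>y. indicator {0<..<(zeta_inv u ^^ 2) x} y * Fq f y) epowr (r / Q)) \<partial>lebesgue)"
        using zeta_inv_pow_nonneg[of _ 2] by (intro nn_integral_cong) (simp add: indicator_def kernel_ext_def del: funpow.simps)
      finally have eq: "rint (B1_integrand f) = \<dots>" .
      show ?thesis
      proof (cases "q = \<infinity>")
        case True
        show ?thesis unfolding eq unfolding if_P[OF True] inf[OF True] unfolding Q_infinity[OF True] by simp
      next
        case False
        show ?thesis unfolding eq unfolding if_not_P[OF False] fin[OF False] unfolding Q_finite[OF False] ..
      qed
    qed
  qed
qed

end

section \<open>Dyadic levels and the lower bounds\<close>

lemma Mplus_interval_measurable:
  assumes "f \<in> Mplus" "0 \<le> c" shows "(\<lambda>z. f z * indicator {c..y} z) \<in> borel_measurable lebesgue"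
proof -
  have "(\<lambda>z. f z * indicator {0..} z) \<in> borel_measurable lebesgue"
    using assms(1) by (simp add: Mplus_indicator)
  then have "(\<lambda>z. (f z * indicator {0..} z) * indicator {c..y} z) \<in> borel_measurable lebesgue"
    by (rule borel_measurable_times_ennreal) simp
  then show ?thesis
    by (rule measurable_cong[THEN iffD1, rotated]) (use assms(2) in \<open>auto simp: indicator_def\<close>)
qed

lemma prim_from_cmult:
  assumes "f \<in> Mplus" "0 \<le> c"
  shows "prim_from c (\<lambda>x. ennreal a * f x) y = ennreal a * prim_from c f y"
  unfolding prim_from_def mult.assoc
  by (rule nn_integral_cmult) (rule Mplus_interval_measurable[OF assms])

lemma prim_le_add_prim_from:
  assumes "f \<in> Mplus" "0 \<le> c" shows "prim f y \<le> prim f c + prim_from c f y"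
proof -
  have "prim f y \<le> (\<integral>\<^sup>+z. f z * indicator {0..c} z + f z * indicator {c..y} z \<partial>lebesgue)"
    unfolding prim_def by (intro nn_integral_mono) (auto simp: indicator_def)
  also have "\<dots> = prim f c + prim_from c f y"
    unfolding prim_def prim_from_def
    by (rule nn_integral_add) (auto intro: Mplus_interval_measurable assms)
  finally show ?thesis .
qed

lemma prim_from_mono_fun: "(\<And>x. f x \<le> g x) \<Longrightarrow> prim_from c f y \<le> prim_from c g y"
  unfolding prim_from_def by (intro nn_integral_mono mult_right_mono) auto

lemma prim_from_antimono: "c \<le> d \<Longrightarrow> prim_from d f y \<le> prim_from c f y"
  unfolding prim_from_def by (intro nn_integral_mono) (auto simp: indicator_def)

text \<open>Sums over the levels are integrals against counting measure, which makes Fubini and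
  monotonicity of the integral available without any summability question.\<close>

abbreviation int_sum :: "(int \<Rightarrow> ennreal) \<Rightarrow> ennreal" (binder "ISUM " 10)
  where "int_sum f \<equiv> integral\<^sup>N (count_space UNIV) f"

lemma nn_integral_count_space_int:
  "(\<integral>\<^sup>+k. f k \<partial>count_space (UNIV :: int set)) = (\<Sum>n. f (int_decode n))"
  by (subst nn_integral_bij_count_space[OF bij_int_decode, symmetric]) (rule nn_integral_count_space_nat)

lemma nn_integral_count_space_int_le:
  fixes f :: "int \<Rightarrow> ennreal"
  assumes "\<And>F. finite F \<Longrightarrow> (\<Sum>k\<in>F. f k) \<le> C"
  shows "(ISUM k. f k) \<le> C"
proof -
  have bij: "bij_betw int_decode UNIV UNIV" by (rule bij_int_decode)
  have "(ISUM k. f k) = (\<Sum>n. f (int_decode n))"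
    by (rule nn_integral_count_space_int)
  also have "\<dots> \<le> C"
    unfolding suminf_eq_SUP
  proof (rule SUP_least)
    fix n
    have "(\<Sum>i<n. f (int_decode i)) = (\<Sum>k\<in>int_decode ` {..<n}. f k)"
      using bij by (subst sum.reindex) (auto simp: bij_betw_def intro: inj_on_subset)
    then show "(\<Sum>i<n. f (int_decode i)) \<le> C" using assms by simp
  qed
  finally show ?thesis .
qed

text \<open>\<open>s / r\<close> is the exponent conjugate to \<open>p / r\<close>. The form
  \<open>1 + s / p\<close> reflects that a level contributes its mass once and the power
  \<open>s / p\<close> of its tail.\<close>

lemma dual_exponent:
  fixes r p s :: real
  assumes "0 < r" "r < p" and s: "s = 1 / (1 / r - 1 / p)"
  shows "0 < s" "s / r = 1 + s / p" "r / s = 1 - r / p"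
proof -
  have "0 < 1 / r - 1 / p" using assms by (simp add: field_simps)
  then show s_pos: "0 < s" using s by simp
  have rel: "1 / s = 1 / r - 1 / p" using s by simp
  have "s / r - s / p = s * (1 / s)" unfolding rel by (simp add: right_diff_distrib)
  then show "s / r = 1 + s / p" using s_pos by simp
  have "r / s = r * (1 / s)" by simp
  then show "r / s = 1 - r / p" unfolding rel using assms(1) by (simp add: right_diff_distrib)
qed

text \<open>Converse Hoelder inequality for finite sums with the exponents \<open>s / r\<close> and
  \<open>p / r\<close>.\<close>

lemma power_duality:
  fixes e :: "'a \<Rightarrow> real"
  assumes "finite F" "0 < r" "r < p" and s: "s = 1 / (1 / r - 1 / p)"
    and e: "\<And>k. k \<in> F \<Longrightarrow> 0 \<le> e k"
    and bound: "\<And>a. (\<And>k. 0 \<le> a k) \<Longrightarrow> (\<Sum>k\<in>F. a k powr p) \<le> 1 \<Longrightarrow> (\<Sum>k\<in>F. e k * a k powr r) \<le> M"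
  shows "(\<Sum>k\<in>F. e k powr (s / r)) \<le> M powr (s / r)"
proof -
  define T where "T = (\<Sum>k\<in>F. e k powr (s / r))"
  have T: "0 \<le> T" by (auto simp: T_def intro: sum_nonneg)
  note s_pos = dual_exponent(1)[OF assms(2,3) s] and sr = dual_exponent(2,3)[OF assms(2,3) s]
  show ?thesis
  proof (cases "T = 0")
    case True then show ?thesis by (simp add: T_def)
  next
    case False
    then have T0: "0 < T" using T by simp
    \<comment> \<open>The equality case of Hoelder: the powers \<open>a k powr p\<close> are
      proportional to \<open>e k powr (s / r)\<close> and normalised to sum 1.\<close>
    define a where "a k = (if k \<in> F then (e k powr (s / r) / T) powr (1 / p) else 0)" for k
    have "(\<Sum>k\<in>F. a k powr p) = (\<Sum>k\<in>F. e k powr (s / r) / T)"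
      using assms T0 by (intro sum.cong) (auto simp: a_def powr_powr)
    also have "\<dots> = 1" using False by (simp add: sum_divide_distrib[symmetric] T_def[symmetric])
    finally have "(\<Sum>k\<in>F. e k * a k powr r) \<le> M" by (intro bound) (auto simp: a_def)
    moreover have "(\<Sum>k\<in>F. e k * a k powr r) = (\<Sum>k\<in>F. e k powr (s / r) * T powr (- r / p))"
    proof (rule sum.cong)
      fix k assume k: "k \<in> F"
      show "e k * a k powr r = e k powr (s / r) * T powr (- r / p)"
      proof (cases "e k = 0")
        case False
        then have ek: "0 < e k" using e[OF k] by simp
        have "a k powr r = e k powr (s / p) * T powr (- r / p)"
          using ek k T0 assms
          by (simp add: a_def powr_powr powr_divide powr_minus_divide)
        moreover have "e k * e k powr (s / p) = e k powr (s / r)"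
          using ek by (simp add: sr powr_add)
        ultimately show ?thesis by (simp add: mult.assoc[symmetric])
      qed simp
    qed simp
    also have "\<dots> = T * T powr (- r / p)" by (simp add: T_def sum_distrib_right)
    also have "\<dots> = T powr (r / s)"
    proof -
      have "T * T powr (- r / p) = T powr 1 * T powr (- r / p)" using T0 by simp
      also have "\<dots> = T powr (1 - r / p)" by (subst powr_add[symmetric]) simp
      finally show ?thesis by (simp add: sr)
    qed
    ultimately have "(T powr (r / s)) powr (s / r) \<le> M powr (s / r)"
      using s_pos assms by (intro powr_mono2) auto
    then show ?thesis using T0 s_pos assms by (simp add: powr_powr T_def)
  qed
qed

context half_line_weight
begin

text \<open>Ratio \<open>sqrt 2\<close>: twice the upper end of a level stays below
  \<open>3 * lev k\<close>, which leaves the window from \<open>3 * lev k\<close> to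
  \<open>4 * lev k\<close> for the base points of the blocks.\<close>

definition lev :: "int \<Rightarrow> real" where "lev k = 2 powr (real_of_int k / 2)"

definition level_set :: "int \<Rightarrow> real set"
  where "level_set k = {x. 0 < x \<and> ennreal (lev k) \<le> tail u x \<and> tail u x < ennreal (lev (k + 1))}"

lemma lev_pos [simp]: "0 < lev k" and lev_nonneg [simp]: "0 \<le> lev k" and lev_neq_0 [simp]: "lev k \<noteq> 0"
  by (simp_all add: lev_def)

lemma lev_Suc: "lev (k + 1) \<le> 3 / 2 * lev k" "4 / 3 * lev k \<le> lev (k + 1)"
proof -
  have eq: "lev (k + 1) = sqrt 2 * lev k"
    by (simp add: lev_def add_divide_distrib powr_add powr_half_sqrt)
  \<comment> \<open>Rational bounds for the ratio keep all later comparisons of levels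
    linear.\<close>
  have "sqrt 2 \<le> 3 / 2" by (rule real_le_lsqrt) (auto simp: power2_eq_square)
  moreover have "4 / 3 \<le> sqrt 2" by (rule real_le_rsqrt) (simp add: power2_eq_square)
  ultimately  show "lev (k + 1) \<le> 3 / 2 * lev k" "4 / 3 * lev k \<le> lev (k + 1)"
    unfolding eq by (auto intro: mult_right_mono less_imp_le)
qed

lemma lev_mono: "j \<le> k \<Longrightarrow> lev j \<le> lev k"
  by (simp add: lev_def)

lemma lev_le_iff: "0 < t \<Longrightarrow> lev k \<le> t \<longleftrightarrow> k \<le> \<lfloor>2 * log 2 t\<rfloor>"
  unfolding lev_def by (subst powr_le_iff) (auto simp: le_floor_iff)

lemma level_set_measurable [measurable]: "level_set k \<in> sets borel"
  unfolding level_set_def by measurable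

lemma ex_level_set:
  assumes "0 < x" shows "\<exists>k. x \<in> level_set k"
proof -
  obtain t where t: "tail u x = ennreal t" "0 < t"
    using tail_pos[OF assms] tail_fin[OF assms] by (cases "tail u x") auto
  let ?k = "\<lfloor>2 * log 2 t\<rfloor>"
  have "lev ?k \<le> t" "\<not> lev (?k + 1) \<le> t" using t by (auto simp: lev_le_iff)
  then show ?thesis using t assms
    by (intro exI[of _ ?k]) (auto simp: level_set_def ennreal_less_iff not_le)
qed

lemma emeasure_level_set: "emeasure \<mu> (level_set k) \<le> ennreal (3 / 2 * lev k)"
proof -
  have "emeasure \<mu> (level_set k) \<le> emeasure \<mu> {x. 0 < x \<and> tail u x \<le> ennreal (lev (k + 1))}"
    by (intro emeasure_mono) (auto simp: level_set_def)
  also have "\<dots> \<le> ennreal (lev (k + 1))" by (rule emeasure_sublevel_le)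
  also have "\<dots> \<le> ennreal (3 / 2 * lev k)" by (intro ennreal_leI lev_Suc)
  finally show ?thesis .
qed

definition level_step :: "(int \<Rightarrow> ennreal) \<Rightarrow> real \<Rightarrow> ennreal"
  where "level_step G x = (ISUM k. G k * indicator (level_set k) x)"

lemma measurable_level_step [measurable]: "level_step G \<in> borel_measurable borel"
  unfolding level_step_def[abs_def] nn_integral_count_space_int by measurable

lemma nn_integral_level_step:
  "(\<integral>\<^sup>+x. level_step G x \<partial>\<mu>) = (ISUM k. G k * emeasure \<mu> (level_set k))"
  unfolding level_step_def
  by (subst nn_integral_count_space_nn_integral) (auto simp: nn_integral_cmult_indicator)

lemma level_step_ge: "x \<in> level_set k \<Longrightarrow> G k \<le> level_step G x"
  unfolding level_step_def
  using nn_integral_ge_point[of k UNIV "\<lambda>k. G k * indicator (level_set k) x"] by simp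

lemma level_step_bound:
  "(\<integral>\<^sup>+x. level_step G x \<partial>\<mu>) \<le> (ISUM k. G k * ennreal (3 / 2 * lev k))"
  unfolding nn_integral_level_step by (intro nn_integral_mono mult_left_mono emeasure_level_set) simp

end

section \<open>Lower bounds for the least constant of the operator\<close>

context problem
begin

lemma kernel_mean_mono:
  "(\<And>y. 0 \<le> y \<Longrightarrow> G y \<le> G' y) \<Longrightarrow> kernel_mean G x \<le> kernel_mean G' x"
  unfolding kernel_mean_def by (intro N_mono mult_left_mono) auto

lemma kernel_mean_cmult:
  assumes [measurable]: "G \<in> borel_measurable borel"
  shows "kernel_mean (\<lambda>y. c * G y) x = c * kernel_mean G x"
proof -
  have "kernel_mean (\<lambda>y. c * G y) x = N (\<lambda>y. c * (indicator {0<..<x} y * (K x y * G y)))"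
    unfolding kernel_mean_def by (intro arg_cong[of _ _ N]) (auto simp: ac_simps)
  also have "\<dots> = c * kernel_mean G x" unfolding kernel_mean_def by (rule N_cmult) measurable
  finally show ?thesis .
qed

lemma Fq_cmult:
  assumes "f \<in> Mplus" "0 \<le> a"
  shows "Fq (\<lambda>x. ennreal a * f x) y = (ennreal a epowr Q) * Fq f y"
  using prim_from_cmult[OF assms(1), of 0 a y] Q_pos by (simp add: epowr_mult)

definition S_norm :: "(real \<Rightarrow> ennreal) \<Rightarrow> ennreal"
  where "S_norm f = rint (kernel_mean (Fq f)) epowr (1 / r)"

lemma C_S_eq': "CS = least_const (ennreal p) v S_norm"
  by (simp add: C_S_eq S_norm_def[abs_def])

lemma measurable_kernel_mean_Fq [measurable]: "kernel_mean (Fq f) \<in> borel_measurable borel"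
  by (rule measurable_kernel_mean) measurable

lemma homogeneous_S_norm: "homogeneous S_norm"
  unfolding homogeneous_def
proof (intro ballI allI impI)
  fix f :: "real \<Rightarrow> ennreal" and a :: real assume f: "f \<in> Mplus" and a: "0 < a"
  have "kernel_mean (Fq (\<lambda>x. ennreal a * f x)) x = (ennreal a epowr Q) * kernel_mean (Fq f) x" for x
    using f a by (simp add: Fq_cmult kernel_mean_cmult)
  then have "S_norm (\<lambda>x. ennreal a * f x) = (\<integral>\<^sup>+x. ennreal (a powr r) * (kernel_mean (Fq f) x epowr (r / Q)) \<partial>\<mu>) epowr (1 / r)"
    using a r_pos Q_pos by (simp add: S_norm_def epowr_mult epowr_ennreal powr_powr)
  also have "\<dots> = (ennreal (a powr r) * rint (kernel_mean (Fq f))) epowr (1 / r)"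
    by (subst nn_integral_cmult) auto
  also have "\<dots> = ennreal a * S_norm f"
    using a r_pos by (simp add: S_norm_def epowr_mult epowr_ennreal powr_powr)
  finally show "S_norm (\<lambda>x. ennreal a * f x) = ennreal a * S_norm f" .
qed

lemma homogeneous_block:
  "homogeneous (\<lambda>f. block_mean c d f epowr (1 / Q))"
  unfolding homogeneous_def
proof (intro ballI allI impI)
  fix f :: "real \<Rightarrow> ennreal" and a :: real assume f: "f \<in> Mplus" and a: "0 < a"
  have "block_mean c d (\<lambda>x. ennreal a * f x)
      = N (\<lambda>y. ennreal (a powr Q) * (indicator {c<..<d} y * (K d y * (prim_from (zeta_inv u c) f y epowr Q))))"
    unfolding block_mean_def using f a Q_pos zeta_inv_nonneg[of c]
    by (intro arg_cong[of _ _ N]) (auto simp: prim_from_cmult epowr_mult epowr_ennreal ac_simps)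
  also have "\<dots> = ennreal (a powr Q) * block_mean c d f"
    unfolding block_mean_def by (rule N_cmult) measurable
  finally show "block_mean c d (\<lambda>x. ennreal a * f x) epowr (1 / Q) = ennreal a * (block_mean c d f epowr (1 / Q))"
    using a Q_pos by (simp add: epowr_mult epowr_ennreal powr_powr)
qed

lemma integral_norm_le:
  assumes [measurable]: "h \<in> borel_measurable borel" and "0 \<le> c" "\<And>x. 0 < x \<Longrightarrow> g x \<le> ennreal c * h x"
  shows "rint g epowr (1 / r)
    \<le> ennreal (c powr (1 / Q)) * (rint h epowr (1 / r))"
proof -
  have "rint g \<le> (\<integral>\<^sup>+x. ennreal (c powr (r / Q)) * (h x epowr (r / Q)) \<partial>\<mu>)"
  proof (intro nn_integral_mono_AE)
    show "AE x in \<mu>. g x epowr (r / Q) \<le> ennreal (c powr (r / Q)) * (h x epowr (r / Q))"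
      using AE_mu_pos
    proof eventually_elim
      case (elim x)
      have "g x epowr (r / Q) \<le> (ennreal c * h x) epowr (r / Q)"
        using assms(3)[OF elim] r_pos Q_pos by (intro epowr_mono) auto
      then show ?case using r_pos Q_pos assms(2) by (simp add: epowr_mult epowr_ennreal)
    qed
  qed
  also have "\<dots> = ennreal (c powr (r / Q)) * rint h"
    by (rule nn_integral_cmult) measurable
  finally have "rint g epowr (1 / r) \<le> (ennreal (c powr (r / Q)) * rint h) epowr (1 / r)"
    using r_pos by (intro epowr_mono) auto
  then show ?thesis using r_pos by (simp add: epowr_mult epowr_ennreal powr_powr)
qed

lemma Fq_mono: "x \<le> y \<Longrightarrow> Fq f x \<le> Fq f y"
  using prim_mono[of f] Q_pos by (auto intro!: epowr_mono dest: monoD)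

text \<open>The primitive is increasing, so its value at the left end of the interval may be moved
  inside \<open>N\<close>.\<close>

lemma B0_integrand_le:
  assumes "0 < x" shows "B0_integrand f x \<le> ennreal 1 * kernel_mean (Fq f) x"
proof -
  let ?z = "(zeta_inv u ^^ 3) x"
  have z: "0 \<le> ?z" by (rule zeta_inv_pow_nonneg) (use assms in simp)
  have "B0_integrand f x = N (\<lambda>y. Fq f ?z * (indicator {?z<..<x} y * K x y))"
    unfolding B0_integrand_def by (subst N_cmult) (auto simp: mult.commute)
  also have "\<dots> \<le> kernel_mean (Fq f) x"
    unfolding kernel_mean_def
  proof (rule N_mono)
    fix y :: real
    show "Fq f ?z * (indicator {?z<..<x} y * K x y) \<le> indicator {0<..<x} y * (K x y * Fq f y)"
    proof (cases "y \<in> {?z<..<x}")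
      case True
      then have "K x y * Fq f ?z \<le> K x y * Fq f y" by (intro mult_left_mono Fq_mono) auto
      then show ?thesis using True z by (auto simp: mult.commute simp del: funpow.simps)
    qed simp
  qed
  finally show ?thesis by simp
qed

text \<open>By \<open>K_left\<close>, \<open>K x z\<close> is at most \<open>D\<close> times
  \<open>K x y\<close> for all \<open>y\<close> to the left of \<open>z\<close>.\<close>

lemma B1_integrand_le:
  assumes "0 < x" shows "B1_integrand f x \<le> ennreal D * kernel_mean (Fq f) x"
proof -
  let ?z = "(zeta_inv u ^^ 2) x"
  have z: "0 \<le> ?z" "?z \<le> x"
    using assms zeta_inv_pow_nonneg[of x 2] zeta_inv_pow_antimono[of x 0 2] by (simp_all del: funpow.simps add: funpow_0)
  have "B1_integrand f x = N (\<lambda>y. K x ?z * (indicator {0<..<?z} y * Fq f y))"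
    unfolding B1_integrand_def by (subst N_cmult) auto
  also have "\<dots> \<le> N (\<lambda>y. ennreal D * (indicator {0<..<x} y * (K x y * Fq f y)))"
  proof (rule N_mono)
    fix y :: real
    show "K x ?z * (indicator {0<..<?z} y * Fq f y) \<le> ennreal D * (indicator {0<..<x} y * (K x y * Fq f y))"
    proof (cases "y \<in> {0<..<?z}")
      case True
      then have "K x ?z * Fq f y \<le> ennreal D * K x y * Fq f y"
        using z by (intro mult_right_mono K_left) auto
      then show ?thesis using True z by (auto simp: mult.assoc simp del: funpow.simps)
    qed simp
  qed
  also have "\<dots> = ennreal D * kernel_mean (Fq f) x"
    unfolding kernel_mean_def by (rule N_cmult) measurable
  finally show ?thesis .
qed

lemma B0_le_C_S: "BB0 \<le> CS"
proof -
  have "BB0 \<le> ennreal 1 * CS"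
    unfolding B0_eq C_S_eq
    by (intro least_const_mono, simp) (use integral_norm_le[OF measurable_kernel_mean_Fq _ B0_integrand_le] in simp)
  then show ?thesis by simp
qed

lemma B1_le_C_S: "BB1 \<le> ennreal (D powr (1 / Q)) * CS"
  unfolding B1_eq C_S_eq using D1
  by (intro least_const_mono integral_norm_le B1_integrand_le) auto

lemma kernel_mean_quasi_mono:
  assumes [measurable]: "G \<in> borel_measurable borel" and "0 \<le> t" "t \<le> x"
  shows "kernel_mean G t \<le> ennreal D * kernel_mean G x"
proof -
  have "kernel_mean G t \<le> N (\<lambda>y. ennreal D * (indicator {0<..<x} y * (K x y * G y)))"
    unfolding kernel_mean_def
  proof (rule N_mono)
    fix y :: real
    show "indicator {0<..<t} y * (K t y * G y) \<le> ennreal D * (indicator {0<..<x} y * (K x y * G y))"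
    proof (cases "y \<in> {0<..<t}")
      case True
      then have "K t y * G y \<le> ennreal D * K x y * G y"
        using assms by (intro mult_right_mono K_right) auto
      then show ?thesis using True assms by (auto simp: mult.assoc)
    qed simp
  qed
  also have "\<dots> = ennreal D * kernel_mean G x"
    unfolding kernel_mean_def by (rule N_cmult) measurable
  finally show ?thesis .
qed

lemma H_cut_op_norm:
  assumes "0 \<le> t"
  shows "op_norm (H_cut t) (ennreal p) v q (\<lambda>y. w y * ennreal (k t y))
    = least_const (ennreal p) v (\<lambda>f. kernel_mean (Fq f) t epowr (1 / Q))"
  unfolding op_norm_def H_cut_norm[OF assms] ..

lemma H_block_op_norm:
  assumes "0 \<le> d"
  shows "op_norm (H_block u c d) (ennreal p) v q (\<lambda>y. w y * ennreal (k d y))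
    = least_const (ennreal p) v (\<lambda>f. block_mean c d f epowr (1 / Q))"
  unfolding op_norm_def H_block_norm[OF assms] ..

text \<open>\<open>kernel_mean\<close> is increasing up to the factor \<open>D\<close>, so its value
  at \<open>t\<close> is dominated on all of \<open>{t..}\<close>, a set of mass
  \<open>tail u t\<close>.\<close>

lemma B2_le_C_S_of_le:
  assumes "p \<le> r" shows "BB2 \<le> ennreal (D powr (1 / Q)) * CS"
proof -
  have "(tail u t epowr (1 / r)) * op_norm (H_cut t) (ennreal p) v q (\<lambda>y. w y * ennreal (k t y))
      \<le> ennreal (D powr (1 / Q)) * CS" if t: "0 < t" for t
  proof -
    obtain T where T: "tail u t = ennreal T" "0 < T"
      using tail_pos[OF t] tail_fin[OF t] by (cases "tail u t") auto
    have "kernel_mean (Fq f) t epowr (1 / Q) \<le> ennreal (D powr (1 / Q) * T powr (- 1 / r)) * S_norm f" for f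
    proof -
      have "(kernel_mean (Fq f) t epowr (r / Q)) * ennreal T
          = (\<integral>\<^sup>+x. (kernel_mean (Fq f) t epowr (r / Q)) * indicator {t..} x \<partial>\<mu>)"
        using t T u_meas by (simp add: nn_integral_cmult_indicator emeasure_half_line_atLeast)
      also have "\<dots> \<le> (\<integral>\<^sup>+x. ennreal (D powr (r / Q)) * (kernel_mean (Fq f) x epowr (r / Q)) \<partial>\<mu>)"
      proof (intro nn_integral_mono)
        fix x
        show "(kernel_mean (Fq f) t epowr (r / Q)) * indicator {t..} x
            \<le> ennreal (D powr (r / Q)) * (kernel_mean (Fq f) x epowr (r / Q))"
        proof (cases "t \<le> x")
          case True
          have "kernel_mean (Fq f) t epowr (r / Q) \<le> (ennreal D * kernel_mean (Fq f) x) epowr (r / Q)"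
            using t True r_pos Q_pos by (intro epowr_mono kernel_mean_quasi_mono) auto
          then show ?thesis using True D1 r_pos Q_pos by (simp add: epowr_mult epowr_ennreal)
        qed simp
      qed
      also have "\<dots> = ennreal (D powr (r / Q)) * rint (kernel_mean (Fq f))"
        by (rule nn_integral_cmult) measurable
      finally have "((kernel_mean (Fq f) t epowr (r / Q)) * ennreal T) epowr (1 / r)
          \<le> (ennreal (D powr (r / Q)) * rint (kernel_mean (Fq f))) epowr (1 / r)"
        using r_pos by (intro epowr_mono) auto
      then have le: "(kernel_mean (Fq f) t epowr (1 / Q)) * ennreal (T powr (1 / r)) \<le> ennreal (D powr (1 / Q)) * S_norm f"
        using r_pos Q_pos T by (simp add: epowr_mult epowr_ennreal epowr_epowr powr_powr S_norm_def)
      have inv: "ennreal (T powr (1 / r)) * ennreal (T powr (- 1 / r)) = 1"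
        using T by (simp add: powr_add[symmetric] flip: ennreal_mult)
      have "kernel_mean (Fq f) t epowr (1 / Q)
          = (kernel_mean (Fq f) t epowr (1 / Q)) * (ennreal (T powr (1 / r)) * ennreal (T powr (- 1 / r)))"
        unfolding inv by simp
      also have "\<dots> \<le> ennreal (D powr (1 / Q)) * S_norm f * ennreal (T powr (- 1 / r))"
        unfolding mult.assoc[symmetric] by (intro mult_right_mono le) simp
      finally show ?thesis by (simp add: ennreal_mult ac_simps)
    qed
    then have "least_const (ennreal p) v (\<lambda>f. kernel_mean (Fq f) t epowr (1 / Q))
        \<le> ennreal (D powr (1 / Q) * T powr (- 1 / r)) * CS"
      unfolding C_S_eq' using D1 T by (intro least_const_mono) auto
    then have "(tail u t epowr (1 / r)) * op_norm (H_cut t) (ennreal p) v q (\<lambda>y. w y * ennreal (k t y))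
        \<le> ennreal (T powr (1 / r)) * (ennreal (D powr (1 / Q) * T powr (- 1 / r)) * CS)"
      using t T by (simp add: H_cut_op_norm epowr_ennreal mult_left_mono)
    also have "\<dots> = ennreal (T powr (1 / r) * (D powr (1 / Q) * T powr (- 1 / r))) * CS"
      by (simp add: ennreal_mult mult.assoc)
    also have "T powr (1 / r) * (D powr (1 / Q) * T powr (- 1 / r)) = D powr (1 / Q)"
    proof -
      have "T powr (1 / r) * T powr (- 1 / r) = 1" using T by (simp add: powr_add[symmetric])
      then show ?thesis by (simp add: mult.left_commute)
    qed
    finally show ?thesis .
  qed
  then show ?thesis using assms by (auto simp: B2_def intro!: SUP_least)
qed

end

context half_line_weight
begin

text \<open>The end point \<open>(zeta u ^^ 2) x\<close> has a quarter of the tail of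
  \<open>x\<close>, so points with tail below \<open>lev k / 4\<close> lie to its right. Removing
  those with tail at most \<open>lev (k - 1) / 4\<close> costs at most three quarters of the mass,
  by the ratio bound \<open>4 / 3\<close>, and makes the sets for different \<open>k\<close>
  disjoint.\<close>

lemma quarter_level_set_mass:
  assumes "x \<in> level_set k"
  shows "ennreal (lev k / 16) \<le> emeasure \<mu> {y. 0 < y \<and> ennreal (lev (k - 1) / 4) < tail u y \<and> tail u y < ennreal (lev k / 4)}"
    (is "_ \<le> emeasure \<mu> ?I")
proof -
  have x: "0 < x" "ennreal (lev k) \<le> tail u x" using assms by (auto simp: level_set_def)
  have "ennreal (lev k / 4) < ennreal (lev k)" by (simp add: ennreal_less_iff)
  also have "\<dots> \<le> tail u 0" using x tail_le_tail_0[of x] by simp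
  finally have "ennreal (lev k / 4) = emeasure \<mu> {y. 0 < y \<and> tail u y < ennreal (lev k / 4)}"
    by (subst emeasure_sublevel) auto
  also have "\<dots> \<le> emeasure \<mu> (?I \<union> {y. 0 < y \<and> tail u y \<le> ennreal (lev (k - 1) / 4)})"
    by (intro emeasure_mono) auto
  also have "\<dots> \<le> emeasure \<mu> ?I + emeasure \<mu> {y. 0 < y \<and> tail u y \<le> ennreal (lev (k - 1) / 4)}"
    by (intro emeasure_subadditive) auto
  also have "\<dots> \<le> emeasure \<mu> ?I + ennreal (lev (k - 1) / 4)"
    by (intro add_left_mono emeasure_sublevel_le)
  also have "\<dots> \<le> emeasure \<mu> ?I + ennreal (3 * lev k / 16)"
    using lev_Suc(2)[of "k - 1"] by (intro add_left_mono ennreal_leI) auto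
  finally have "ennreal (lev k / 4) \<le> ennreal (3 * lev k / 16) + emeasure \<mu> ?I"
    by (simp add: add.commute)
  moreover have "ennreal (lev k / 4) = ennreal (3 * lev k / 16) + ennreal (lev k / 16)"
    by (subst ennreal_plus[symmetric]) auto
  ultimately have "ennreal (3 * lev k / 16) + ennreal (lev k / 16) \<le> ennreal (3 * lev k / 16) + emeasure \<mu> ?I"
    by simp
  then show ?thesis unfolding ennreal_add_left_cancel_le by simp
qed

end

context problem
begin

lemma block_mean_le:
  assumes "0 \<le> c" "0 \<le> d" "d \<le> x"
  shows "block_mean c d f \<le> ennreal D * kernel_mean (Fq f) x"
proof -
  have "block_mean c d f \<le> kernel_mean (Fq f) d"
    unfolding block_mean_def kernel_mean_def
  proof (rule N_mono)
    fix y :: real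
    have "prim_from (zeta_inv u c) f y \<le> prim f y"
      using prim_from_antimono[OF zeta_inv_nonneg[of c], of f y] by simp
    then show "indicator {c<..<d} y * (K d y * (prim_from (zeta_inv u c) f y epowr Q))
        \<le> indicator {0<..<d} y * (K d y * Fq f y)"
      using assms Q_pos by (auto simp: indicator_def intro!: mult_left_mono epowr_mono)
  qed
  also have "\<dots> \<le> ennreal D * kernel_mean (Fq f) x"
    using assms by (intro kernel_mean_quasi_mono) auto
  finally show ?thesis .
qed

abbreviation "block x \<equiv> block_mean (zeta_inv u x) ((zeta u ^^ 2) x)"

text \<open>
  The test function for the lower bound is \<open>SUP k. a k * f k\<close>: its \<open>L\<^sup>p\<close> norm is controlled without
  any disjointness of supports, and \<open>S\<close> of it is bounded below on the disjoint sets where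
  \<open>tail u\<close> lies between \<open>lev (k - 1) / 4\<close> and \<open>lev k / 4\<close>, which lie to the right of the block.
\<close>

lemma block_test:
  assumes "finite F" and C: "CS < ennreal C" and "0 \<le> C"
    and x: "\<And>j. j \<in> F \<Longrightarrow> x j \<in> level_set j"
    and f: "\<And>j. j \<in> F \<Longrightarrow> f j \<in> Mplus" "\<And>j. j \<in> F \<Longrightarrow> pnorm (f j) \<le> 1"
    and b: "\<And>j. j \<in> F \<Longrightarrow> 0 \<le> b j" "\<And>j. j \<in> F \<Longrightarrow> ennreal (b j) \<le> block (x j) (f j) epowr (1 / Q)"
    and a: "\<And>j. 0 \<le> a j" "(\<Sum>j\<in>F. a j powr p) \<le> 1"
  shows "(\<Sum>j\<in>F. (lev j * b j powr r) * a j powr r) \<le> 16 * D powr (r / Q) * C powr r"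
proof -
  define g where "g x = (SUP j\<in>F. ennreal (a j) * f j x)" for x
  have g: "g \<in> Mplus"
    using f(1) \<open>finite F\<close> unfolding Mplus_def g_def[abs_def] by (intro borel_measurable_SUP) (auto intro: countable_finite)
  have g_ge: "ennreal (a j) * f j y \<le> g y" if "j \<in> F" for j y
    unfolding g_def using that by (rule SUP_upper)
  have v[measurable]: "v \<in> borel_measurable (lebesgue_on {0..})" using v_meas by (simp add: Mplus_def)
  have fp: "(\<integral>\<^sup>+y\<in>{0..}. (f j y epowr p) * v y \<partial>lebesgue) \<le> 1" if "j \<in> F" for j
    using f(2)[OF that] p_pos by (simp add: wnorm_finite_exponent epowr_le_iff')
  have "(\<integral>\<^sup>+y\<in>{0..}. (g y epowr p) * v y \<partial>lebesgue)
      \<le> (\<integral>\<^sup>+y\<in>{0..}. (\<Sum>j\<in>F. ennreal (a j powr p) * ((f j y epowr p) * v y)) \<partial>lebesgue)"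
  proof (intro nn_integral_mono mult_right_mono)
    fix y
    \<comment> \<open>The power of a supremum is at most the sum of the powers with constant 1,
      however much the functions overlap.\<close>
    have "g y epowr p \<le> (SUP j\<in>F. (ennreal (a j) * f j y) epowr p)"
      unfolding g_def by (rule epowr_SUP_le[OF p_pos])
    also have "\<dots> \<le> (\<Sum>j\<in>F. ennreal (a j powr p) * (f j y epowr p))"
      using \<open>finite F\<close> a(1) p_pos by (intro SUP_least) (auto simp: epowr_mult epowr_ennreal intro: member_le_sum)
    finally have "(g y epowr p) * v y \<le> (\<Sum>j\<in>F. ennreal (a j powr p) * (f j y epowr p)) * v y"
      by (rule mult_right_mono) simp
    then show "(g y epowr p) * v y \<le> (\<Sum>j\<in>F. ennreal (a j powr p) * ((f j y epowr p) * v y))"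
      by (simp add: sum_distrib_right mult.assoc)
  qed simp
  also have "\<dots> = (\<Sum>j\<in>F. ennreal (a j powr p) * (\<integral>\<^sup>+y\<in>{0..}. (f j y epowr p) * v y \<partial>lebesgue))"
  proof -
    have [measurable]: "f j \<in> borel_measurable (lebesgue_on {0..})" if "j \<in> F" for j
      using f(1)[OF that] by (simp add: Mplus_def)
    show ?thesis
      unfolding nn_integral_Mplus_eq by (subst nn_integral_sum) (auto intro!: sum.cong nn_integral_cmult)
  qed
  also have "\<dots> \<le> (\<Sum>j\<in>F. ennreal (a j powr p) * 1)"
    by (intro sum_mono mult_left_mono fp) auto
  also have "\<dots> \<le> 1"
    using a(2) by (simp add: sum_ennreal)
  finally have "pnorm g \<le> 1"
    using p_pos by (simp add: wnorm_finite_exponent epowr_le_iff')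
  moreover have "S_norm g \<le> ennreal C * pnorm g"
    using C g unfolding C_S_eq' by (rule least_const_le_imp)
  ultimately have "S_norm g \<le> ennreal C * 1"
    by (meson mult_left_mono order_trans zero_le)
  then have "rint (kernel_mean (Fq g)) \<le> ennreal C epowr r"
    using r_pos by (simp add: S_norm_def epowr_le_iff')
  then have S_le: "rint (kernel_mean (Fq g)) \<le> ennreal (C powr r)"
    using \<open>0 \<le> C\<close> by (simp add: epowr_ennreal)
  define I where "I j = {y. 0 < y \<and> ennreal (lev (j - 1) / 4) < tail u y \<and> tail u y < ennreal (lev j / 4)}" for j
  have [measurable]: "I j \<in> sets borel" for j unfolding I_def by measurable
  have disj: "i = j" if "y \<in> I i" "y \<in> I j" for i j y
  proof (rule ccontr)
    have *: False if "i < j" "y \<in> I i" "y \<in> I j" for i j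
    proof -
      have "ennreal (lev (j - 1) / 4) < ennreal (lev i / 4)"
        using that by (auto simp: I_def intro: less_trans)
      moreover have "lev i \<le> lev (j - 1)" using that by (intro lev_mono) simp
      ultimately show False by (simp add: ennreal_less_iff)
    qed
    assume "i \<noteq> j" then show False using *[of i j] *[of j i] that by (cases i j rule: linorder_cases) auto
  qed
  have point: "ennreal ((a j * b j) powr r) \<le> ennreal (D powr (r / Q)) * (kernel_mean (Fq g) y epowr (r / Q))"
    if j: "j \<in> F" and y: "y \<in> I j" for j y
  proof -
    have xj: "0 < x j" "ennreal (lev j) \<le> tail u (x j)" using x[OF j] by (auto simp: level_set_def)
    let ?d = "(zeta u ^^ 2) (x j)"
    have y0: "0 < y" "tail u y < ennreal (lev j / 4)" using y by (auto simp: I_def)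
    \<comment> \<open>Otherwise \<open>tail u ?d\<close> would be below \<open>lev j / 4\<close>,
      although it equals a quarter of \<open>tail u (x j)\<close>.\<close>
    have "?d \<le> y"
    proof (rule ccontr)
      assume "\<not> ?d \<le> y"
      then have "4 * tail u ?d \<le> 4 * tail u y" by (intro mult_left_mono tail_antimono) auto
      also have "\<dots> < ennreal (lev j)"
      proof -
        have "4 * tail u y < 4 * ennreal (lev j / 4)"
          using y0 by (intro ennreal_mult_strict_left_mono) auto
        also have "\<dots> = ennreal (lev j)" by (simp add: ennreal_mult'[symmetric] flip: ennreal_numeral)
        finally show ?thesis .
      qed
      finally show False using xj zeta2_props(2)[OF xj(1)] by simp
    qed
    have "ennreal ((a j * b j) powr Q) = (ennreal (a j) epowr Q) * (ennreal (b j) epowr Q)"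
      using a(1)[of j] b(1)[OF j] by (simp add: epowr_ennreal powr_mult ennreal_mult)
    also have "\<dots> \<le> (ennreal (a j) epowr Q) * ((block (x j) (f j) epowr (1 / Q)) epowr Q)"
      using b(2)[OF j] Q_pos by (intro mult_left_mono epowr_mono) auto
    also have "\<dots> = (ennreal (a j) epowr Q) * block (x j) (f j)" using Q_pos by simp
    also have "\<dots> \<le> (ennreal (a j) epowr Q) * (ennreal D * kernel_mean (Fq (f j)) y)"
      using zeta2_props(1)[OF xj(1)] \<open>?d \<le> y\<close> zeta_inv_nonneg[of "x j"]
      by (intro mult_left_mono block_mean_le) auto
    also have "\<dots> = ennreal D * kernel_mean (Fq (\<lambda>y. ennreal (a j) * f j y)) y"
      using f(1)[OF j] a(1)[of j] by (simp add: Fq_cmult kernel_mean_cmult ac_simps)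
    also have "\<dots> \<le> ennreal D * kernel_mean (Fq g) y"
      using g_ge[OF j] Q_pos prim_from_mono_fun[of "\<lambda>y. ennreal (a j) * f j y" g 0]
      by (intro mult_left_mono kernel_mean_mono epowr_mono) auto
    finally have "ennreal ((a j * b j) powr Q) epowr (r / Q) \<le> (ennreal D * kernel_mean (Fq g) y) epowr (r / Q)"
      using r_pos Q_pos by (intro epowr_mono) auto
    then show ?thesis
      using r_pos Q_pos a(1)[of j] b(1)[OF j] D1 by (simp add: epowr_ennreal epowr_mult powr_powr)
  qed
  have "(\<Sum>j\<in>F. ennreal ((a j * b j) powr r) * ennreal (lev j / 16)) \<le> (\<Sum>j\<in>F. ennreal ((a j * b j) powr r) * emeasure \<mu> (I j))"
    unfolding I_def using x by (intro sum_mono mult_left_mono quarter_level_set_mass) auto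
  also have "\<dots> = (\<integral>\<^sup>+y. (\<Sum>j\<in>F. ennreal ((a j * b j) powr r) * indicator (I j) y) \<partial>\<mu>)"
    by (subst nn_integral_sum) (auto simp: nn_integral_cmult_indicator)
  also have "\<dots> \<le> (\<integral>\<^sup>+y. ennreal (D powr (r / Q)) * (kernel_mean (Fq g) y epowr (r / Q)) \<partial>\<mu>)"
  proof (rule nn_integral_mono)
    fix y
    show "(\<Sum>j\<in>F. ennreal ((a j * b j) powr r) * indicator (I j) y) \<le> ennreal (D powr (r / Q)) * (kernel_mean (Fq g) y epowr (r / Q))"
    proof (cases "\<exists>i\<in>F. y \<in> I i")
      case True
      then obtain i where i: "i \<in> F" "y \<in> I i" by blast
      have "(\<Sum>j\<in>F. ennreal ((a j * b j) powr r) * indicator (I j) y) = (\<Sum>j\<in>{i}. ennreal ((a j * b j) powr r) * indicator (I j) y)"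
        using \<open>finite F\<close> i disj by (intro sum.mono_neutral_right) (auto simp: indicator_def)
      then show ?thesis using point[OF i] i by simp
    next
      case False
      then have "(\<Sum>j\<in>F. ennreal ((a j * b j) powr r) * indicator (I j) y) = 0" by (intro sum.neutral) auto
      then show ?thesis by simp
    qed
  qed
  also have "\<dots> = ennreal (D powr (r / Q)) * (\<integral>\<^sup>+y. kernel_mean (Fq g) y epowr (r / Q) \<partial>\<mu>)"
    by (rule nn_integral_cmult) measurable
  also have "\<dots> \<le> ennreal (D powr (r / Q)) * ennreal (C powr r)"
    by (intro mult_left_mono S_le) simp
  also have "\<dots> = ennreal (D powr (r / Q) * C powr r)" by (simp add: ennreal_mult)
  also have "(\<Sum>j\<in>F. ennreal ((a j * b j) powr r) * ennreal (lev j / 16)) = ennreal (\<Sum>j\<in>F. (a j * b j) powr r * (lev j / 16))"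
    by (simp add: sum_ennreal less_imp_le flip: ennreal_mult)
  finally have "(\<Sum>j\<in>F. (a j * b j) powr r * (lev j / 16)) \<le> D powr (r / Q) * C powr r"
    by simp
  \<comment> \<open>The factor 16 compensates the mass bound \<open>lev j / 16\<close>.\<close>
  moreover have "(\<Sum>j\<in>F. (lev j * b j powr r) * a j powr r) = 16 * (\<Sum>j\<in>F. (a j * b j) powr r * (lev j / 16))"
    unfolding sum_distrib_left using a(1) b(1) by (intro sum.cong) (auto simp: powr_mult)
  ultimately show ?thesis by simp
qed

abbreviation "block_norm x \<equiv> least_const (ennreal p) v (\<lambda>f. block x f epowr (1 / Q))"

text \<open>Without such an \<open>f\<close>, \<open>least_const_unit_ball\<close> would give
  \<open>block_norm x \<le> b\<close>. That lemma requires a positive constant, so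
  \<open>b = 0\<close> is served by the zero function.\<close>

lemma block_norm_witness:
  assumes "ennreal b < block_norm x" "0 \<le> b"
  shows "\<exists>f\<in>Mplus. pnorm f \<le> 1 \<and> ennreal b \<le> block x f epowr (1 / Q)"
proof (cases "b = 0")
  case True
  have "(\<lambda>x. 0) \<in> Mplus" "pnorm (\<lambda>x. 0) = 0" using p_pos by (auto simp: Mplus_def wnorm_finite_exponent)
  then show ?thesis using True by (intro bexI[of _ "\<lambda>x. 0"]) auto
next
  case False
  show ?thesis
  proof (rule ccontr)
    assume "\<not> ?thesis"
    then have "block_norm x \<le> ennreal b"
      using False assms(2) by (intro least_const_unit_ball homogeneous_block p_pos v_meas) auto
    with assms show False by simp
  qed
qed

lemma B2_eq_of_less:
  assumes "r < p" and s: "s = 1 / (1 / r - 1 / p)"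
  shows "BB2 = (\<integral>\<^sup>+x\<in>{0..}. u x * (tail u x epowr (s / p)) * (block_norm x epowr s) \<partial>lebesgue) epowr (1 / s)"
proof -
  have "0 < 1 / r - 1 / p" using assms r_pos by (simp add: field_simps)
  then have m: "1 / max (1 / r - 1 / p) 0 = s" using s by simp
  have "AE x in lebesgue. x \<noteq> (0::real)" using AE_lborel_singleton AE_completion_iff by blast
  then have "(\<integral>\<^sup>+x\<in>{0..}. u x * (tail u x epowr (s / p)) * (op_norm (H_block u (zeta_inv u x) ((zeta u ^^ 2) x)) (ennreal p) v q
        (\<lambda>y. w y * ennreal (k ((zeta u ^^ 2) x) y)) epowr s) \<partial>lebesgue)
      = (\<integral>\<^sup>+x\<in>{0..}. u x * (tail u x epowr (s / p)) * (block_norm x epowr s) \<partial>lebesgue)"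
  proof (intro nn_integral_cong_AE, eventually_elim)
    case (elim x)
    show ?case
    proof (cases "0 < x")
      case True
      have "0 \<le> (zeta u ^^ 2) x" using zeta2_props(1)[OF True] by simp
      from H_block_op_norm[OF this] show ?thesis by simp
    qed (use elim in auto)
  qed
  then show ?thesis using assms m by (simp add: B2_def Let_def)
qed

text \<open>On each level the block norm is replaced by its supremum \<open>B j\<close>, which is
  realised up to a factor 2 by one point and one function. \<open>block_test\<close> bounds all
  pairings of the resulting sequence with the unit ball of \<open>l^p\<close>, and
  \<open>power_duality\<close> turns this into the bound on its \<open>s / r\<close> power
  sum.\<close>

lemma B2_le_C_S_of_less:
  assumes "r < p"
  shows "BB2 \<le> ennreal (2 * (24 * D powr (r / Q)) powr (1 / r)) * CS"
proof -
  define s where "s = 1 / (1 / r - 1 / p)"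
  define M where "M C = 16 * D powr (r / Q) * C powr r" for C
  note s_pos = dual_exponent(1)[OF r_pos assms s_def] and sr = dual_exponent(2)[OF r_pos assms s_def]
  have main: "BB2 \<le> ennreal (2 * (24 * D powr (r / Q)) powr (1 / r) * C)"
    if C: "CS < ennreal C" "0 \<le> C" for C
  proof -
    have M0: "0 \<le> M C" by (simp add: M_def)
    define B where "B j = (SUP x\<in>level_set j. block_norm x)" for j
    \<comment> \<open>The test with a single level and coefficient 1 shows that \<open>B j\<close>
      is finite; without this, half of \<open>B j\<close> would not be strictly smaller than a
      positive \<open>B j\<close>.\<close>
    have single: "block_norm x \<le> ennreal ((M C / lev j) powr (1 / r))" if x: "x \<in> level_set j" for x j
    proof (rule dense_le)
      fix z assume z: "z < block_norm x"
      then obtain b where b: "z = ennreal b" "0 \<le> b" by (cases z) auto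
      from block_norm_witness[of b x] z b obtain f where f: "f \<in> Mplus" "pnorm f \<le> 1" "ennreal b \<le> block x f epowr (1 / Q)" by auto
      have "(\<Sum>j\<in>{j}. (lev j * b powr r) * 1 powr r) \<le> M C"
        unfolding M_def by (rule block_test[where x = "\<lambda>_. x" and f = "\<lambda>_. f"]) (use C x f b in auto)
      then have "b powr r \<le> M C / lev j" by (simp add: field_simps)
      then have "(b powr r) powr (1 / r) \<le> (M C / lev j) powr (1 / r)" using r_pos by (intro powr_mono2) auto
      then show "z \<le> ennreal ((M C / lev j) powr (1 / r))" using b r_pos by (simp add: powr_powr ennreal_leI)
    qed
    have B_fin: "B j < top" for j
    proof -
      have "B j \<le> ennreal ((M C / lev j) powr (1 / r))" unfolding B_def by (intro SUP_least single)
      then show ?thesis by (rule le_less_trans) simp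
    qed
    define b where "b j = enn2real (B j) / 2" for j
    have b0: "0 \<le> b j" and Bb: "B j = ennreal (2 * b j)" for j using B_fin by (auto simp: b_def)
    have "\<exists>x f. x \<in> level_set j \<and> f \<in> Mplus \<and> pnorm f \<le> 1 \<and> ennreal (b j) \<le> block x f epowr (1 / Q)" if "0 < b j" for j
    proof -
      have "ennreal (b j) < B j" unfolding Bb using that by (simp add: ennreal_less_iff)
      then obtain x where "x \<in> level_set j" "ennreal (b j) < block_norm x" unfolding B_def less_SUP_iff by auto
      then show ?thesis using block_norm_witness b0 by blast
    qed
    then obtain X f where Xf: "\<And>j. 0 < b j \<Longrightarrow> X j \<in> level_set j \<and> f j \<in> Mplus \<and> pnorm (f j) \<le> 1
        \<and> ennreal (b j) \<le> block (X j) (f j) epowr (1 / Q)" by metis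
    have sum_le: "(\<Sum>j\<in>F. (lev j * b j powr r) powr (s / r)) \<le> M C powr (s / r)" if "finite F" for F
    proof -
      \<comment> \<open>Points and functions were chosen only where \<open>b j\<close> is positive;
        empty levels have \<open>B j = 0\<close> and drop out here.\<close>
      let ?F = "{j\<in>F. 0 < b j}"
      have "(\<Sum>j\<in>F. (lev j * b j powr r) powr (s / r)) = (\<Sum>j\<in>?F. (lev j * b j powr r) powr (s / r))"
        using that b0 by (intro sum.mono_neutral_right) (auto simp: not_less intro: antisym)
      also have "\<dots> \<le> M C powr (s / r)"
      proof (rule power_duality[OF _ r_pos assms s_def])
        show "(\<Sum>j\<in>?F. lev j * b j powr r * a j powr r) \<le> M C"
          if "\<And>j. 0 \<le> a j" "(\<Sum>j\<in>?F. a j powr p) \<le> 1" for a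
          unfolding M_def
          by (rule block_test[where x = X and f = f]) (use that \<open>finite F\<close> C Xf b0 in auto)
      qed (use that in \<open>auto intro: less_imp_le\<close>)
      finally show ?thesis .
    qed
    let ?G = "\<lambda>j. ennreal (lev (j + 1) powr (s / p)) * (B j epowr s)"
    \<comment> \<open>The Borel step function dominates the integrand pointwise, so no measurability
      of \<open>block_norm\<close> in \<open>x\<close> is called for.\<close>
    have "(\<integral>\<^sup>+x\<in>{0..}. u x * (tail u x epowr (s / p)) * (block_norm x epowr s) \<partial>lebesgue)
        \<le> (\<integral>\<^sup>+x\<in>{0..}. u x * level_step ?G x \<partial>lebesgue)"
    proof -
      have "AE x in lebesgue. x \<noteq> (0::real)" using AE_lborel_singleton AE_completion_iff by blast
      then show ?thesis
      proof (intro nn_integral_mono_AE, eventually_elim)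
        case (elim x)
        show ?case
        proof (cases "0 < x")
          case True
          then obtain j where j: "x \<in> level_set j" using ex_level_set by blast
          have "tail u x epowr (s / p) \<le> ennreal (lev (j + 1)) epowr (s / p)"
            using j s_pos p_pos by (intro epowr_mono) (auto simp: level_set_def)
          moreover have "block_norm x epowr s \<le> B j epowr s"
            using j s_pos unfolding B_def by (intro epowr_mono SUP_upper)
          ultimately have "(tail u x epowr (s / p)) * (block_norm x epowr s) \<le> ?G j"
            by (simp add: epowr_ennreal less_imp_le mult_mono)
          also have "\<dots> \<le> level_step ?G x" using j by (rule level_step_ge)
          finally show ?thesis by (auto simp: mult.assoc indicator_def intro!: mult_left_mono)
        qed (use elim in auto)
      qed
    qed
    also have "\<dots> = (\<integral>\<^sup>+x. level_step ?G x \<partial>\<mu>)"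
      by (rule nn_integral_half_line_measure[OF u_meas, symmetric]) measurable
    also have "\<dots> \<le> (ISUM j. ?G j * ennreal (3 / 2 * lev j))"
      by (rule level_step_bound)
    also have "\<dots> \<le> (ISUM j. ennreal ((3 / 2) powr (s / r) * 2 powr s) * ennreal ((lev j * b j powr r) powr (s / r)))"
    proof (rule nn_integral_mono)
      fix j
      have "?G j * ennreal (3 / 2 * lev j) = ennreal (lev (j + 1) powr (s / p) * (2 * b j) powr s * (3 / 2 * lev j))"
        using b0[of j] unfolding Bb by (subst epowr_ennreal) (simp_all add: ennreal_mult[symmetric] del: ennreal_mult_le_mult_iff)
      also have "\<dots> \<le> ennreal ((3 / 2 * lev j) powr (s / p) * (2 * b j) powr s * (3 / 2 * lev j))"
        using lev_Suc(1)[of j] s_pos p_pos b0[of j]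
        by (intro ennreal_leI mult_right_mono powr_mono2) (auto intro: less_imp_le)
      also have "(3 / 2 * lev j) powr (s / p) * (2 * b j) powr s * (3 / 2 * lev j)
          = (3 / 2) powr (s / r) * 2 powr s * ((lev j * b j powr r) powr (s / r))"
      proof -
        have "(3 / 2 * lev j) * (3 / 2 * lev j) powr (s / p) = (3 / 2 * lev j) powr (s / r)"
          unfolding sr powr_add by (subst powr_one) auto
        moreover have "(lev j * b j powr r) powr (s / r) = lev j powr (s / r) * b j powr s"
          using b0[of j] r_pos by (simp add: powr_mult powr_powr less_imp_le)
        moreover have "(3 / 2 * lev j) powr (s / r) = (3 / 2) powr (s / r) * lev j powr (s / r)"
          by (rule powr_mult)
        moreover have "(2 * b j) powr s = 2 powr s * b j powr s" using b0[of j] by (simp add: powr_mult)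
        ultimately show ?thesis by (simp add: ac_simps)
      qed
      finally show "?G j * ennreal (3 / 2 * lev j) \<le> ennreal ((3 / 2) powr (s / r) * 2 powr s) * ennreal ((lev j * b j powr r) powr (s / r))"
        by (simp add: ennreal_mult)
    qed
    also have "\<dots> = ennreal ((3 / 2) powr (s / r) * 2 powr s) * (ISUM j. ennreal ((lev j * b j powr r) powr (s / r)))"
      by (rule nn_integral_cmult) simp
    also have "\<dots> \<le> ennreal ((3 / 2) powr (s / r) * 2 powr s) * ennreal (M C powr (s / r))"
    proof (intro mult_left_mono nn_integral_count_space_int_le)
      fix F :: "int set" assume "finite F"
      then show "(\<Sum>j\<in>F. ennreal ((lev j * b j powr r) powr (s / r))) \<le> ennreal (M C powr (s / r))"
        using sum_le by (subst sum_ennreal) (auto intro: ennreal_leI)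
    qed simp
    finally have "BB2 \<le> ennreal ((3 / 2) powr (s / r) * 2 powr s * M C powr (s / r)) epowr (1 / s)"
      using s_pos unfolding B2_eq_of_less[OF assms s_def] by (intro epowr_mono) (auto simp: ennreal_mult)
    also have "\<dots> = ennreal (((3 / 2) powr (s / r) * 2 powr s * M C powr (s / r)) powr (1 / s))"
      by (simp add: epowr_ennreal)
    also have "((3 / 2) powr (s / r) * 2 powr s * M C powr (s / r)) powr (1 / s) = (3 / 2) powr (1 / r) * 2 * M C powr (1 / r)"
      using s_pos M0 by (simp add: powr_mult powr_powr)
    \<comment> \<open>Here 24 is 16 from the test times \<open>3 / 2\<close> from the mass of a
      level, and 2 comes from halving the suprema.\<close>
    also have "\<dots> = 2 * (24 * D powr (r / Q)) powr (1 / r) * C"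
    proof -
      have "M C powr (1 / r) = (16 * D powr (r / Q)) powr (1 / r) * C"
        using C(2) r_pos by (simp add: M_def powr_mult powr_powr)
      moreover have "(3 / 2) powr (1 / r) * (16 * D powr (r / Q)) powr (1 / r) = (24 * D powr (r / Q)) powr (1 / r)"
        by (subst powr_mult[symmetric]) auto
      ultimately show ?thesis by (simp add: ac_simps)
    qed
    finally show ?thesis .
  qed
  show ?thesis
  proof (cases "CS")
    case (real c)
    let ?A = "2 * (24 * D powr (r / Q)) powr (1 / r)"
    have A: "0 < ?A" using D1 by (simp add: zero_less_mult_iff)
    show ?thesis
    proof (rule ennreal_le_epsilon)
      fix e :: real assume e: "0 < e"
      have "BB2 \<le> ennreal (?A * (c + e / ?A))"
        using real e A by (intro main) (auto intro!: ennreal_lessI)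
      also have "?A * (c + e / ?A) = ?A * c + e" using A by (simp add: distrib_left)
      finally show "BB2 \<le> ennreal ?A * CS + ennreal e"
        using real e A by (simp add: ennreal_mult)
    qed
  next
    case top
    have "ennreal (2 * (24 * D powr (r / Q)) powr (1 / r)) \<noteq> 0" using D1 by (simp add: ennreal_eq_0_iff not_le)
    then show ?thesis using top by (simp add: ennreal_mult_top)
  qed
qed

end

section \<open>The local part of the operator\<close>

context half_line_weight
begin

lemma lev_add: "lev (k + 2 * j) = 2 powi j * lev k"
proof -
  have "lev (k + 2 * j) = 2 powr real_of_int j * lev k"
    by (simp add: lev_def add_divide_distrib powr_add)
  then show ?thesis by (simp add: powr_real_of_int')
qed

text \<open>Large enough to contain everything between \<open>(zeta_inv u ^^ 3) x\<close> and
  \<open>x\<close> for \<open>x\<close> in level \<open>k\<close>: three steps multiply the tail by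
  at most 8, and \<open>8 * (3 / 2) < 16\<close>.\<close>

definition wide_level :: "int \<Rightarrow> real set"
  where "wide_level k = {x. ennreal (lev k) \<le> tail u x \<and> tail u x < ennreal (16 * lev k)}"

lemma wide_level_measurable [measurable]: "wide_level k \<in> sets borel"
  unfolding wide_level_def by measurable

lemma count_le:
  assumes "\<And>j. P j \<Longrightarrow> j \<in> {c..c + 7}"
  shows "(\<integral>\<^sup>+j. (if P j then 1 else 0) \<partial>count_space (UNIV :: int set)) \<le> 8"
proof -
  have "(ISUM j. (if P j then 1 else 0)) \<le> (ISUM j. indicator {c..c + 7} j)"
    using assms by (intro nn_integral_mono) (auto simp: indicator_def)
  also have "\<dots> = 8" by (simp add: emeasure_count_space)
  finally show ?thesis .
qed

lemma wide_level_overlap: "(ISUM k. indicator (wide_level k) x) \<le> 8"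
proof (cases "tail u x")
  case (real t)
  show ?thesis
  proof (cases "0 < t")
    case True
    have "(ISUM k. indicator (wide_level k) x) = (ISUM k. (if lev k \<le> t \<and> t < 16 * lev k then 1 else 0))"
      using real by (intro nn_integral_cong) (auto simp: wide_level_def indicator_def ennreal_less_iff)
    also have "\<dots> \<le> 8"
    proof (rule count_le[where c = "\<lfloor>2 * log 2 t\<rfloor> - 7"])
      fix j assume j: "lev j \<le> t \<and> t < 16 * lev j"
      \<comment> \<open>The factor 16 is eight steps of ratio \<open>sqrt 2\<close>, hence the
        overlap bound 8.\<close>
      have "\<not> lev (j + 8) \<le> t" using j lev_add[of j 4] by simp
      then show "j \<in> {\<lfloor>2 * log 2 t\<rfloor> - 7..\<lfloor>2 * log 2 t\<rfloor> - 7 + 7}"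
        using j True by (auto simp: lev_le_iff)
    qed
    finally show ?thesis .
  next
    case False
    then have "x \<notin> wide_level k" for k using real by (auto simp: wide_level_def ennreal_neg not_less)
    then show ?thesis by simp
  qed
next
  case top
  then have "x \<notin> wide_level k" for k by (auto simp: wide_level_def)
  then show ?thesis by simp
qed

lemma level_set_subset_wide_level:
  assumes x: "x \<in> level_set j" and z: "(zeta_inv u ^^ 3) x \<le> z" "z \<le> x"
  shows "z \<in> wide_level j"
proof -
  have x0: "0 < x" "ennreal (lev j) \<le> tail u x" "tail u x < ennreal (lev (j + 1))"
    using x by (auto simp: level_set_def)
  have "tail u z \<le> tail u ((zeta_inv u ^^ 3) x)" using z by (intro tail_antimono)
  also have "\<dots> \<le> 2 ^ 3 * tail u x" using x0 by (intro tail_zeta_inv_pow_le) simp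
  also have "\<dots> \<le> 8 * ennreal (lev (j + 1))" using x0 by (simp add: mult_left_mono)
  also have "\<dots> = ennreal (8 * lev (j + 1))" by (simp add: ennreal_mult)
  also have "\<dots> < ennreal (16 * lev j)" using lev_Suc(1)[of j] lev_pos[of j] by (intro ennreal_lessI) linarith+
  finally show ?thesis
    using x0(2) tail_antimono[OF z(2), of u] by (auto simp: wide_level_def)
qed

text \<open>
  The points whose blocks dominate the local part of \<open>S f\<close> on \<open>level_set j\<close>. The second argument
  of \<open>min\<close> matters only if \<open>tail u 0\<close> is finite: then \<open>zeta_inv u\<close> vanishes where \<open>tail u\<close> exceeds
  \<open>tail u 0 / 2\<close>.
\<close>

definition block_points :: "int \<Rightarrow> real set"
  where "block_points j = {x. 0 < x \<and> min (ennreal (3 * lev j)) ((1 / 2) * tail u 0) < tail u x \<and> tail u x \<le> ennreal (4 * lev j)}"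

lemma block_points_measurable [measurable]: "block_points j \<in> sets borel"
  unfolding block_points_def by measurable

text \<open>These inclusions say that the block based at \<open>x'\<close> covers the range
  \<open>((zeta_inv u ^^ 2) x, x)\<close> of the local part and that its inner integration starts no
  later. The lower end of the window for \<open>tail u x'\<close> gives the first two, the upper end
  the third.\<close>

lemma block_points_geometry:
  assumes x: "x \<in> level_set j" and x': "x' \<in> block_points j"
  shows "zeta_inv u x' \<le> (zeta_inv u ^^ 2) x" "zeta_inv u (zeta_inv u x') \<le> (zeta_inv u ^^ 3) x" "x \<le> (zeta u ^^ 2) x'"
proof -
  have x0: "0 < x" "ennreal (lev j) \<le> tail u x" "tail u x < ennreal (lev (j + 1))"
    using x by (auto simp: level_set_def)
  have x'0: "0 < x'" "min (ennreal (3 * lev j)) ((1 / 2) * tail u 0) < tail u x'" "tail u x' \<le> ennreal (4 * lev j)"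
    using x' by (auto simp: block_points_def)
  show 1: "zeta_inv u x' \<le> (zeta_inv u ^^ 2) x"
  proof (cases "2 * tail u x \<le> tail u x'")
    case True
    then have "x' \<le> zeta_inv u x" using x'0 by (intro zeta_inv_ge)
    then have "zeta_inv u x' \<le> zeta_inv u (zeta_inv u x)" by (rule monoD[OF zeta_inv_mono])
    then show ?thesis by (simp add: numeral_2_eq_2)
  next
    case False
    then have "tail u x' < 2 * tail u x" by simp
    also have "\<dots> \<le> 2 * ennreal (lev (j + 1))" using x0 by (intro mult_left_mono) auto
    also have "\<dots> = ennreal (2 * lev (j + 1))" by (simp add: ennreal_mult)
    also have "\<dots> \<le> ennreal (3 * lev j)" using lev_Suc(1)[of j] by (intro ennreal_leI) simp
    \<comment> \<open>Below \<open>3 * lev j\<close> the minimum can only be its second argument;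
      the doubled tail then exceeds \<open>tail u 0\<close> and \<open>zeta_inv u x'\<close>
      vanishes.\<close>
    finally have "(1 / 2) * tail u 0 < tail u x'" using x'0(2) by (auto simp: min_def split: if_splits)
    then have "2 * ((1 / 2) * tail u 0) < 2 * tail u x'" by (intro ennreal_mult_strict_left_mono) auto
    then have "tail u 0 < 2 * tail u x'" unfolding half_tail .
    from zeta_inv_eq_0[OF this] show ?thesis using zeta_inv_pow_nonneg[of x 2] x0 by simp
  qed
  have "zeta_inv u (zeta_inv u x') \<le> zeta_inv u ((zeta_inv u ^^ 2) x)" by (rule monoD[OF zeta_inv_mono 1])
  then show "zeta_inv u (zeta_inv u x') \<le> (zeta_inv u ^^ 3) x" by (simp add: numeral_3_eq_3 numeral_2_eq_2)
  have "tail u x' \<le> 4 * ennreal (lev j)" using x'0(3) by (simp add: ennreal_mult)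
  also have "\<dots> \<le> 4 * tail u x" using x0 by (intro mult_left_mono) auto
  finally show "x \<le> (zeta u ^^ 2) x'" using zeta2_props(3)[OF x'0(1) x0(1)] by simp
qed

lemma half_ennreal: "0 \<le> c \<Longrightarrow> (1 / 2) * ennreal c = ennreal (c / 2)"
proof -
  assume "0 \<le> c"
  then have "2 * ennreal (c / 2) = ennreal c" by (simp add: ennreal_mult'[symmetric] flip: ennreal_numeral)
  then show ?thesis using half_tail(1)[of "ennreal (c / 2)"] by simp
qed

lemma level_le_half_tail_0:
  assumes "x \<in> level_set j" shows "ennreal (lev j / 2) \<le> (1 / 2) * tail u 0"
proof -
  have "ennreal (lev j) \<le> tail u 0"
    using assms tail_le_tail_0[of x] by (auto simp: level_set_def)
  then have "(1 / 2) * ennreal (lev j) \<le> (1 / 2) * tail u 0" by (intro mult_left_mono) auto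
  then show ?thesis by (simp add: half_ennreal)
qed

lemma block_points_tail:
  assumes "x \<in> level_set j" "x' \<in> block_points j" shows "ennreal (lev j / 2) \<le> tail u x'"
proof -
  have "ennreal (lev j / 2) \<le> ennreal (3 * lev j)" by (intro ennreal_leI) simp
  then have "ennreal (lev j / 2) \<le> min (ennreal (3 * lev j)) ((1 / 2) * tail u 0)"
    using level_le_half_tail_0[OF assms(1)] by simp
  also have "\<dots> \<le> tail u x'" using assms(2) by (simp add: block_points_def less_imp_le)
  finally show ?thesis .
qed

text \<open>The mass is that of the sublevel set of \<open>4 * lev j\<close> minus that of the lower
  cut \<open>lo\<close>. A nonempty level has \<open>lev j \<le> tail u 0\<close>, so there is room
  \<open>lev j / 2\<close> above \<open>lo\<close> in both cases of the minimum.\<close>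

lemma emeasure_block_points:
  assumes x: "x \<in> level_set j" shows "ennreal (lev j / 2) \<le> emeasure \<mu> (block_points j)"
proof -
  define lo where "lo = min (ennreal (3 * lev j)) ((1 / 2) * tail u 0)"
  have lo_fin: "lo < top" by (simp add: lo_def min_less_iff_disj)
  have "lo + ennreal (lev j / 2) \<le> min (ennreal (4 * lev j)) (tail u 0)"
  proof (rule min.boundedI)
    have "lo + ennreal (lev j / 2) \<le> ennreal (3 * lev j) + ennreal (lev j / 2)" by (simp add: lo_def)
    also have "\<dots> = ennreal (3 * lev j + lev j / 2)" by (rule ennreal_plus[symmetric]) auto
    also have "\<dots> \<le> ennreal (4 * lev j)" by (intro ennreal_leI) simp
    finally show "lo + ennreal (lev j / 2) \<le> ennreal (4 * lev j)" .
    have "lo + ennreal (lev j / 2) \<le> (1 / 2) * tail u 0 + (1 / 2) * tail u 0"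
      using level_le_half_tail_0[OF x] by (intro add_mono) (auto simp: lo_def)
    also have "\<dots> = tail u 0" unfolding mult_2[symmetric] half_tail ..
    finally show "lo + ennreal (lev j / 2) \<le> tail u 0" .
  qed
  also have "\<dots> \<le> emeasure \<mu> {y. 0 < y \<and> tail u y \<le> ennreal (4 * lev j)}" by (rule emeasure_sublevel_ge)
  also have "\<dots> \<le> emeasure \<mu> ({y. 0 < y \<and> tail u y \<le> lo} \<union> block_points j)"
    by (intro emeasure_mono) (auto simp: block_points_def lo_def[symmetric] not_le)
  also have "\<dots> \<le> emeasure \<mu> {y. 0 < y \<and> tail u y \<le> lo} + emeasure \<mu> (block_points j)"
    by (intro emeasure_subadditive) auto
  also have "\<dots> \<le> lo + emeasure \<mu> (block_points j)"
    by (intro add_right_mono emeasure_sublevel_le)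
  finally show ?thesis using lo_fin by (auto simp: ennreal_add_left_cancel_le)
qed

lemma block_points_overlap:
  "(ISUM j. (if level_set j \<noteq> {} \<and> x \<in> block_points j then 1 else 0)) \<le> 8"
proof (cases "0 < x")
  case True
  then obtain t where t: "tail u x = ennreal t" "0 < t"
    using tail_pos[OF True] tail_fin[OF True] by (cases "tail u x") auto
  show ?thesis
  \<comment> \<open>The tail \<open>t\<close> lies between \<open>lev (j - 2)\<close> and
    \<open>lev (j + 6)\<close>, which leaves eight indices around
    \<open>2 * log 2 t\<close>.\<close>
  proof (rule count_le[where c = "\<lfloor>2 * log 2 t\<rfloor> - 5"])
    fix j assume j: "level_set j \<noteq> {} \<and> x \<in> block_points j"
    then obtain y where "y \<in> level_set j" by auto
    then have "lev j / 2 \<le> t" "t \<le> 4 * lev j"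
      using block_points_tail[of y j x] j t by (auto simp: block_points_def)
    moreover have "lev (j - 2) = lev j / 2" using lev_add[of "j - 2" 1] by simp
    moreover have "lev (j + 4) < lev (j + 6)" "lev (j + 4) = 4 * lev j"
      using lev_add[of j 2] lev_add[of j 3] lev_pos[of j] by (simp_all)
    ultimately have "lev (j - 2) \<le> t" "\<not> lev (j + 6) \<le> t" by auto
    then show "j \<in> {\<lfloor>2 * log 2 t\<rfloor> - 5..\<lfloor>2 * log 2 t\<rfloor> - 5 + 7}" using t by (auto simp: lev_le_iff)
  qed
qed (simp add: block_points_def)

end

section \<open>Localisation of \<open>f\<close> and the estimate of the local part by
  \<open>B2\<close>\<close>

context problem
begin

definition local_mean :: "(real \<Rightarrow> ennreal) \<Rightarrow> real \<Rightarrow> ennreal"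
  where "local_mean f x = N (\<lambda>y. indicator {(zeta_inv u ^^ 2) x<..<x} y * (K x y * (prim_from ((zeta_inv u ^^ 3) x) f y epowr Q)))"

text \<open>On level \<open>j\<close> the local part sees only this piece of \<open>f\<close>. Since
  the wide levels overlap at most eight times, the \<open>p\<close>-th powers of the norms of the
  pieces are summable.\<close>

definition loc :: "int \<Rightarrow> (real \<Rightarrow> ennreal) \<Rightarrow> real \<Rightarrow> ennreal"
  where "loc j f y = f y * indicator (wide_level j) y"

lemma loc_Mplus: "f \<in> Mplus \<Longrightarrow> loc j f \<in> Mplus"
proof -
  assume "f \<in> Mplus"
  then have [measurable]: "f \<in> borel_measurable (lebesgue_on {0..})" by (simp add: Mplus_def)
  have "indicator (wide_level j) \<in> borel_measurable (lebesgue_on {0..})"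
    by (intro measurable_restrict_space1) (simp add: lebesgue_measurable_of_borel)
  then show ?thesis unfolding Mplus_def loc_def[abs_def] by measurable
qed

lemma prim_from_loc:
  assumes "x \<in> level_set j" "y \<le> x"
  shows "prim_from ((zeta_inv u ^^ 3) x) f y = prim_from ((zeta_inv u ^^ 3) x) (loc j f) y"
  unfolding prim_from_def loc_def using level_set_subset_wide_level[OF assms(1)] assms(2)
  by (intro nn_integral_cong) (auto simp: indicator_def)

lemma pnorm_loc: "pnorm (loc j f) epowr p = (\<integral>\<^sup>+y\<in>{0..}. (f y epowr p) * v y * indicator (wide_level j) y \<partial>lebesgue)"
  using p_pos by (auto simp: wnorm_finite_exponent loc_def indicator_def intro!: nn_integral_cong)

lemma sum_pnorm_loc:
  assumes "f \<in> Mplus" "pnorm f \<le> 1"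
  shows "(ISUM j. pnorm (loc j f) epowr p) \<le> 8"
proof -
  have [measurable]: "f \<in> borel_measurable (lebesgue_on {0..})" "v \<in> borel_measurable (lebesgue_on {0..})"
    using assms v_meas by (auto simp: Mplus_def)
  have [measurable]: "indicator (wide_level j) \<in> borel_measurable (lebesgue_on {0..})" for j
    by (intro measurable_restrict_space1) (simp add: lebesgue_measurable_of_borel)
  have "(ISUM j. pnorm (loc j f) epowr p)
      = (\<integral>\<^sup>+y. (ISUM j. (f y epowr p) * v y * indicator (wide_level j) y) \<partial>lebesgue_on {0..})"
    unfolding pnorm_loc nn_integral_Mplus_eq
    by (subst nn_integral_count_space_nn_integral) auto
  also have "\<dots> = (\<integral>\<^sup>+y. (f y epowr p) * v y * (ISUM j. indicator (wide_level j) y) \<partial>lebesgue_on {0..})"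
    by (subst nn_integral_cmult) auto
  also have "\<dots> \<le> (\<integral>\<^sup>+y. (f y epowr p) * v y * 8 \<partial>lebesgue_on {0..})"
    by (intro nn_integral_mono mult_left_mono wide_level_overlap) simp
  also have "\<dots> = (\<integral>\<^sup>+y. (f y epowr p) * v y \<partial>lebesgue_on {0..}) * 8"
    by (rule nn_integral_multc) measurable
  also have "\<dots> \<le> 1 * 8"
    using assms p_pos by (intro mult_right_mono) (auto simp: wnorm_finite_exponent epowr_le_iff' nn_integral_Mplus_eq)
  finally show ?thesis by simp
qed

lemma pnorm_loc_le_1:
  assumes "f \<in> Mplus" "pnorm f \<le> 1" shows "pnorm (loc j f) \<le> 1"
proof -
  have "pnorm (loc j f) \<le> pnorm f"
    using p_pos unfolding wnorm_finite_exponent[OF p_pos] loc_def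
    by (intro epowr_mono nn_integral_mono mult_right_mono) (auto simp: indicator_def)
  with assms show ?thesis by simp
qed

lemma local_mean_le_kernel_mean:
  assumes "x \<in> level_set j" shows "local_mean f x \<le> kernel_mean (Fq (loc j f)) x"
  unfolding local_mean_def kernel_mean_def
proof (rule N_mono)
  fix y :: real
  have z: "0 \<le> (zeta_inv u ^^ 2) x" "0 \<le> (zeta_inv u ^^ 3) x"
    using assms by (auto simp: level_set_def intro!: zeta_inv_pow_nonneg simp del: funpow.simps)
  show "indicator {(zeta_inv u ^^ 2) x<..<x} y * (K x y * (prim_from ((zeta_inv u ^^ 3) x) f y epowr Q))
      \<le> indicator {0<..<x} y * (K x y * Fq (loc j f) y)"
  proof (cases "y \<in> {(zeta_inv u ^^ 2) x<..<x}")
    case True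
    then have "prim_from ((zeta_inv u ^^ 3) x) f y \<le> prim (loc j f) y"
      using prim_from_loc[OF assms, of y f] prim_from_antimono[OF z(2), of "loc j f" y] by simp
    then have "K x y * (prim_from ((zeta_inv u ^^ 3) x) f y epowr Q) \<le> K x y * Fq (loc j f) y"
      using Q_pos by (intro mult_left_mono epowr_mono) auto
    then show ?thesis using True z by simp
  qed simp
qed

text \<open>\<open>block_points_geometry\<close> enlarges both ranges of integration, and
  \<open>K_right\<close> moves the first argument of the kernel from \<open>x\<close> to the end of
  the block.\<close>

lemma local_mean_le_block:
  assumes x: "x \<in> level_set j" and x': "x' \<in> block_points j"
  shows "local_mean f x \<le> ennreal D * block x' (loc j f)"
proof -
  note g = block_points_geometry[OF x x']
  let ?d = "(zeta u ^^ 2) x'"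
  have x0: "0 < x" using x by (auto simp: level_set_def)
  have "local_mean f x \<le> N (\<lambda>y. ennreal D * (indicator {zeta_inv u x'<..<?d} y
      * (K ?d y * (prim_from (zeta_inv u (zeta_inv u x')) (loc j f) y epowr Q))))"
    unfolding local_mean_def
  proof (rule N_mono)
    fix y :: real assume y0: "0 \<le> y"
    show "indicator {(zeta_inv u ^^ 2) x<..<x} y * (K x y * (prim_from ((zeta_inv u ^^ 3) x) f y epowr Q))
      \<le> ennreal D * (indicator {zeta_inv u x'<..<?d} y * (K ?d y * (prim_from (zeta_inv u (zeta_inv u x')) (loc j f) y epowr Q)))"
    proof (cases "y \<in> {(zeta_inv u ^^ 2) x<..<x}")
      case True
      then have "prim_from ((zeta_inv u ^^ 3) x) f y \<le> prim_from (zeta_inv u (zeta_inv u x')) (loc j f) y"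
        using prim_from_loc[OF x, of y f] prim_from_antimono[OF g(2), of "loc j f" y] by simp
      then have "K x y * (prim_from ((zeta_inv u ^^ 3) x) f y epowr Q)
          \<le> (ennreal D * K ?d y) * (prim_from (zeta_inv u (zeta_inv u x')) (loc j f) y epowr Q)"
        using Q_pos True y0 g(3) by (intro mult_mono epowr_mono K_right) auto
      then show ?thesis using True g by (simp add: mult.assoc del: funpow.simps)
    qed simp
  qed
  also have "\<dots> = ennreal D * block x' (loc j f)"
    unfolding block_mean_def by (rule N_cmult) measurable
  finally show ?thesis .
qed

lemma ennreal_less_divide_powr:
  assumes "ennreal (T powr a) * X < ennreal B" "0 < T" "0 \<le> B"
  shows "X < ennreal (B * T powr (- a))"
proof -
  have inv: "ennreal (T powr a) * ennreal (T powr (- a)) = 1"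
    using assms(2) by (simp add: powr_add[symmetric] flip: ennreal_mult)
  have "ennreal (T powr (- a)) * (ennreal (T powr a) * X) < ennreal (T powr (- a)) * ennreal B"
    using assms by (intro ennreal_mult_strict_left_mono) auto
  then show ?thesis
    using inv assms by (simp add: mult.assoc[symmetric] mult.commute[of "ennreal (T powr (- a))"] ennreal_mult')
qed

text \<open>On level \<open>j\<close> the cut-off operator norm at \<open>x\<close> is at most
  \<open>B\<close> times the power \<open>- 1 / r\<close> of the tail. The weights
  \<open>lev j\<close> then cancel against the masses of the levels, and 12 is \<open>3 / 2\<close>
  from these masses times the overlap 8.\<close>

lemma local_bound_of_le:
  assumes "p \<le> r" and B: "BB2 < ennreal B" "0 < B" and f: "f \<in> Mplus" "pnorm f \<le> 1"
  shows "\<exists>H. (\<forall>x>0. local_mean f x epowr (r / Q) \<le> level_step H x)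
    \<and> (\<integral>\<^sup>+x. level_step H x \<partial>\<mu>) \<le> ennreal (12 * B powr r)"
proof (intro exI conjI allI impI)
  define \<beta> where "\<beta> j = ennreal (B * lev j powr (- 1 / r))" for j
  let ?H = "\<lambda>j. (\<beta> j * pnorm (loc j f)) epowr r"
  fix x :: real assume x0: "0 < x"
  then obtain j where j: "x \<in> level_set j" using ex_level_set by blast
  obtain T where T: "tail u x = ennreal T" "0 < T"
    using tail_pos[OF x0] tail_fin[OF x0] by (cases "tail u x") auto
  have lev_T: "lev j \<le> T" using j T by (auto simp: level_set_def)
  have "ennreal (T powr (1 / r)) * least_const (ennreal p) v (\<lambda>f. kernel_mean (Fq f) x epowr (1 / Q)) \<le> BB2"
    using assms(1) x0 T unfolding B2_def by (auto simp: epowr_ennreal H_cut_op_norm intro!: SUP_upper2[of x])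
  also note B(1)
  finally have "least_const (ennreal p) v (\<lambda>f. kernel_mean (Fq f) x epowr (1 / Q)) < ennreal (B * T powr (- (1 / r)))"
    using T B by (intro ennreal_less_divide_powr) auto
  then have "kernel_mean (Fq (loc j f)) x epowr (1 / Q) \<le> ennreal (B * T powr (- (1 / r))) * pnorm (loc j f)"
    using loc_Mplus[OF f(1)] by (rule least_const_le_imp)
  also have "\<dots> \<le> \<beta> j * pnorm (loc j f)"
  proof -
    have "T powr (- (1 / r)) \<le> lev j powr (- (1 / r))"
      using r_pos by (intro powr_mono2' lev_T) auto
    then have "B * T powr (- (1 / r)) \<le> B * lev j powr (- 1 / r)" using B by simp
    then show ?thesis unfolding \<beta>_def by (intro mult_right_mono ennreal_leI) auto
  qed
  finally have "local_mean f x epowr (1 / Q) \<le> \<beta> j * pnorm (loc j f)"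
    using epowr_mono[OF local_mean_le_kernel_mean[OF j], of "1 / Q" f] Q_pos by (auto intro: order_trans)
  then have "(local_mean f x epowr (1 / Q)) epowr r \<le> ?H j" using r_pos by (rule epowr_mono)
  also have "\<dots> \<le> level_step ?H x" by (rule level_step_ge[OF j])
  finally show "local_mean f x epowr (r / Q) \<le> level_step ?H x"
    using r_pos Q_pos by (simp add: epowr_epowr)
next
  define \<beta> where "\<beta> j = ennreal (B * lev j powr (- 1 / r))" for j
  let ?H = "\<lambda>j. (\<beta> j * pnorm (loc j f)) epowr r"
  have "(\<integral>\<^sup>+x. level_step ?H x \<partial>\<mu>) \<le> (ISUM j. ?H j * ennreal (3 / 2 * lev j))"
    by (rule level_step_bound)
  also have "\<dots> \<le> (ISUM j. ennreal (3 / 2 * B powr r) * (pnorm (loc j f) epowr p))"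
  proof (rule nn_integral_mono)
    fix j
    have "?H j = ennreal (B powr r * (1 / lev j)) * (pnorm (loc j f) epowr r)"
    proof -
      have "(B * lev j powr (- 1 / r)) powr r = B powr r * lev j powr (- 1)"
        using r_pos unfolding powr_mult powr_powr by simp
      then show ?thesis using r_pos B by (simp add: \<beta>_def epowr_mult epowr_ennreal powr_minus_divide)
    qed
    \<comment> \<open>This is where \<open>p \<le> r\<close> enters: norms at most 1 have smaller
      \<open>r\<close>-th than \<open>p\<close>-th powers.\<close>
    also have "\<dots> \<le> ennreal (B powr r * (1 / lev j)) * (pnorm (loc j f) epowr p)"
      using assms(1) p_pos pnorm_loc_le_1[OF f] by (intro mult_left_mono epowr_mono_exponent) auto
    finally have "?H j * ennreal (3 / 2 * lev j) \<le> ennreal (B powr r * (1 / lev j)) * (pnorm (loc j f) epowr p) * ennreal (3 / 2 * lev j)"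
      by (intro mult_right_mono) auto
    also have "\<dots> = ennreal (B powr r * (1 / lev j) * (3 / 2 * lev j)) * (pnorm (loc j f) epowr p)"
      by (subst ennreal_mult) (auto simp: ac_simps)
    also have "B powr r * (1 / lev j) * (3 / 2 * lev j) = 3 / 2 * B powr r" using lev_pos[of j] by simp
    finally show "?H j * ennreal (3 / 2 * lev j) \<le> ennreal (3 / 2 * B powr r) * (pnorm (loc j f) epowr p)" .
  qed
  also have "\<dots> = ennreal (3 / 2 * B powr r) * (ISUM j. pnorm (loc j f) epowr p)"
    by (rule nn_integral_cmult) simp
  also have "\<dots> \<le> ennreal (3 / 2 * B powr r) * ennreal 8"
    using sum_pnorm_loc[OF f] by (intro mult_left_mono) auto
  also have "\<dots> = ennreal (12 * B powr r)" by (subst ennreal_mult[symmetric]) auto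
  finally show "(\<integral>\<^sup>+x. level_step ?H x \<partial>\<mu>) \<le> ennreal (12 * B powr r)" .
qed

text \<open>An infimum over the block points is both below the integrand of \<open>B2\<close>
  throughout a set of substantial mass and nearly attained at a single point. The value 0 on empty
  levels is chosen because the mass bound for \<open>block_points j\<close> is available only for
  nonempty levels.\<close>

definition block_inf :: "int \<Rightarrow> ennreal"
  where "block_inf j = (if level_set j = {} then 0 else (INF x\<in>block_points j. block_norm x))"

text \<open>Each term is dominated by the integral of the \<open>B2\<close> integrand over
  \<open>block_points j\<close>, where both the tail and the mass are at least
  \<open>lev j / 2\<close>; this gives \<open>2 powr (s / r)\<close>, and the overlap of these sets
  gives 8.\<close>

lemma sum_block_inf:
  assumes "r < p" and s: "s = 1 / (1 / r - 1 / p)" and B: "BB2 < ennreal B" "0 < B"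
  shows "(ISUM j. ennreal (lev j powr (s / r)) * (block_inf j epowr s))
    \<le> ennreal (8 * 2 powr (s / r) * B powr s)"
proof -
  note s_pos = dual_exponent(1)[OF r_pos assms(1) s] and sr = dual_exponent(2)[OF r_pos assms(1) s]
  let ?bu = "\<lambda>x. (tail u x epowr (s / p)) * (block_norm x epowr s)"
  let ?h = "\<lambda>j. ennreal ((lev j / 2) powr (s / p)) * (block_inf j epowr s)"
  define G where "G x = (ISUM j. ?h j * indicator (block_points j) x)" for x
  have [measurable]: "G \<in> borel_measurable borel"
    unfolding G_def[abs_def] nn_integral_count_space_int by measurable
  have point: "G x \<le> 8 * ?bu x" for x
  proof -
    have "G x \<le> (ISUM j. ?bu x * (if level_set j \<noteq> {} \<and> x \<in> block_points j then 1 else 0))"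
      unfolding G_def
    proof (rule nn_integral_mono)
      fix j
      show "?h j * indicator (block_points j) x
        \<le> ?bu x * (if level_set j \<noteq> {} \<and> x \<in> block_points j then 1 else 0)"
      proof (cases "level_set j \<noteq> {} \<and> x \<in> block_points j")
        case True
        then obtain y where y: "y \<in> level_set j" by auto
        have "ennreal (lev j / 2) epowr (s / p) \<le> tail u x epowr (s / p)"
          using block_points_tail[OF y] True s_pos p_pos by (intro epowr_mono) auto
        moreover have "block_inf j epowr s \<le> block_norm x epowr s"
          using True s_pos by (intro epowr_mono) (auto simp: block_inf_def intro: INF_lower)
        ultimately show ?thesis using True by (simp add: epowr_ennreal mult_mono)
      next
        case False
        then show ?thesis using s_pos by (auto simp: block_inf_def)
      qed
    qed
    also have "\<dots> = ?bu x * (ISUM j. (if level_set j \<noteq> {} \<and> x \<in> block_points j then 1 else 0))"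
      by (rule nn_integral_cmult) simp
    also have "\<dots> \<le> ?bu x * 8"
      by (intro mult_left_mono block_points_overlap) simp
    finally show ?thesis by (simp add: mult.commute)
  qed
  have inv2: "ennreal (2 powr (s / r)) * ennreal ((lev j / 2) powr (s / p) * (lev j / 2)) = ennreal (lev j powr (s / r))" for j
  proof -
    have "(lev j / 2) powr (s / p) * (lev j / 2) = (lev j / 2) powr (s / r)"
      unfolding sr powr_add by (subst powr_one) auto
    moreover have "2 powr (s / r) * (lev j / 2) powr (s / r) = lev j powr (s / r)"
      by (subst powr_mult[symmetric]) simp
    ultimately show ?thesis by (simp flip: ennreal_mult)
  qed
  have "(ISUM j. ennreal (lev j powr (s / r)) * (block_inf j epowr s))
      \<le> (ISUM j. ennreal (2 powr (s / r)) * (?h j * emeasure \<mu> (block_points j)))"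
  proof (rule nn_integral_mono)
    fix j
    show "ennreal (lev j powr (s / r)) * (block_inf j epowr s)
      \<le> ennreal (2 powr (s / r)) * (?h j * emeasure \<mu> (block_points j))"
    proof (cases "level_set j = {}")
      case True
      then show ?thesis using s_pos by (simp add: block_inf_def)
    next
      case False
      then obtain y where "y \<in> level_set j" by auto
      from emeasure_block_points[OF this]
      have "ennreal (2 powr (s / r)) * (?h j * ennreal (lev j / 2))
        \<le> ennreal (2 powr (s / r)) * (?h j * emeasure \<mu> (block_points j))"
        by (intro mult_left_mono) auto
      moreover have "ennreal (2 powr (s / r)) * (?h j * ennreal (lev j / 2))
        = ennreal (lev j powr (s / r)) * (block_inf j epowr s)"
      proof -
        have "ennreal ((lev j / 2) powr (s / p) * (lev j / 2)) = ennreal ((lev j / 2) powr (s / p)) * ennreal (lev j / 2)"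
          by (rule ennreal_mult) auto
        then show ?thesis unfolding inv2[symmetric] by (simp only: ac_simps)
      qed
      ultimately show ?thesis by simp
    qed
  qed
  also have "\<dots> = ennreal (2 powr (s / r)) * (ISUM j. ?h j * emeasure \<mu> (block_points j))"
    by (rule nn_integral_cmult) simp
  also have "(ISUM j. ?h j * emeasure \<mu> (block_points j)) = (\<integral>\<^sup>+x. G x \<partial>\<mu>)"
    unfolding G_def by (subst nn_integral_count_space_nn_integral) (auto simp: nn_integral_cmult_indicator)
  \<comment> \<open>The constant is taken out of the integral of the Borel function
    \<open>G\<close>, because measurability of \<open>block_norm\<close> in \<open>x\<close> is not
    established; the comparison with the \<open>B2\<close> integrand then uses monotonicity
    alone.\<close>
  also have "(\<integral>\<^sup>+x. G x \<partial>\<mu>) = 8 * (\<integral>\<^sup>+x. (1 / 8) * G x \<partial>\<mu>)"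
  proof -
    have "8 * (1 / 8 :: ennreal) = 1" by (simp add: ennreal_times_divide ennreal_divide_self)
    then show ?thesis by (subst nn_integral_cmult) (auto simp flip: mult.assoc)
  qed
  also have "(\<integral>\<^sup>+x. (1 / 8) * G x \<partial>\<mu>) = (\<integral>\<^sup>+x\<in>{0..}. u x * ((1 / 8) * G x) \<partial>lebesgue)"
    by (rule nn_integral_half_line_measure[OF u_meas]) measurable
  also have "\<dots> \<le> (\<integral>\<^sup>+x\<in>{0..}. u x * ?bu x \<partial>lebesgue)"
  proof (intro nn_integral_mono mult_right_mono)
    fix x
    have "(1 / 8) * G x \<le> (1 / 8) * (8 * ?bu x)"
      by (intro mult_left_mono point) simp
    also have "\<dots> = ?bu x"
    proof -
      have "(1 / 8 :: ennreal) * 8 = 1" by (simp add: mult.commute ennreal_times_divide ennreal_divide_self)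
      then show ?thesis by (simp flip: mult.assoc)
    qed
    finally show "u x * ((1 / 8) * G x) \<le> u x * ?bu x"
      by (simp add: mult.assoc mult_left_mono)
  qed simp
  also have "\<dots> = BB2 epowr s"
    using s_pos unfolding B2_eq_of_less[OF assms(1) s] by (simp add: mult.assoc)
  also have "\<dots> \<le> ennreal B epowr s" using B s_pos by (intro epowr_mono) auto
  finally have "(ISUM j. ennreal (lev j powr (s / r)) * (block_inf j epowr s))
      \<le> ennreal (2 powr (s / r)) * (8 * (ennreal B epowr s))"
    by (simp add: mult_left_mono)
  then show ?thesis using B by (simp add: epowr_ennreal ennreal_mult ac_simps)
qed

text \<open>On level \<open>j\<close> the local part is controlled by \<open>block_inf j\<close>
  times the norm of the localised function. A Young-type inequality with the conjugate exponents
  \<open>s / r\<close> and \<open>p / r\<close> separates the two factors, whose power sums come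
  from \<open>sum_block_inf\<close> and \<open>sum_pnorm_loc\<close>.\<close>

lemma local_bound_of_less:
  assumes "r < p" and s: "s = 1 / (1 / r - 1 / p)" and B: "BB2 < ennreal B" "0 < B"
    and f: "f \<in> Mplus" "pnorm f \<le> 1"
  shows "\<exists>H. (\<forall>x>0. local_mean f x epowr (r / Q) \<le> level_step H x)
    \<and> (\<integral>\<^sup>+x. level_step H x \<partial>\<mu>) \<le> ennreal (3 / 2 * D powr (r / Q) * (8 * 2 powr (s / r) + 8) * B powr r)"
proof -
  note s_pos = dual_exponent(1)[OF r_pos assms(1) s]
  define \<delta> where "\<delta> = D powr (1 / Q)"
  have \<delta>: "0 < \<delta>" using D1 by (simp add: \<delta>_def)
  let ?b = "\<lambda>j. ennreal (lev j powr (s / r)) * (block_inf j epowr s)"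
  have fin: "block_inf j < top" for j
  proof -
    have "?b j
        \<le> (ISUM j. ?b j)"
      using nn_integral_ge_point[of j UNIV] by auto
    also note sum_block_inf[OF assms(1-4)]
    finally have "?b j < top" by (rule le_less_trans) simp
    then have "block_inf j epowr s < top" by (auto simp: ennreal_mult_less_top)
    then show ?thesis by (cases "block_inf j") auto
  qed
  let ?H = "\<lambda>j. (ennreal \<delta> * (block_inf j * pnorm (loc j f))) epowr r"
  show ?thesis
  proof (intro exI[of _ ?H] conjI allI impI)
    fix x :: real assume x0: "0 < x"
    then obtain j where j: "x \<in> level_set j" using ex_level_set by blast
    have "local_mean f x epowr (1 / Q) \<le> ennreal \<delta> * (block_inf j * pnorm (loc j f))"
    proof (rule ennreal_le_epsilon)
      fix e :: real assume e: "0 < e"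
      have "block_inf j < block_inf j + ennreal (e / \<delta>)"
        using fin[of j] e \<delta> by (cases "block_inf j") (auto intro!: ennreal_lessI add_nonneg_pos simp flip: ennreal_plus)
      moreover have "block_inf j = (INF x\<in>block_points j. block_norm x)"
        using j by (auto simp: block_inf_def)
      ultimately have "(INF x\<in>block_points j. block_norm x) < block_inf j + ennreal (e / \<delta>)" by simp
      \<comment> \<open>The infimum need not be attained; the error \<open>e / \<delta>\<close> is
        calibrated so that exactly \<open>e\<close> remains after multiplication by
        \<open>\<delta>\<close>.\<close>
      then obtain x' where x': "x' \<in> block_points j" "block_norm x' < block_inf j + ennreal (e / \<delta>)"
        unfolding INF_less_iff by blast
      have "local_mean f x epowr (1 / Q) \<le> (ennreal D * block x' (loc j f)) epowr (1 / Q)"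
        using Q_pos by (intro epowr_mono local_mean_le_block[OF j x'(1)]) simp
      also have "\<dots> = ennreal \<delta> * (block x' (loc j f) epowr (1 / Q))"
        using Q_pos D1 by (simp add: epowr_mult epowr_ennreal \<delta>_def)
      also have "\<dots> \<le> ennreal \<delta> * ((block_inf j + ennreal (e / \<delta>)) * pnorm (loc j f))"
        by (intro mult_left_mono least_const_le_imp[OF x'(2)] loc_Mplus f) simp
      also have "\<dots> \<le> ennreal \<delta> * (block_inf j * pnorm (loc j f) + ennreal (e / \<delta>) * 1)"
        using pnorm_loc_le_1[OF f, of j] unfolding distrib_right by (intro mult_left_mono add_left_mono) auto
      also have "\<dots> = ennreal \<delta> * (block_inf j * pnorm (loc j f)) + ennreal e"
        using \<delta> e by (simp add: distrib_left flip: ennreal_mult)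
      finally show "local_mean f x epowr (1 / Q) \<le> ennreal \<delta> * (block_inf j * pnorm (loc j f)) + ennreal e" .
    qed
    then have "(local_mean f x epowr (1 / Q)) epowr r \<le> ?H j" using r_pos by (rule epowr_mono)
    also have "\<dots> \<le> level_step ?H x" by (rule level_step_ge[OF j])
    finally show "local_mean f x epowr (r / Q) \<le> level_step ?H x"
      using r_pos Q_pos by (simp add: epowr_epowr)
  next
    let ?c = "3 / 2 * \<delta> powr r * B powr r"
    have c0: "0 \<le> ?c" by simp
    have "(\<integral>\<^sup>+x. level_step ?H x \<partial>\<mu>) \<le> (ISUM j. ?H j * ennreal (3 / 2 * lev j))"
      by (rule level_step_bound)
    also have "\<dots> \<le> (ISUM j. ennreal ?c * (ennreal (B powr (- s)) * ?b j + pnorm (loc j f) epowr p))"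
    proof (rule nn_integral_mono)
      fix j
      obtain b where b: "block_inf j = ennreal b" "0 \<le> b" using fin[of j] by (cases "block_inf j") auto
      \<comment> \<open>The factor \<open>B powr (- r)\<close> normalises the first sum to a bound
        independent of \<open>B\<close>, so that the final bound is homogeneous of degree
        \<open>r\<close> in \<open>B\<close>.\<close>
      let ?a = "ennreal (lev j * b powr r * B powr (- r))"
      have "?a * (pnorm (loc j f) epowr r) \<le> (?a epowr (s / r)) + ((pnorm (loc j f) epowr r) epowr (p / r))"
      proof (rule mult_le_epowr_add)
        have "1 / s = 1 / r - 1 / p" using s by simp
        moreover have "1 / (s / r) + 1 / (p / r) = r * (1 / s + 1 / p)" by (simp add: distrib_left)
        ultimately show "1 / (s / r) + 1 / (p / r) = 1" using r_pos by simp
      qed (use s_pos r_pos p_pos in auto)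
      also have "?a epowr (s / r) = ennreal (B powr (- s)) * ?b j"
        using b r_pos B by (simp add: epowr_ennreal powr_mult powr_powr ac_simps flip: ennreal_mult)
      also have "(pnorm (loc j f) epowr r) epowr (p / r) = pnorm (loc j f) epowr p"
        using r_pos p_pos by (simp add: epowr_epowr)
      finally have le: "?a * (pnorm (loc j f) epowr r)
        \<le> ennreal (B powr (- s)) * ?b j + pnorm (loc j f) epowr p" .
      have "?H j * ennreal (3 / 2 * lev j) = ennreal (\<delta> powr r * b powr r * (3 / 2 * lev j)) * (pnorm (loc j f) epowr r)"
      proof -
        have "ennreal (\<delta> powr r * b powr r * (3 / 2 * lev j)) = ennreal (\<delta> powr r) * ennreal (b powr r) * ennreal (3 / 2 * lev j)"
          by (subst ennreal_mult, simp, simp, subst ennreal_mult) auto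
        moreover have "?H j = ennreal (\<delta> powr r) * (ennreal (b powr r) * (pnorm (loc j f) epowr r))"
          using b r_pos \<delta> by (simp add: epowr_mult epowr_ennreal)
        ultimately show ?thesis by (simp only: ac_simps)
      qed
      also have "\<delta> powr r * b powr r * (3 / 2 * lev j) = ?c * (lev j * b powr r * B powr (- r))"
      proof -
        have "B powr r * B powr (- r) = 1" using B by (simp add: powr_add[symmetric])
        then show ?thesis by (simp add: ac_simps)
      qed
      also have "ennreal (?c * (lev j * b powr r * B powr (- r))) * (pnorm (loc j f) epowr r) = ennreal ?c * (?a * (pnorm (loc j f) epowr r))"
        by (subst ennreal_mult) (auto simp: mult.assoc)
      also have "\<dots> \<le> ennreal ?c * (ennreal (B powr (- s)) * ?b j + pnorm (loc j f) epowr p)"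
        by (intro mult_left_mono le) simp
      finally show "?H j * ennreal (3 / 2 * lev j) \<le> ennreal ?c * (ennreal (B powr (- s)) * ?b j + pnorm (loc j f) epowr p)" .
    qed
    also have "\<dots> = ennreal ?c * (ennreal (B powr (- s)) * (ISUM j. ?b j)
        + (ISUM j. pnorm (loc j f) epowr p))"
      by (simp add: nn_integral_cmult nn_integral_add)
    also have "\<dots> \<le> ennreal ?c * (ennreal (B powr (- s)) * ennreal (8 * 2 powr (s / r) * B powr s) + 8)"
      by (intro mult_left_mono add_mono sum_block_inf[OF assms(1-4)] sum_pnorm_loc[OF f]) auto
    also have "ennreal (B powr (- s)) * ennreal (8 * 2 powr (s / r) * B powr s) = ennreal (8 * 2 powr (s / r))"
    proof -
      have "B powr (- s) * B powr s = 1" using B by (simp add: powr_add[symmetric])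
      then have "B powr (- s) * (8 * 2 powr (s / r) * B powr s) = 8 * 2 powr (s / r)" by (simp add: mult.left_commute)
      then show ?thesis by (subst ennreal_mult[symmetric]) auto
    qed
    also have "ennreal ?c * (ennreal (8 * 2 powr (s / r)) + 8) = ennreal (?c * (8 * 2 powr (s / r) + 8))"
      by (subst ennreal_mult) auto
    also have "?c * (8 * 2 powr (s / r) + 8) = 3 / 2 * D powr (r / Q) * (8 * 2 powr (s / r) + 8) * B powr r"
      by (simp add: \<delta>_def powr_powr)
    finally show "(\<integral>\<^sup>+x. level_step ?H x \<partial>\<mu>) \<le> ennreal (3 / 2 * D powr (r / Q) * (8 * 2 powr (s / r) + 8) * B powr r)" .
  qed
qed

end

section \<open>The two-sided estimate\<close>

definition local_const :: "real \<Rightarrow> real \<Rightarrow> real \<Rightarrow> real \<Rightarrow> real"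
  where "local_const p r Q D = (if p \<le> r then 12
    else 3 / 2 * D powr (r / Q) * (8 * 2 powr (1 / (1 / r - 1 / p) / r) + 8))"

text \<open>\<open>4 powr (r / Q)\<close> comes from two uses of \<open>epowr_add_le\<close>,
  \<open>2 powr r\<close> from splitting the primitive, and the summands of
  \<open>2 + local_const\<close> from \<open>B0\<close>, \<open>B1\<close> and the local
  part.\<close>

definition upper_const :: "real \<Rightarrow> real \<Rightarrow> real \<Rightarrow> real \<Rightarrow> nat \<Rightarrow> real"
  where "upper_const p r Q D m = (absorb_const D m (r / Q) * (4 powr (r / Q) * 2 powr r * (2 + local_const p r Q D))) powr (1 / r)"

definition lower_const :: "real \<Rightarrow> real \<Rightarrow> real \<Rightarrow> real \<Rightarrow> real"
  where "lower_const p r Q D = 1 + D powr (1 / Q) +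
    (if p \<le> r then D powr (1 / Q) else 2 * (24 * D powr (r / Q)) powr (1 / r))"

lemma local_const_pos: "0 < D \<Longrightarrow> 0 < local_const p r Q D"
  by (auto simp: local_const_def intro!: mult_pos_pos add_nonneg_pos)

lemma upper_const_pos: "1 \<le> D \<Longrightarrow> 0 < upper_const p r Q D m"
  using local_const_pos[of D p r Q] by (auto simp: upper_const_def absorb_const_def)

context problem
begin

lemma local_bound:
  assumes "BB2 < ennreal B" "0 < B" "f \<in> Mplus" "pnorm f \<le> 1"
  obtains H where "\<And>x. 0 < x \<Longrightarrow> local_mean f x epowr (r / Q) \<le> level_step H x"
    "(\<integral>\<^sup>+x. level_step H x \<partial>\<mu>) \<le> ennreal (local_const p r Q D * B powr r)"
proof (cases "p \<le> r")
  case True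
  with local_bound_of_le[OF True assms] that show thesis by (auto simp: local_const_def)
next
  case False
  then have "r < p" by simp
  from local_bound_of_less[OF this refl assms] False that show thesis by (auto simp: local_const_def)
qed

text \<open>The primitive is split at \<open>(zeta_inv u ^^ 3) x\<close>: the part accumulated
  before that point yields the \<open>B0\<close> integrand after enlarging the interval, the rest is
  the local part.\<close>

lemma split_mean_le:
  assumes "f \<in> Mplus" "0 < x"
  shows "split_mean (Fq f) x ((zeta_inv u ^^ 2) x)
    \<le> B1_integrand f x + ennreal (2 powr Q) * (B0_integrand f x + local_mean f x)"
proof -
  let ?z2 = "(zeta_inv u ^^ 2) x" and ?z3 = "(zeta_inv u ^^ 3) x"
  have z: "0 \<le> ?z3" "?z3 \<le> ?z2"
    using assms by (auto intro!: zeta_inv_pow_nonneg zeta_inv_pow_antimono simp del: funpow.simps)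
  have "N (\<lambda>y. indicator {?z2<..<x} y * (K x y * Fq f y))
      \<le> N (\<lambda>y. ennreal (2 powr Q) * (Fq f ?z3 * (indicator {?z3<..<x} y * K x y)
          + indicator {?z2<..<x} y * (K x y * (prim_from ?z3 f y epowr Q))))"
  proof (rule N_mono)
    fix y :: real
    show "indicator {?z2<..<x} y * (K x y * Fq f y) \<le> ennreal (2 powr Q) * (Fq f ?z3 * (indicator {?z3<..<x} y * K x y)
          + indicator {?z2<..<x} y * (K x y * (prim_from ?z3 f y epowr Q)))"
    proof (cases "y \<in> {?z2<..<x}")
      case True
      have "prim f y \<le> prim f ?z3 + prim_from ?z3 f y"
        using assms(1) z(1) by (rule prim_le_add_prim_from)
      then have "Fq f y \<le> (prim f ?z3 + prim_from ?z3 f y) epowr Q" using Q_pos by (rule epowr_mono)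
      also have "\<dots> \<le> ennreal (2 powr Q) * (Fq f ?z3 + prim_from ?z3 f y epowr Q)"
        using Q_pos by (rule epowr_add_le)
      finally have "K x y * Fq f y \<le> K x y * (ennreal (2 powr Q) * (Fq f ?z3 + prim_from ?z3 f y epowr Q))"
        by (rule mult_left_mono) simp
      then show ?thesis using True z by (simp add: distrib_left ac_simps del: funpow.simps)
    qed simp
  qed
  also have "\<dots> = ennreal (2 powr Q) * N (\<lambda>y. Fq f ?z3 * (indicator {?z3<..<x} y * K x y)
          + indicator {?z2<..<x} y * (K x y * (prim_from ?z3 f y epowr Q)))"
    by (rule N_cmult) measurable
  also have "\<dots> \<le> ennreal (2 powr Q) * (N (\<lambda>y. Fq f ?z3 * (indicator {?z3<..<x} y * K x y)) + local_mean f x)"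
    unfolding local_mean_def by (intro mult_left_mono N_add) measurable
  also have "N (\<lambda>y. Fq f ?z3 * (indicator {?z3<..<x} y * K x y)) = B0_integrand f x"
    unfolding B0_integrand_def by (subst N_cmult) (auto simp: mult.commute)
  finally show ?thesis
    unfolding split_mean_def B1_integrand_def by (intro add_left_mono)
qed

lemma S_norm_le:
  assumes B: "BB0 < ennreal B" "BB1 < ennreal B" "BB2 < ennreal B" "0 < B"
    and f: "f \<in> Mplus" "pnorm f \<le> 1" and m: "2 * (2 * D) powr (r / Q) \<le> 4 ^ Suc m"
  shows "S_norm f \<le> ennreal (upper_const p r Q D m * B)"
proof -
  note [measurable] = measurable_B0_integrand measurable_B1_integrand
  have rQ: "0 < r / Q" using r_pos Q_pos by simp
  define L where "L = local_const p r Q D"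
  have L: "0 < L" using local_const_pos D1 by (simp add: L_def)
  have bnd: "rint g \<le> ennreal (B powr r)"
    if "rint g epowr (1 / r) \<le> ennreal B * pnorm f" for g
  proof -
    have "rint g epowr (1 / r) \<le> ennreal B * 1"
      using that f(2) by (meson mult_left_mono order_trans zero_le)
    then show ?thesis using r_pos B(4) by (simp add: epowr_le_iff' epowr_ennreal)
  qed
  have I0: "rint (B0_integrand f) \<le> ennreal (B powr r)"
    using B(1) f(1) unfolding B0_eq by (intro bnd least_const_le_imp)
  have I1: "rint (B1_integrand f) \<le> ennreal (B powr r)"
    using B(2) f(1) unfolding B1_eq by (intro bnd least_const_le_imp)
  obtain H where H: "\<And>x. 0 < x \<Longrightarrow> local_mean f x epowr (r / Q) \<le> level_step H x"
    "(\<integral>\<^sup>+x. level_step H x \<partial>\<mu>) \<le> ennreal (L * B powr r)"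
    using local_bound[OF B(3,4) f] unfolding L_def by metis
  have "(\<integral>\<^sup>+x. split_mean (Fq f) x ((zeta_inv u ^^ 2) x) epowr (r / Q) \<partial>\<mu>)
      \<le> (\<integral>\<^sup>+x. ennreal (4 powr (r / Q) * 2 powr r)
          * ((B1_integrand f x epowr (r / Q)) + ((B0_integrand f x epowr (r / Q)) + level_step H x)) \<partial>\<mu>)"
  proof (rule nn_integral_mono_AE, use AE_mu_pos in eventually_elim)
    fix x :: real assume x: "0 < x"
    let ?X = "B1_integrand f x" and ?Y = "B0_integrand f x" and ?Z = "local_mean f x"
    have two: "1 \<le> (2::real) powr Q" using Q_pos by (simp add: ge_one_powr_ge_zero)
    have "split_mean (Fq f) x ((zeta_inv u ^^ 2) x) \<le> ennreal (2 powr Q) * (?X + (?Y + ?Z))"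
    proof -
      have "1 * ?X \<le> ennreal (2 powr Q) * ?X" using two by (intro mult_right_mono) auto
      then show ?thesis
        using order_trans[OF split_mean_le[OF f(1) x] add_right_mono] unfolding distrib_left[of _ ?X] by simp
    qed
    then have "split_mean (Fq f) x ((zeta_inv u ^^ 2) x) epowr (r / Q) \<le> (ennreal (2 powr Q) * (?X + (?Y + ?Z))) epowr (r / Q)"
      using rQ by (rule epowr_mono)
    also have "\<dots> = ennreal (2 powr r) * ((?X + (?Y + ?Z)) epowr (r / Q))"
      using rQ Q_pos by (simp add: epowr_mult epowr_ennreal powr_powr)
    also have "(?X + (?Y + ?Z)) epowr (r / Q) \<le> ennreal (2 powr (r / Q)) * (?X epowr (r / Q) + (?Y + ?Z) epowr (r / Q))"
      using rQ by (rule epowr_add_le)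
    also have "(?Y + ?Z) epowr (r / Q) \<le> ennreal (2 powr (r / Q)) * (?Y epowr (r / Q) + ?Z epowr (r / Q))"
      using rQ by (rule epowr_add_le)
    also have "?X epowr (r / Q) + ennreal (2 powr (r / Q)) * (?Y epowr (r / Q) + ?Z epowr (r / Q))
        \<le> ennreal (2 powr (r / Q)) * (?X epowr (r / Q)) + ennreal (2 powr (r / Q)) * (?Y epowr (r / Q) + level_step H x)"
    proof (intro add_mono mult_left_mono H x order_refl)
      have "1 \<le> (2::real) powr (r / Q)" using rQ by (simp add: ge_one_powr_ge_zero)
      then have "1 * (?X epowr (r / Q)) \<le> ennreal (2 powr (r / Q)) * (?X epowr (r / Q))"
        by (intro mult_right_mono) auto
      then show "?X epowr (r / Q) \<le> ennreal (2 powr (r / Q)) * (?X epowr (r / Q))" by simp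
    qed simp
    also have "ennreal (2 powr r) * (ennreal (2 powr (r / Q)) * (ennreal (2 powr (r / Q)) * (?X epowr (r / Q))
        + ennreal (2 powr (r / Q)) * (?Y epowr (r / Q) + level_step H x)))
      = ennreal (4 powr (r / Q) * 2 powr r) * (?X epowr (r / Q) + (?Y epowr (r / Q) + level_step H x))"
    proof -
      have "(4::real) powr (r / Q) = 2 powr (r / Q) * 2 powr (r / Q)" by (subst powr_mult[symmetric]) simp
      then have "ennreal (4 powr (r / Q) * 2 powr r) = ennreal (2 powr r) * (ennreal (2 powr (r / Q)) * ennreal (2 powr (r / Q)))"
        by (simp add: ac_simps flip: ennreal_mult)
      then show ?thesis unfolding distrib_left[symmetric] by (simp only: mult.assoc)
    qed
    finally show "split_mean (Fq f) x ((zeta_inv u ^^ 2) x) epowr (r / Q)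
      \<le> ennreal (4 powr (r / Q) * 2 powr r) * (?X epowr (r / Q) + (?Y epowr (r / Q) + level_step H x))"
      by (simp add: mult_left_mono add_left_mono)
  qed
  also have "\<dots> = ennreal (4 powr (r / Q) * 2 powr r) * (rint (B1_integrand f)
      + (rint (B0_integrand f) + (\<integral>\<^sup>+x. level_step H x \<partial>\<mu>)))"
    by (simp add: nn_integral_cmult nn_integral_add)
  also have "\<dots> \<le> ennreal (4 powr (r / Q) * 2 powr r) * (ennreal (B powr r) + (ennreal (B powr r) + ennreal (L * B powr r)))"
    by (intro mult_left_mono add_mono I0 I1 H(2)) simp
  also have "\<dots> = ennreal (4 powr (r / Q) * 2 powr r * ((2 + L) * B powr r))"
    using L by (simp add: algebra_simps flip: ennreal_plus ennreal_mult)
  finally have split: "(\<integral>\<^sup>+x. split_mean (Fq f) x ((zeta_inv u ^^ 2) x) epowr (r / Q) \<partial>\<mu>)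
      \<le> ennreal (4 powr (r / Q) * 2 powr r * ((2 + L) * B powr r))" .
  have abs0: "0 \<le> absorb_const D m (r / Q)" by (simp add: absorb_const_def)
  have "rint (kernel_mean (Fq f))
      \<le> ennreal (absorb_const D m (r / Q)) * (\<integral>\<^sup>+x. split_mean (Fq f) x ((zeta_inv u ^^ 2) x) epowr (r / Q) \<partial>\<mu>)"
    by (rule nn_integral_kernel_mean_le[OF measurable_Fq rQ m])
  also have "\<dots> \<le> ennreal (absorb_const D m (r / Q)) * ennreal (4 powr (r / Q) * 2 powr r * ((2 + L) * B powr r))"
    by (intro mult_left_mono split) simp
  also have "\<dots> = ennreal (absorb_const D m (r / Q) * (4 powr (r / Q) * 2 powr r * (2 + L)) * B powr r)"
    using abs0 by (simp add: mult.assoc flip: ennreal_mult')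
  finally have "S_norm f \<le> ennreal (absorb_const D m (r / Q) * (4 powr (r / Q) * 2 powr r * (2 + L)) * B powr r) epowr (1 / r)"
    unfolding S_norm_def using r_pos by (intro epowr_mono) auto
  also have "\<dots> = ennreal (upper_const p r Q D m * B)"
    using abs0 L B(4) r_pos by (simp add: epowr_ennreal powr_mult powr_powr upper_const_def L_def)
  finally show ?thesis .
qed

text \<open>The margin \<open>e / ?c\<close> puts \<open>B\<close> strictly above all three
  constants and keeps it positive even if they vanish; it contributes only \<open>e\<close> to the
  final bound.\<close>

lemma C_S_le:
  assumes m: "2 * (2 * D) powr (r / Q) \<le> 4 ^ Suc m"
  shows "CS \<le> ennreal (upper_const p r Q D m) * (BB0 + BB1 + BB2)"
proof -
  let ?T = "BB0 + BB1 + BB2" and ?c = "upper_const p r Q D m"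
  have c: "0 < ?c" using upper_const_pos D1 by simp
  show ?thesis
  proof (cases ?T)
    case (real t)
    show ?thesis
    proof (rule ennreal_le_epsilon)
      fix e :: real assume e: "0 < e"
      define B where "B = t + e / ?c"
      have B: "0 < B" "?T < ennreal B" using real e c by (auto simp: B_def intro!: ennreal_lessI add_nonneg_pos)
      have "BB0 \<le> ?T" "BB1 \<le> ?T" "BB2 \<le> ?T"
        by (auto intro: add_increasing add_increasing2)
      then have "BB0 < ennreal B" "BB1 < ennreal B" "BB2 < ennreal B"
        using le_less_trans[OF _ B(2)] by blast+
      then have "CS \<le> ennreal (?c * B)"
        unfolding C_S_eq' using c B(1) m
        by (intro least_const_unit_ball homogeneous_S_norm p_pos v_meas S_norm_le) auto
      also have "?c * B = ?c * t + e" using c by (simp add: B_def distrib_left)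
      finally show "CS \<le> ennreal ?c * ?T + ennreal e"
        using real c e by (simp add: ennreal_mult)
    qed
  next
    case top
    show ?thesis unfolding top using c by (simp add: ennreal_mult_top ennreal_eq_0_iff not_le)
  qed
qed

lemma sum_le_C_S:
  "BB0 + BB1 + BB2 \<le> ennreal (lower_const p r Q D) * CS"
proof -
  have "BB2 \<le> ennreal (if p \<le> r then D powr (1 / Q) else 2 * (24 * D powr (r / Q)) powr (1 / r)) * CS"
    using B2_le_C_S_of_le B2_le_C_S_of_less by auto
  with B0_le_C_S B1_le_C_S
  have "BB0 + BB1 + BB2
    \<le> CS + ennreal (D powr (1 / Q)) * CS
      + ennreal (if p \<le> r then D powr (1 / Q) else 2 * (24 * D powr (r / Q)) powr (1 / r)) * CS"
    by (intro add_mono)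
  also have "\<dots> = ennreal (lower_const p r Q D) * CS"
    unfolding lower_const_def by (subst ennreal_plus, simp, simp, subst ennreal_plus) (auto simp: distrib_right)
  finally show ?thesis .
qed

end

theorem theorem5p2:
  fixes p r D :: real and q :: ennreal
  assumes "1 \<le> p" and "0 < r" and "0 < q" and "1 \<le> D"
  shows "\<exists>K1 K2 :: real. 0 < K1 \<and> 0 < K2 \<and>
    (\<forall>(u :: real \<Rightarrow> ennreal) (v :: real \<Rightarrow> ennreal) (w :: real \<Rightarrow> ennreal) (k :: real \<Rightarrow> real \<Rightarrow> real).
      u \<in> Mplus \<and> v \<in> Mplus \<and> w \<in> Mplus \<and>
      (\<forall>t>0. 0 < tail u t \<and> tail u t < \<infinity>) \<and> oinarov_kernel D k \<longrightarrow>
        (C_S p r q u v w k < \<infinity> \<longleftrightarrow>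
           B0 p r q u v w k < \<infinity> \<and> B1 p r q u v w k < \<infinity> \<and> B2 p r q u v w k < \<infinity>) \<and>
        C_S p r q u v w k \<le> ennreal K1 * (B0 p r q u v w k + B1 p r q u v w k + B2 p r q u v w k) \<and>
        B0 p r q u v w k + B1 p r q u v w k + B2 p r q u v w k \<le> ennreal K2 * C_S p r q u v w k)"
proof -
  let ?Q = "mean_exponent q"
  \<comment> \<open>The number of steps is fixed before the weights and the kernel are introduced,
    so the constants depend on \<open>p\<close>, \<open>q\<close>, \<open>r\<close>,
    \<open>D\<close> only.\<close>
  obtain m0 :: nat where "2 * (2 * D) powr (r / ?Q) < 4 ^ m0"
    using real_arch_pow[of 4 "2 * (2 * D) powr (r / ?Q)"] by auto
  also have "(4::real) ^ m0 \<le> 4 ^ Suc m0" by (rule power_increasing) auto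
  finally have m: "2 * (2 * D) powr (r / ?Q) \<le> 4 ^ Suc m0" by simp
  have K1: "0 < upper_const p r ?Q D m0" using upper_const_pos assms(4) by simp
  have K2: "0 < lower_const p r ?Q D" unfolding lower_const_def by (intro add_pos_nonneg) auto
  show ?thesis
  proof (rule exI[of _ "upper_const p r ?Q D m0"], rule exI[of _ "lower_const p r ?Q D"], intro conjI K1 K2 allI impI; elim conjE)
    fix u v w :: "real \<Rightarrow> ennreal" and k :: "real \<Rightarrow> real \<Rightarrow> real"
    assume asm: "u \<in> Mplus" "v \<in> Mplus" "w \<in> Mplus" "\<forall>t>0. 0 < tail u t \<and> tail u t < \<infinity>" "oinarov_kernel D k"
    obtain w' where w': "w' \<in> borel_measurable borel" "AE y in lborel. 0 \<le> y \<longrightarrow> w y = w' y"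
      using Mplus_borel_version[OF asm(3)] .
    interpret problem u p r q v w k D w'
      using asm assms w' by unfold_locales auto
    let ?T = "B0 p r q u v w k + B1 p r q u v w k + B2 p r q u v w k"
    show le: "C_S p r q u v w k \<le> ennreal (upper_const p r ?Q D m0) * ?T" by (rule C_S_le[OF m])
    show ge: "?T \<le> ennreal (lower_const p r ?Q D) * C_S p r q u v w k" by (rule sum_le_C_S)
    have "C_S p r q u v w k < top \<longleftrightarrow> ?T < top"
    proof
      assume "C_S p r q u v w k < top"
      then show "?T < top" by (intro le_less_trans[OF ge]) (simp add: ennreal_mult_less_top)
    next
      assume "?T < top"
      then show "C_S p r q u v w k < top" by (intro le_less_trans[OF le]) (simp add: ennreal_mult_less_top)
    qed
    then show "C_S p r q u v w k < \<infinity> \<longleftrightarrow>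
        B0 p r q u v w k < \<infinity> \<and> B1 p r q u v w k < \<infinity> \<and> B2 p r q u v w k < \<infinity>"
      by (auto simp: less_top)
  qed
qed

end
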